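(* The nonlocality threshold of the three-qubit W state under projective measurements satisfies $$v_c^{\mathrm{W}_3}\leq\frac{1000910150415}{314450816715+210987849189\sqrt5+\sqrt{565536694605181420689075+230287482340357705773330\sqrt5}}\approx 0.548236 .$$
   Context: Let $|\mathrm{W}_3\rangle=\frac{|001\rangle+|010\rangle+|100\rangle}{\sqrt3}\in(\mathbb{C}^2)^{\otimes3}$ and, for $v\in[0,1]$, $\rho_v=v\,|\mathrm{W}_3\rangle\langle\mathrm{W}_3|+(1-v)\frac{I}{8}$. Each of three parties $n=1,2,3$ measures one qubit with an observable $\hat x_n\cdot\vec\sigma$, where $\hat x_n$ is a unit vector of $\mathbb{R}^3$ and $\vec\sigma$ is the vector of Pauli matrices, with outcome $a_n=\pm1$. The outcome probabilities are $p_v(a_1a_2a_3|\hat x_1\hat x_2\hat x_3)=\mathrm{Tr}\big[\rho_v\bigotimes_{n=1}^3\frac{I+a_n\hat x_n\cdot\vec\sigma}{2}\big]$; thus all correlators, including one- and two-party marginals, are taken into account. The state $\rho_v$ is local under projective measurements if there are a probability space $(\Lambda,\mu)$ and conditional probabilities $p^{(n)}_\lambda(a_n|\hat x_n)$, measurable in $\lambda$, such that for all outcomes $a_1,a_2,a_3\in\{\pm1\}$ and all unit vectors $\hat x_1,\hat x_2,\hat x_3\in\mathbb{R}^3$, $p_v(a_1a_2a_3|\hat x_1\hat x_2\hat x_3)=\int_\Lambda\prod_{n=1}^3p^{(n)}_\lambda(a_n|\hat x_n)\,d\mu(\lambda)$. The threshold $v_c^{\mathrm{W}_3}$ is the supremum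 of the $v\in[0,1]$ for which $\rho_v$ is local under projective measurements. *)

theory Defs
  imports "HOL-Probability.Probability"
begin

type_synonym qubit = "complex ^ 2"
type_synonym qubit_op = "complex ^ 2 ^ 2"
type_synonym three_qubit = "complex ^ (2 \<times> 2 \<times> 2)"
type_synonym three_qubit_op = "complex ^ (2 \<times> 2 \<times> 2) ^ (2 \<times> 2 \<times> 2)"

text \<open>Index \<open>1\<close> of type \<open>2\<close> is the basis vector \<open>|0>\<close> and index \<open>2\<close> (which equals \<open>0\<close>) is \<open>|1>\<close>.\<close>

definition ket0 :: qubit where "ket0 = vector [1, 0]"
definition ket1 :: qubit where "ket1 = vector [0, 1]"

definition tensor_vec3 :: "qubit \<Rightarrow> qubit \<Rightarrow> qubit \<Rightarrow> three_qubit" where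
  "tensor_vec3 u v w = vec_lambda (\<lambda>(i, j, k). u $ i * v $ j * w $ k)"

definition tensor_op3 :: "qubit_op \<Rightarrow> qubit_op \<Rightarrow> qubit_op \<Rightarrow> three_qubit_op" where
  "tensor_op3 A B C =
     vec_lambda (\<lambda>(i, j, k). vec_lambda (\<lambda>(i', j', k'). A $ i $ i' * B $ j $ j' * C $ k $ k'))"

definition ket_bra :: "three_qubit \<Rightarrow> three_qubit_op" where
  "ket_bra \<psi> = (\<chi> i j. \<psi> $ i * cnj (\<psi> $ j))"

definition W3 :: three_qubit where
  "W3 = (1 / sqrt 3) *\<^sub>R
     (tensor_vec3 ket0 ket0 ket1 + tensor_vec3 ket0 ket1 ket0 + tensor_vec3 ket1 ket0 ket0)"

definition rho_W3 :: "real \<Rightarrow> three_qubit_op" where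
  "rho_W3 v = v *\<^sub>R ket_bra W3 + (1 - v) *\<^sub>R ((1 / 8) *\<^sub>R mat 1)"

definition pauli_x :: qubit_op where "pauli_x = vector [vector [0, 1], vector [1, 0]]"
definition pauli_y :: qubit_op where "pauli_y = vector [vector [0, - \<i>], vector [\<i>, 0]]"
definition pauli_z :: qubit_op where "pauli_z = vector [vector [1, 0], vector [0, - 1]]"

definition observable :: "real ^ 3 \<Rightarrow> qubit_op" where
  "observable x = x $ 1 *\<^sub>R pauli_x + x $ 2 *\<^sub>R pauli_y + x $ 3 *\<^sub>R pauli_z"

definition effect :: "real \<Rightarrow> real ^ 3 \<Rightarrow> qubit_op" where
  "effect a x = (1 / 2) *\<^sub>R (mat 1 + a *\<^sub>R observable x)"

definition outcome_prob ::
    "three_qubit_op \<Rightarrow> real \<Rightarrow> real \<Rightarrow> real \<Rightarrow> real ^ 3 \<Rightarrow> real ^ 3 \<Rightarrow> real ^ 3 \<Rightarrow> complex" where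
  "outcome_prob \<rho> a1 a2 a3 x1 x2 x3 =
     trace (\<rho> ** tensor_op3 (effect a1 x1) (effect a2 x2) (effect a3 x3))"

definition response_function :: "'l measure \<Rightarrow> ('l \<Rightarrow> real \<Rightarrow> real ^ 3 \<Rightarrow> real) \<Rightarrow> bool" where
  "response_function M p \<longleftrightarrow>
     (\<forall>x. norm x = 1 \<longrightarrow>
        (\<forall>a\<in>{1, - 1}. (\<lambda>l. p l a x) \<in> borel_measurable M) \<and>
        (\<forall>l\<in>space M. (\<forall>a\<in>{1, - 1}. 0 \<le> p l a x) \<and> (\<Sum>a\<in>{1, - 1}. p l a x) = 1))"

text \<open>HOL has no existential quantifier over types, so the type \<open>'l\<close> carrying the space of
  hidden variables is a parameter of locality and of the threshold. A statement in which \<open>'l\<close>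
  is a free type variable covers every probability space.\<close>

definition local_projective :: "'l itself \<Rightarrow> three_qubit_op \<Rightarrow> bool" where
  "local_projective _ \<rho> \<longleftrightarrow>
     (\<exists>(M :: 'l measure) p1 p2 p3.
        prob_space M \<and>
        response_function M p1 \<and> response_function M p2 \<and> response_function M p3 \<and>
        (\<forall>a1\<in>{1, - 1}. \<forall>a2\<in>{1, - 1}. \<forall>a3\<in>{1, - 1}. \<forall>x1 x2 x3.
           norm x1 = 1 \<longrightarrow> norm x2 = 1 \<longrightarrow> norm x3 = 1 \<longrightarrow>
           outcome_prob \<rho> a1 a2 a3 x1 x2 x3 =
             complex_of_real (\<integral>l. p1 l a1 x1 * p2 l a2 x2 * p3 l a3 x3 \<partial>M)))"

definition W3_threshold :: "'l itself \<Rightarrow> real" where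
  "W3_threshold T = Sup {v \<in> {0..1}. local_projective T (rho_W3 v)}"

definition W3_bound :: real where
  "W3_bound =
     1000910150415 /
       (314450816715 + 210987849189 * sqrt 5
        + sqrt (565536694605181420689075 + 230287482340357705773330 * sqrt 5))"

end

theory Submission
  imports Defs
begin

text \<open>The W state violates a multilinear Bell inequality
  \<open>\<Sum>\<^bsub>ijk\<^esub> T\<^bsub>ijk\<^esub> \<alpha>\<^bsub>i\<^esub> \<beta>\<^bsub>j\<^esub> \<gamma>\<^bsub>k\<^esub> \<le> 26072\<close> with integer coefficients, where index \<open>0\<close> stands for the
  trivial observable \<open>1\<close> and the parties have 31, 13 and 13 further settings. At suitable directions
  with rational coordinates the noiseless correlators give a value \<open>Q \<approx> 47556.357\<close>. The correlators
  of \<open>\<rho>\<^bsub>v\<^esub>\<close> are \<open>v\<close> times those of the W state and \<open>T\<^bsub>000\<^esub> = 0\<close>, so locality forces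
  \<open>v \<le> 26072 / Q \<approx> 0.5482337\<close>, slightly below the claimed bound.

  For the local bound, multilinearity reduces to \<open>\<beta>\<close>, \<open>\<gamma>\<close> with values \<open>\<plusminus>1\<close>, and the optimal
  \<open>\<alpha>\<close> turns the functional into \<open>G\<^bsub>0\<^esub> + \<Sum>\<^bsub>i>0\<^esub> |G\<^bsub>i\<^esub>|\<close> with \<open>G\<close> bilinear. The coefficients are
  symmetric in the last two parties and, up to a permutation and signs of the settings of the first
  party, under the dihedral group of order 8 acting on the settings of the other two. For one
  \<open>\<beta>\<close> from each orbit, a depth-first search over \<open>\<gamma>\<close> fixes its signs one at a time. It
  discards a branch once the partial sums plus the largest possible contribution of the open signs
  cannot exceed the bound. The search is run by the simplifier on numbers in base 100, with one
  rewrite rule for each pair of digits.\<close>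

text \<open>Without reductions the local bound concerns 2^26 sign pairs with 32 sums each, and every
  step of the check has to be an inference of the logic. The two symmetries could obstruct each
  other: moving \<open>b\<close> to a representative of its orbit moves \<open>c\<close> as well,
  which would destroy an order of the strategies themselves. The pair is therefore compared by a
  number that is constant on orbits. It is read off from setting 1 and the ring 10--13, whose signs
  come at the top of the search, so that exchanging the parties prunes whole subtrees within five
  levels. Halving makes partial sums cheap: starting with all nontrivial signs negative, turning one
  positive adds its row once instead of twice, and even column sums keep the start integral. The
  vectors for different \<open>b\<close> share these sums along a binary tree. Rational directions
  make the quantum value an exact fraction. The relative gap between the visibility reached and the
  constant of the statement is only about 4e-6, so neither the coefficients nor the local bound
  leave much room for coarsening.\<close>

section \<open>Digits in base 100 as constants\<close>

definition D0 :: int where "D0 = 0"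
definition D1 :: int where "D1 = 1"
definition D2 :: int where "D2 = 2"
definition D3 :: int where "D3 = 3"
definition D4 :: int where "D4 = 4"
definition D5 :: int where "D5 = 5"
definition D6 :: int where "D6 = 6"
definition D7 :: int where "D7 = 7"
definition D8 :: int where "D8 = 8"
definition D9 :: int where "D9 = 9"
definition D10 :: int where "D10 = 10"
definition D11 :: int where "D11 = 11"
definition D12 :: int where "D12 = 12"
definition D13 :: int where "D13 = 13"
definition D14 :: int where "D14 = 14"
definition D15 :: int where "D15 = 15"
definition D16 :: int where "D16 = 16"
definition D17 :: int where "D17 = 17"
definition D18 :: int where "D18 = 18"
definition D19 :: int where "D19 = 19"
definition D20 :: int where "D20 = 20"
definition D21 :: int where "D21 = 21"
definition D22 :: int where "D22 = 22"
definition D23 :: int where "D23 = 23"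
definition D24 :: int where "D24 = 24"
definition D25 :: int where "D25 = 25"
definition D26 :: int where "D26 = 26"
definition D27 :: int where "D27 = 27"
definition D28 :: int where "D28 = 28"
definition D29 :: int where "D29 = 29"
definition D30 :: int where "D30 = 30"
definition D31 :: int where "D31 = 31"
definition D32 :: int where "D32 = 32"
definition D33 :: int where "D33 = 33"
definition D34 :: int where "D34 = 34"
definition D35 :: int where "D35 = 35"
definition D36 :: int where "D36 = 36"
definition D37 :: int where "D37 = 37"
definition D38 :: int where "D38 = 38"
definition D39 :: int where "D39 = 39"
definition D40 :: int where "D40 = 40"
definition D41 :: int where "D41 = 41"
definition D42 :: int where "D42 = 42"
definition D43 :: int where "D43 = 43"
definition D44 :: int where "D44 = 44"
definition D45 :: int where "D45 = 45"
definition D46 :: int where "D46 = 46"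
definition D47 :: int where "D47 = 47"
definition D48 :: int where "D48 = 48"
definition D49 :: int where "D49 = 49"
definition D50 :: int where "D50 = 50"
definition D51 :: int where "D51 = 51"
definition D52 :: int where "D52 = 52"
definition D53 :: int where "D53 = 53"
definition D54 :: int where "D54 = 54"
definition D55 :: int where "D55 = 55"
definition D56 :: int where "D56 = 56"
definition D57 :: int where "D57 = 57"
definition D58 :: int where "D58 = 58"
definition D59 :: int where "D59 = 59"
definition D60 :: int where "D60 = 60"
definition D61 :: int where "D61 = 61"
definition D62 :: int where "D62 = 62"
definition D63 :: int where "D63 = 63"
definition D64 :: int where "D64 = 64"
definition D65 :: int where "D65 = 65"
definition D66 :: int where "D66 = 66"
definition D67 :: int where "D67 = 67"
definition D68 :: int where "D68 = 68"
definition D69 :: int where "D69 = 69"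
definition D70 :: int where "D70 = 70"
definition D71 :: int where "D71 = 71"
definition D72 :: int where "D72 = 72"
definition D73 :: int where "D73 = 73"
definition D74 :: int where "D74 = 74"
definition D75 :: int where "D75 = 75"
definition D76 :: int where "D76 = 76"
definition D77 :: int where "D77 = 77"
definition D78 :: int where "D78 = 78"
definition D79 :: int where "D79 = 79"
definition D80 :: int where "D80 = 80"
definition D81 :: int where "D81 = 81"
definition D82 :: int where "D82 = 82"
definition D83 :: int where "D83 = 83"
definition D84 :: int where "D84 = 84"
definition D85 :: int where "D85 = 85"
definition D86 :: int where "D86 = 86"
definition D87 :: int where "D87 = 87"
definition D88 :: int where "D88 = 88"
definition D89 :: int where "D89 = 89"
definition D90 :: int where "D90 = 90"
definition D91 :: int where "D91 = 91"
definition D92 :: int where "D92 = 92"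
definition D93 :: int where "D93 = 93"
definition D94 :: int where "D94 = 94"
definition D95 :: int where "D95 = 95"
definition D96 :: int where "D96 = 96"
definition D97 :: int where "D97 = 97"
definition D98 :: int where "D98 = 98"
definition D99 :: int where "D99 = 99"
definition D100 :: int where "D100 = 100"
definition D101 :: int where "D101 = 101"
definition D102 :: int where "D102 = 102"
definition D103 :: int where "D103 = 103"
definition D104 :: int where "D104 = 104"
definition D105 :: int where "D105 = 105"
definition D106 :: int where "D106 = 106"
definition D107 :: int where "D107 = 107"
definition D108 :: int where "D108 = 108"
definition D109 :: int where "D109 = 109"
definition D110 :: int where "D110 = 110"
definition D111 :: int where "D111 = 111"
definition D112 :: int where "D112 = 112"
definition D113 :: int where "D113 = 113"
definition D114 :: int where "D114 = 114"
definition D115 :: int where "D115 = 115"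
definition D116 :: int where "D116 = 116"
definition D117 :: int where "D117 = 117"
definition D118 :: int where "D118 = 118"
definition D119 :: int where "D119 = 119"
definition D120 :: int where "D120 = 120"
definition D121 :: int where "D121 = 121"
definition D122 :: int where "D122 = 122"
definition D123 :: int where "D123 = 123"
definition D124 :: int where "D124 = 124"
definition D125 :: int where "D125 = 125"
definition D126 :: int where "D126 = 126"
definition D127 :: int where "D127 = 127"
definition D128 :: int where "D128 = 128"
definition D129 :: int where "D129 = 129"
definition D130 :: int where "D130 = 130"
definition D131 :: int where "D131 = 131"
definition D132 :: int where "D132 = 132"
definition D133 :: int where "D133 = 133"
definition D134 :: int where "D134 = 134"
definition D135 :: int where "D135 = 135"
definition D136 :: int where "D136 = 136"
definition D137 :: int where "D137 = 137"
definition D138 :: int where "D138 = 138"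
definition D139 :: int where "D139 = 139"
definition D140 :: int where "D140 = 140"
definition D141 :: int where "D141 = 141"
definition D142 :: int where "D142 = 142"
definition D143 :: int where "D143 = 143"
definition D144 :: int where "D144 = 144"
definition D145 :: int where "D145 = 145"
definition D146 :: int where "D146 = 146"
definition D147 :: int where "D147 = 147"
definition D148 :: int where "D148 = 148"
definition D149 :: int where "D149 = 149"
definition D150 :: int where "D150 = 150"
definition D151 :: int where "D151 = 151"
definition D152 :: int where "D152 = 152"
definition D153 :: int where "D153 = 153"
definition D154 :: int where "D154 = 154"
definition D155 :: int where "D155 = 155"
definition D156 :: int where "D156 = 156"
definition D157 :: int where "D157 = 157"
definition D158 :: int where "D158 = 158"
definition D159 :: int where "D159 = 159"
definition D160 :: int where "D160 = 160"
definition D161 :: int where "D161 = 161"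
definition D162 :: int where "D162 = 162"
definition D163 :: int where "D163 = 163"
definition D164 :: int where "D164 = 164"
definition D165 :: int where "D165 = 165"
definition D166 :: int where "D166 = 166"
definition D167 :: int where "D167 = 167"
definition D168 :: int where "D168 = 168"
definition D169 :: int where "D169 = 169"
definition D170 :: int where "D170 = 170"
definition D171 :: int where "D171 = 171"
definition D172 :: int where "D172 = 172"
definition D173 :: int where "D173 = 173"
definition D174 :: int where "D174 = 174"
definition D175 :: int where "D175 = 175"
definition D176 :: int where "D176 = 176"
definition D177 :: int where "D177 = 177"
definition D178 :: int where "D178 = 178"
definition D179 :: int where "D179 = 179"
definition D180 :: int where "D180 = 180"
definition D181 :: int where "D181 = 181"
definition D182 :: int where "D182 = 182"
definition D183 :: int where "D183 = 183"
definition D184 :: int where "D184 = 184"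
definition D185 :: int where "D185 = 185"
definition D186 :: int where "D186 = 186"
definition D187 :: int where "D187 = 187"
definition D188 :: int where "D188 = 188"
definition D189 :: int where "D189 = 189"
definition D190 :: int where "D190 = 190"
definition D191 :: int where "D191 = 191"
definition D192 :: int where "D192 = 192"
definition D193 :: int where "D193 = 193"
definition D194 :: int where "D194 = 194"
definition D195 :: int where "D195 = 195"
definition D196 :: int where "D196 = 196"
definition D197 :: int where "D197 = 197"
definition D198 :: int where "D198 = 198"
definition D199 :: int where "D199 = 199"
definition D200 :: int where "D200 = 200"
definition D201 :: int where "D201 = 201"
definition D202 :: int where "D202 = 202"
definition D203 :: int where "D203 = 203"
definition D204 :: int where "D204 = 204"
definition D205 :: int where "D205 = 205"
definition D206 :: int where "D206 = 206"
definition D207 :: int where "D207 = 207"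
definition D208 :: int where "D208 = 208"
definition D209 :: int where "D209 = 209"
definition D210 :: int where "D210 = 210"
definition D211 :: int where "D211 = 211"
definition D212 :: int where "D212 = 212"
definition D213 :: int where "D213 = 213"
definition D214 :: int where "D214 = 214"
definition D215 :: int where "D215 = 215"
definition D216 :: int where "D216 = 216"
definition D217 :: int where "D217 = 217"
definition D218 :: int where "D218 = 218"
definition D219 :: int where "D219 = 219"
definition D220 :: int where "D220 = 220"
definition D221 :: int where "D221 = 221"
definition D222 :: int where "D222 = 222"
definition D223 :: int where "D223 = 223"
definition D224 :: int where "D224 = 224"
definition D225 :: int where "D225 = 225"
definition D226 :: int where "D226 = 226"
definition D227 :: int where "D227 = 227"
definition D228 :: int where "D228 = 228"
definition D229 :: int where "D229 = 229"
definition D230 :: int where "D230 = 230"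
definition D231 :: int where "D231 = 231"
definition D232 :: int where "D232 = 232"
definition D233 :: int where "D233 = 233"
definition D234 :: int where "D234 = 234"
definition D235 :: int where "D235 = 235"
definition D236 :: int where "D236 = 236"
definition D237 :: int where "D237 = 237"
definition D238 :: int where "D238 = 238"
definition D239 :: int where "D239 = 239"
definition D240 :: int where "D240 = 240"
definition D241 :: int where "D241 = 241"
text \<open>Only high digits become negative. The low digit always lies between 0 and 99, so the
  number -1 has high digit -1 and low digit 99.\<close>

definition M1 :: int where "M1 = - 1"
definition M2 :: int where "M2 = - 2"
definition M3 :: int where "M3 = - 3"
definition M4 :: int where "M4 = - 4"
definition M5 :: int where "M5 = - 5"
definition M6 :: int where "M6 = - 6"
definition M7 :: int where "M7 = - 7"
definition M8 :: int where "M8 = - 8"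
definition M9 :: int where "M9 = - 9"
definition M10 :: int where "M10 = - 10"
definition M11 :: int where "M11 = - 11"
definition M12 :: int where "M12 = - 12"
definition M13 :: int where "M13 = - 13"
definition M14 :: int where "M14 = - 14"
definition M15 :: int where "M15 = - 15"
definition M16 :: int where "M16 = - 16"
definition M17 :: int where "M17 = - 17"
definition M18 :: int where "M18 = - 18"
definition M19 :: int where "M19 = - 19"
definition M20 :: int where "M20 = - 20"
definition M21 :: int where "M21 = - 21"
definition M22 :: int where "M22 = - 22"
definition M23 :: int where "M23 = - 23"
definition M24 :: int where "M24 = - 24"
definition M25 :: int where "M25 = - 25"
definition M26 :: int where "M26 = - 26"
definition M27 :: int where "M27 = - 27"
definition M28 :: int where "M28 = - 28"
definition M29 :: int where "M29 = - 29"
definition M30 :: int where "M30 = - 30"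
definition M31 :: int where "M31 = - 31"
definition M32 :: int where "M32 = - 32"
definition M33 :: int where "M33 = - 33"
definition M34 :: int where "M34 = - 34"
definition M35 :: int where "M35 = - 35"
definition M36 :: int where "M36 = - 36"
definition M37 :: int where "M37 = - 37"
definition M38 :: int where "M38 = - 38"
definition M39 :: int where "M39 = - 39"
definition M40 :: int where "M40 = - 40"
definition M41 :: int where "M41 = - 41"

lemmas D_defs =
  D0_def D1_def D2_def D3_def D4_def D5_def D6_def D7_def D8_def D9_def
  D10_def D11_def D12_def D13_def D14_def D15_def D16_def D17_def D18_def D19_def
  D20_def D21_def D22_def D23_def D24_def D25_def D26_def D27_def D28_def D29_def
  D30_def D31_def D32_def D33_def D34_def D35_def D36_def D37_def D38_def D39_def
  D40_def D41_def D42_def D43_def D44_def D45_def D46_def D47_def D48_def D49_def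
  D50_def D51_def D52_def D53_def D54_def D55_def D56_def D57_def D58_def D59_def
  D60_def D61_def D62_def D63_def D64_def D65_def D66_def D67_def D68_def D69_def
  D70_def D71_def D72_def D73_def D74_def D75_def D76_def D77_def D78_def D79_def
  D80_def D81_def D82_def D83_def D84_def D85_def D86_def D87_def D88_def D89_def
  D90_def D91_def D92_def D93_def D94_def D95_def D96_def D97_def D98_def D99_def
  D100_def D101_def D102_def D103_def D104_def D105_def D106_def D107_def D108_def D109_def
  D110_def D111_def D112_def D113_def D114_def D115_def D116_def D117_def D118_def D119_def
  D120_def D121_def D122_def D123_def D124_def D125_def D126_def D127_def D128_def D129_def
  D130_def D131_def D132_def D133_def D134_def D135_def D136_def D137_def D138_def D139_def
  D140_def D141_def D142_def D143_def D144_def D145_def D146_def D147_def D148_def D149_def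
  D150_def D151_def D152_def D153_def D154_def D155_def D156_def D157_def D158_def D159_def
  D160_def D161_def D162_def D163_def D164_def D165_def D166_def D167_def D168_def D169_def
  D170_def D171_def D172_def D173_def D174_def D175_def D176_def D177_def D178_def D179_def
  D180_def D181_def D182_def D183_def D184_def D185_def D186_def D187_def D188_def D189_def
  D190_def D191_def D192_def D193_def D194_def D195_def D196_def D197_def D198_def D199_def
  D200_def D201_def D202_def D203_def D204_def D205_def D206_def D207_def D208_def D209_def
  D210_def D211_def D212_def D213_def D214_def D215_def D216_def D217_def D218_def D219_def
  D220_def D221_def D222_def D223_def D224_def D225_def D226_def D227_def D228_def D229_def
  D230_def D231_def D232_def D233_def D234_def D235_def D236_def D237_def D238_def D239_def
  D240_def D241_def
lemmas M_defs =
  M1_def M2_def M3_def M4_def M5_def M6_def M7_def M8_def M9_def M10_def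
  M11_def M12_def M13_def M14_def M15_def M16_def M17_def M18_def M19_def M20_def
  M21_def M22_def M23_def M24_def M25_def M26_def M27_def M28_def M29_def M30_def
  M31_def M32_def M33_def M34_def M35_def M36_def M37_def M38_def M39_def M40_def
  M41_def
text \<open>The high digit of a slack is looked up among 0 to 241, that of a vector entry among -41
  to 40.\<close>

definition digits :: "int list" where "digits = [D0, D1, D2, D3, D4, D5, D6, D7, D8, D9, D10, D11, D12, D13, D14, D15, D16, D17, D18, D19, D20, D21, D22, D23, D24, D25, D26, D27, D28, D29, D30, D31, D32, D33, D34, D35, D36, D37, D38, D39, D40, D41, D42, D43, D44, D45, D46, D47, D48, D49, D50, D51, D52, D53, D54, D55, D56, D57, D58, D59, D60, D61, D62, D63, D64, D65, D66, D67, D68, D69, D70, D71, D72, D73, D74, D75, D76, D77, D78, D79, D80, D81, D82, D83, D84, D85, D86, D87, D88, D89, D90, D91, D92, D93, D94, D95, D96, D97, D98, D99, D100, D101, D102, D103, D104, D105, D106, D107, D108, D109, D110, D111, D112, D113, D114, D115, D116, D117, D118, D119, D120, D121, D122, D123, D124, D125, D126, D127, D128, D129, D130, D131, D132, D133, D134, D135, D136, D137, D138, D139, D140, D141, D142, D143, D144, D145, D146, D147, D148, D149, D150, D151, D152, D153, D154, D155, D156, D157, D158, D159, D160, D161, D162, D163, D164, D165, D166, D167, D168, D169, D170, D171, D172, D173, D174, D175, D176, D177, D178, D179, D180, D181, D182, D183, D184, D185, D186, D187, D188, D189, D190, D191, D192, D193, D194, D195, D196, D197, D198, D199, D200, D201,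 D202, D203, D204, D205, D206, D207, D208, D209, D210, D211, D212, D213, D214, D215, D216, D217, D218, D219, D220, D221, D222, D223, D224, D225, D226, D227, D228, D229, D230, D231, D232, D233, D234, D235, D236, D237, D238, D239, D240, D241]"

section \<open>Vectors and slacks\<close>

text \<open>\<open>N t a\<close> is the number \<open>100 t + a\<close> with \<open>0 \<le> a < 100\<close>. The digits are constants because
  the simplifier then finds the result of a digit operation in a table by one indexed lookup;
  vectors are trees because its cost per step grows with the depth of the surrounding term.
  \<open>Z u b\<close> is what remains of a bound after some absolute values were subtracted, and \<open>Neg\<close>
  means that it was exceeded.\<close>

datatype vec = N int int | B vec vec | V8 vec vec vec vec vec vec vec vec
datatype slack = Z int int | Neg

text \<open>These four stop after the low digit: the carry is known by then, and the high digits are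
  left to a second lookup. A single table for complete sums would need a rule for each quadruple of
  digits.\<close>

definition h0 :: "int \<Rightarrow> int \<Rightarrow> int \<Rightarrow> vec" where "h0 t t' l = N (t + t') l"
definition h1 :: "int \<Rightarrow> int \<Rightarrow> int \<Rightarrow> vec" where "h1 t t' l = N (t + t' + 1) l"
definition n0 :: "int \<Rightarrow> vec" where "n0 t = N (- t) D0"
definition n1 :: "int \<Rightarrow> int \<Rightarrow> vec" where "n1 t l = N (- t - 1) l"

fun ad :: "vec \<Rightarrow> vec \<Rightarrow> vec" where
  "ad (N t a) (N t' b) = (if a + b < 100 then h0 t t' (a + b) else h1 t t' (a + b - 100))"
| "ad (B x y) (B x' y') = B (ad x x') (ad y y')"
| "ad (V8 x1 x2 x3 x4 x5 x6 x7 x8) (V8 y1 y2 y3 y4 y5 y6 y7 y8) =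
     V8 (ad x1 y1) (ad x2 y2) (ad x3 y3) (ad x4 y4) (ad x5 y5) (ad x6 y6) (ad x7 y7) (ad x8 y8)"
| "ad x y = x"

fun neg :: "vec \<Rightarrow> vec" where
  "neg (N t a) = (if a = 0 then n0 t else n1 t (100 - a))"
| "neg (B x y) = B (neg x) (neg y)"
| "neg (V8 x1 x2 x3 x4 x5 x6 x7 x8) = V8 (neg x1) (neg x2) (neg x3) (neg x4) (neg x5) (neg x6) (neg x7) (neg x8)"

text \<open>A high digit -1 is the only undecided one, because a carry from the low digits can still
  lift it to 0. Anything smaller has already been replaced by \<open>Neg\<close> in
  \<open>sh\<close> and \<open>acc\<close>.\<close>

definition sz :: "int \<Rightarrow> int \<Rightarrow> slack" where "sz w l = (if w < 0 then Neg else Z w l)"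
definition ic :: "int \<Rightarrow> int \<Rightarrow> slack" where "ic w l = sz (w + 1) l"
definition dec :: "int \<Rightarrow> int \<Rightarrow> slack" where "dec w l = (if w \<le> 0 then Neg else Z (w - 1) l)"
definition sa :: "int \<Rightarrow> int \<Rightarrow> int \<Rightarrow> slack" where
  "sa w b a = (if a + b < 100 then sz w (a + b) else ic w (a + b - 100))"
definition sb :: "int \<Rightarrow> int \<Rightarrow> int \<Rightarrow> slack" where
  "sb w b a = (if a \<le> b then Z w (b - a) else dec w (100 + b - a))"

fun sh :: "vec \<Rightarrow> slack \<Rightarrow> slack" where
  "sh (N t a) (Z u b) = (if u + t < - 1 then Neg else sa (u + t) b a)"
| "sh x z = Neg"

text \<open>Subtracts the 1-norm of a vector. The sign of an entry is that of its high digit, so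
  absolute values need not be formed: a negative entry is added instead.\<close>

fun acc :: "vec \<Rightarrow> slack \<Rightarrow> slack" where
  "acc (N t a) (Z u b) =
     (if 0 \<le> t then if u < t then Neg else sb (u - t) b a
      else if u + t < - 1 then Neg else sa (u + t) b a)"
| "acc (N t a) Neg = Neg"
| "acc (B x y) z = acc y (acc x z)"
| "acc (V8 x1 x2 x3 x4 x5 x6 x7 x8) z =
     acc x8 (acc x7 (acc x6 (acc x5 (acc x4 (acc x3 (acc x2 (acc x1 z)))))))"

section \<open>Rewrite rules for digit arithmetic\<close>

text \<open>Expanded over lists of digit constants, \<open>tab\<close> turns a statement about sums \<open>x + y = z\<close> of
  digits into one rewrite rule for each pair.\<close>

fun la :: "(int \<Rightarrow> int \<Rightarrow> bool) \<Rightarrow> int list \<Rightarrow> int list \<Rightarrow> bool" where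
  "la P (y # ys) (z # zs) = (P y z \<and> la P ys zs)"
| "la P ys [] = True"
| "la P [] zs = True"

fun tab :: "(int \<Rightarrow> int \<Rightarrow> int \<Rightarrow> bool) \<Rightarrow> int list \<Rightarrow> int list \<Rightarrow> int list \<Rightarrow> bool" where
  "tab P (x # xs) ys (z # zs) = (la (P x) ys (z # zs) \<and> tab P xs ys zs)"
| "tab P xs ys [] = True"
| "tab P [] ys zs = True"

definition sq :: "nat \<Rightarrow> nat \<Rightarrow> int list" where "sq a n = map int [a..<a + n]"

lemma digits_eq: "digits = sq 0 242"
  by (simp add: digits_def sq_def D_defs upt_rec)

lemma sq_Nil [simp]: "sq a 0 = []" by (simp add: sq_def)
lemma sq_Cons: "sq a (Suc n) = int a # sq (Suc a) n"
  by (simp add: sq_def upt_conv_Cons del: upt_Suc)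

lemma la_sq:
  assumes "\<And>y z. b \<le> y \<Longrightarrow> y < b + n \<Longrightarrow> z < c + l \<Longrightarrow> int z = int y + int c - int b \<Longrightarrow> P (int y) (int z)"
  shows "la P (sq b n) (sq c l)"
  using assms
proof (induction n arbitrary: b c l)
  case (Suc n)
  show ?case
  proof (cases l)
    case (Suc l')
    have "P (int b) (int c)" by (rule Suc.prems) (auto simp: Suc)
    moreover have "la P (sq (Suc b) n) (sq (Suc c) l')"
      by (rule Suc.IH) (rule Suc.prems, auto simp: Suc)
    ultimately show ?thesis by (simp add: sq_Cons Suc)
  qed simp
next
  case 0
  then show ?case by (cases "sq c l") auto
qed

text \<open>Positions i and j of the first two lists meet position i + j of the third. The third
  list thus holds the sums up to an offset, and its end cuts off the pairs that are out of
  range.\<close>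

lemma tab_sq:
  assumes "\<And>x y z. a \<le> x \<Longrightarrow> x < a + m \<Longrightarrow> b \<le> y \<Longrightarrow> y < b + n \<Longrightarrow> z < c + l \<Longrightarrow>
      int z = int x + int y + (int c - int a - int b) \<Longrightarrow> P (int x) (int y) (int z)"
  shows "tab P (sq a m) (sq b n) (sq c l)"
  using assms
proof (induction m arbitrary: a c l)
  case (Suc m)
  show ?case
  proof (cases l)
    case (Suc l')
    have "la (P (int a)) (sq b n) (sq c (Suc l'))"
      by (rule la_sq, rule Suc.prems) (auto simp: Suc)
    moreover have "tab P (sq (Suc a) m) (sq b n) (sq (Suc c) l')"
      by (rule Suc.IH) (rule Suc.prems, auto simp: Suc)
    ultimately show ?thesis by (simp add: sq_Cons Suc)
  qed simp
next
  case 0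
  then show ?case by (cases "sq c l") auto
qed

definition ds :: "nat \<Rightarrow> nat \<Rightarrow> int list" where "ds a n = take n (drop a digits)"

lemma ds_eq: "a + n \<le> 242 \<Longrightarrow> ds a n = sq a n"
  by (simp add: ds_def digits_eq sq_def take_map drop_map)

text \<open>A table is proved by one argument about natural numbers and is unfolded into its entries
  only afterwards, so no entry needs a proof of its own.\<close>

lemma tab_ds:
  assumes "a + m \<le> 242" "b + n \<le> 242" "c + l \<le> 242"
    and "\<And>x y z. a \<le> x \<Longrightarrow> x < a + m \<Longrightarrow> b \<le> y \<Longrightarrow> y < b + n \<Longrightarrow> c \<le> z \<Longrightarrow> z < c + l \<Longrightarrow>
      z + a + b = x + y + c \<Longrightarrow> P (int x) (int y) (int z)"
  shows "tab P (ds a m) (ds b n) (ds c l)"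
  unfolding ds_eq[OF assms(1)] ds_eq[OF assms(2)] ds_eq[OF assms(3)]
  by (rule tab_sq, rule assms(4)) linarith+

lemma neg_digit:
  "- D1 = M1" "- D2 = M2" "- D3 = M3" "- D4 = M4" "- D5 = M5" "- D6 = M6" "- D7 = M7" "- D8 = M8" "- D9 = M9" "- D10 = M10" "- D11 = M11" "- D12 = M12" "- D13 = M13" "- D14 = M14" "- D15 = M15" "- D16 = M16" "- D17 = M17" "- D18 = M18" "- D19 = M19" "- D20 = M20" "- D21 = M21" "- D22 = M22" "- D23 = M23" "- D24 = M24" "- D25 = M25" "- D26 = M26" "- D27 = M27" "- D28 = M28" "- D29 = M29" "- D30 = M30" "- D31 = M31" "- D32 = M32" "- D33 = M33" "- D34 = M34" "- D35 = M35" "- D36 = M36" "- D37 = M37" "- D38 = M38" "- D39 = M39" "- D40 = M40" "- D41 = M41"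
  by (simp_all add: D_defs M_defs)
lemma compl_digit:
  "100 - D1 = D99" "100 - D2 = D98" "100 - D3 = D97" "100 - D4 = D96" "100 - D5 = D95" "100 - D6 = D94" "100 - D7 = D93" "100 - D8 = D92" "100 - D9 = D91" "100 - D10 = D90" "100 - D11 = D89" "100 - D12 = D88" "100 - D13 = D87" "100 - D14 = D86" "100 - D15 = D85" "100 - D16 = D84" "100 - D17 = D83" "100 - D18 = D82" "100 - D19 = D81" "100 - D20 = D80" "100 - D21 = D79" "100 - D22 = D78" "100 - D23 = D77" "100 - D24 = D76" "100 - D25 = D75" "100 - D26 = D74" "100 - D27 = D73" "100 - D28 = D72" "100 - D29 = D71" "100 - D30 = D70" "100 - D31 = D69" "100 - D32 = D68" "100 - D33 = D67" "100 - D34 = D66" "100 - D35 = D65" "100 - D36 = D64" "100 - D37 = D63" "100 - D38 = D62" "100 - D39 = D61" "100 - D40 = D60" "100 - D41 = D59" "100 - D42 = D58" "100 - D43 = D57" "100 - D44 = D56" "100 - D45 = D55" "100 - D46 = D54" "100 - D47 = D53" "100 - D48 = D52" "100 - D49 = D51" "100 - D50 = D50" "100 - D51 = D49" "100 - D52 = D48" "100 - D53 = D47" "100 - D54 = D46" "100 - D55 = D45" "100 - D56 = D44" "100 - D57 = D43" "100 - D58 = D42" "100 - D59 = D41" "100 - D60 = D40" "100 - D61 = D39" "100 - D62 = D38" "100 - D63 = D37" "100 - D64 = D36" "100 - D65 = D35" "100 - D66 = D34" "100 - D67 = D33" "100 - D68 = D32" "100 - D69 = D31" "100 - D70 = D30"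 "100 - D71 = D29" "100 - D72 = D28" "100 - D73 = D27" "100 - D74 = D26" "100 - D75 = D25" "100 - D76 = D24" "100 - D77 = D23" "100 - D78 = D22" "100 - D79 = D21" "100 - D80 = D20" "100 - D81 = D19" "100 - D82 = D18" "100 - D83 = D17" "100 - D84 = D16" "100 - D85 = D15" "100 - D86 = D14" "100 - D87 = D13" "100 - D88 = D12" "100 - D89 = D11" "100 - D90 = D10" "100 - D91 = D9" "100 - D92 = D8" "100 - D93 = D7" "100 - D94 = D6" "100 - D95 = D5" "100 - D96 = D4" "100 - D97 = D3" "100 - D98 = D2" "100 - D99 = D1"
  by (simp_all add: D_defs)

lemma take_drop_expand:
  "take 0 xs = []" "take (numeral k) (x # xs) = x # take (pred_numeral k) xs"
  "take (Suc n) (x # xs) = x # take n xs" "take n [] = []"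
  "drop 0 xs = xs" "drop (numeral k) (x # xs) = drop (pred_numeral k) xs"
  "drop (Suc n) (x # xs) = drop n xs"
  by (simp_all add: numeral_eq_Suc)
lemma pred_num: "pred_numeral num.One = 0" "pred_numeral (num.Bit0 k) = numeral (Num.BitM k)"
  "pred_numeral (num.Bit1 k) = numeral (num.Bit0 k)" "Num.BitM num.One = num.One"
  "Num.BitM (num.Bit0 n) = num.Bit1 (Num.BitM n)" "Num.BitM (num.Bit1 n) = num.Bit1 (num.Bit0 n)"
  "take 1 (x # xs) = [x]" "drop 1 (x # xs) = xs"
  "numeral num.One = (1::nat)"
  by simp_all
lemma and_True: "(P \<and> True) = P" by simp

lemmas expand_table = ds_def digits_def take_drop_expand pred_num la.simps tab.simps and_True

lemma ad_low: "tab (\<lambda>x y z. ad (N t x) (N t' y) = h0 t t' z) (ds 0 100) (ds 0 100) (ds 0 100)"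
  by (rule tab_ds) (auto simp:  ac_simps)
lemmas ad_low_rules = ad_low[unfolded expand_table, unfolded neg_digit compl_digit]
text \<open>Two digits with a carry have the form 100 - x and x + y, and y is what remains. Passing
  to complements in this way turns the carries into a table of sums as well.\<close>

lemma ad_carry: "tab (\<lambda>x y z. ad (N t (100 - x)) (N t' z) = h1 t t' y) (ds 1 99) (ds 0 100) (ds 1 99)"
  by (rule tab_ds) (auto simp:  ac_simps)
lemmas ad_carry_rules = ad_carry[unfolded expand_table, unfolded neg_digit compl_digit]
lemma sb_low: "tab (\<lambda>x y z. sb w z x = Z w y) (ds 0 100) (ds 0 100) (ds 0 100)"
  by (rule tab_ds) (auto simp: sb_def ac_simps)
lemmas sb_low_rules = sb_low[unfolded expand_table, unfolded neg_digit compl_digit]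
lemma sb_borrow: "tab (\<lambda>x y z. sb w x z = dec w (100 - y)) (ds 0 100) (ds 1 99) (ds 1 99)"
  by (rule tab_ds) (auto simp: sb_def ac_simps)
lemmas sb_borrow_rules = sb_borrow[unfolded expand_table, unfolded neg_digit compl_digit]
lemma sa_low: "tab (\<lambda>x y z. sa w x y = sz w z) (ds 0 100) (ds 0 100) (ds 0 100)"
  by (rule tab_ds) (auto simp: sa_def ac_simps)
lemmas sa_low_rules = sa_low[unfolded expand_table, unfolded neg_digit compl_digit]
lemma sa_carry: "tab (\<lambda>x y z. sa w z (100 - x) = ic w y) (ds 1 99) (ds 0 100) (ds 1 99)"
  by (rule tab_ds) (auto simp: sa_def ac_simps)
lemmas sa_carry_rules = sa_carry[unfolded expand_table, unfolded neg_digit compl_digit]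
lemma dec_pos: "tab (\<lambda>x y z. dec z l = Z y l) (ds 1 1) (ds 0 241) (ds 1 241)"
  by (rule tab_ds) (auto simp: dec_def ac_simps)
lemmas dec_pos_rules = dec_pos[unfolded expand_table, unfolded neg_digit compl_digit]
lemma sz_pos: "tab (\<lambda>x y z. sz y l = Z z l) (ds 0 1) (ds 0 242) (ds 0 242)"
  by (rule tab_ds) (auto simp: sz_def ac_simps)
lemmas sz_pos_rules = sz_pos[unfolded expand_table, unfolded neg_digit compl_digit]
lemma ic_pos: "tab (\<lambda>x y z. ic y l = Z z l) (ds 1 1) (ds 0 241) (ds 1 241)"
  by (rule tab_ds) (auto simp: ic_def sz_def ac_simps)
lemmas ic_pos_rules = ic_pos[unfolded expand_table, unfolded neg_digit compl_digit]
text \<open>The transitions at zero: a borrow from 0 or a missing carry at -1 exhausts the slack, a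
  carry at -1 rescues it.\<close>

lemma slack_edge: "dec D0 l = Neg" "sz M1 l = Neg" "ic M1 l = Z D0 l"
  by (simp_all add: dec_def sz_def ic_def D_defs M_defs)
lemma h0_pp: "tab (\<lambda>x y z. h0 x y l = N z l) (ds 0 41) (ds 0 41) (ds 0 41)"
  by (rule tab_ds) (auto simp: h0_def ac_simps)
lemmas h0_pp_rules = h0_pp[unfolded expand_table, unfolded neg_digit compl_digit]
lemma h0_mm: "tab (\<lambda>x y z. h0 (- x) (- y) l = N (- z) l) (ds 1 41) (ds 1 41) (ds 2 40)"
  by (rule tab_ds) (auto simp: h0_def ac_simps)
lemmas h0_mm_rules = h0_mm[unfolded expand_table, unfolded neg_digit compl_digit]
lemma h0_pm: "tab (\<lambda>x y z. h0 z (- x) l = N y l \<and> h0 (- x) z l = N y l) (ds 1 41) (ds 0 41) (ds 1 40)"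
  by (rule tab_ds) (auto simp: h0_def ac_simps)
lemmas h0_pm_rules = h0_pm[unfolded expand_table, unfolded neg_digit compl_digit]
lemma h0_mp: "tab (\<lambda>x y z. h0 x (- z) l = N (- y) l \<and> h0 (- z) x l = N (- y) l) (ds 0 41) (ds 1 41) (ds 1 41)"
  by (rule tab_ds) (auto simp: h0_def ac_simps)
lemmas h0_mp_rules = h0_mp[unfolded expand_table, unfolded neg_digit compl_digit]
lemma h1_pp: "tab (\<lambda>x y z. h1 x y l = N z l) (ds 0 41) (ds 0 41) (ds 1 40)"
  by (rule tab_ds) (auto simp: h1_def ac_simps)
lemmas h1_pp_rules = h1_pp[unfolded expand_table, unfolded neg_digit compl_digit]
lemma h1_mm: "tab (\<lambda>x y z. h1 (- x) (- y) l = N (- z) l) (ds 1 41) (ds 1 41) (ds 1 41)"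
  by (rule tab_ds) (auto simp: h1_def ac_simps)
lemmas h1_mm_rules = h1_mm[unfolded expand_table, unfolded neg_digit compl_digit]
lemma h1_pm: "tab (\<lambda>x y z. h1 z (- x) l = N y l \<and> h1 (- x) z l = N y l) (ds 1 41) (ds 0 41) (ds 0 41)"
  by (rule tab_ds) (auto simp: h1_def ac_simps)
lemmas h1_pm_rules = h1_pm[unfolded expand_table, unfolded neg_digit compl_digit]
lemma h1_mp: "tab (\<lambda>x y z. h1 x (- z) l = N (- y) l \<and> h1 (- z) x l = N (- y) l) (ds 0 41) (ds 1 41) (ds 2 40)"
  by (rule tab_ds) (auto simp: h1_def ac_simps)
lemmas h1_mp_rules = h1_mp[unfolded expand_table, unfolded neg_digit compl_digit]
lemma n0_p: "tab (\<lambda>x y z. n0 y = N (- z) D0) (ds 0 1) (ds 1 40) (ds 1 40)"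
  by (rule tab_ds) (auto simp: n0_def D_defs ac_simps)
lemmas n0_p_rules = n0_p[unfolded expand_table, unfolded neg_digit compl_digit]
lemma n0_m: "tab (\<lambda>x y z. n0 (- y) = N z D0) (ds 0 1) (ds 1 40) (ds 1 40)"
  by (rule tab_ds) (auto simp: n0_def D_defs ac_simps)
lemmas n0_m_rules = n0_m[unfolded expand_table, unfolded neg_digit compl_digit]
lemma n0_0: "n0 D0 = N D0 D0" "neg (N t D0) = n0 t"
  by (simp_all add: n0_def D_defs)
lemma n1_p: "tab (\<lambda>x y z. n1 y l = N (- z) l) (ds 1 1) (ds 0 41) (ds 1 41)"
  by (rule tab_ds) (auto simp: n1_def ac_simps)
lemmas n1_p_rules = n1_p[unfolded expand_table, unfolded neg_digit compl_digit]
lemma n1_m: "tab (\<lambda>x y z. n1 (- z) l = N y l) (ds 1 1) (ds 0 41) (ds 1 41)"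
  by (rule tab_ds) (auto simp: n1_def ac_simps)
lemmas n1_m_rules = n1_m[unfolded expand_table, unfolded neg_digit compl_digit]
lemma neg_low: "tab (\<lambda>x y z. neg (N t (100 - y)) = n1 t z) (ds 0 1) (ds 1 99) (ds 1 99)"
  by (rule tab_ds) (auto simp:  ac_simps)
lemmas neg_low_rules = neg_low[unfolded expand_table, unfolded neg_digit compl_digit]
text \<open>The ranges of the tables for \<open>acc\<close> and \<open>sh\<close> are fitted to the
  numbers that occur; a missing entry would block the evaluation but could not falsify it. The
  variants ending in \<open>l\<close> combine large entries with a shorter range of slacks to keep
  the tables small.\<close>

lemma acc_p: "tab (\<lambda>x y z. acc (N x a) (Z z b) = sb y b a) (ds 0 18) (ds 0 242) (ds 0 242)"
  by (rule tab_ds) (auto simp:  ac_simps)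
lemmas acc_p_rules = acc_p[unfolded expand_table, unfolded neg_digit compl_digit]
lemma acc_pl: "tab (\<lambda>x y z. acc (N x a) (Z z b) = sb y b a) (ds 18 22) (ds 0 150) (ds 18 132)"
  by (rule tab_ds) (auto simp:  ac_simps)
lemmas acc_pl_rules = acc_pl[unfolded expand_table, unfolded neg_digit compl_digit]
lemma acc_p_Neg: "tab (\<lambda>x y z. acc (N z a) (Z x b) = Neg) (ds 0 40) (ds 1 39) (ds 1 39)"
  by (rule tab_ds) (auto simp:  ac_simps)
lemmas acc_p_Neg_rules = acc_p_Neg[unfolded expand_table, unfolded neg_digit compl_digit]
lemma acc_m: "tab (\<lambda>x y z. acc (N (- x) a) (Z z b) = sa y b a) (ds 1 24) (ds 0 242) (ds 1 241)"
  by (rule tab_ds) (auto simp:  ac_simps)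
lemmas acc_m_rules = acc_m[unfolded expand_table, unfolded neg_digit compl_digit]
lemma acc_ml: "tab (\<lambda>x y z. acc (N (- x) a) (Z z b) = sa y b a) (ds 25 15) (ds 0 150) (ds 25 125)"
  by (rule tab_ds) (auto simp:  ac_simps)
lemmas acc_ml_rules = acc_ml[unfolded expand_table, unfolded neg_digit compl_digit]
lemma acc_m1: "tab (\<lambda>x y z. acc (N (- z) a) (Z x b) = sa (- y) b a) (ds 0 40) (ds 1 1) (ds 1 39)"
  by (rule tab_ds) (auto simp:  ac_simps)
lemmas acc_m1_rules = acc_m1[unfolded expand_table, unfolded neg_digit compl_digit]
lemma acc_m_Neg: "tab (\<lambda>x y z. acc (N (- z) a) (Z x b) = Neg) (ds 0 40) (ds 2 38) (ds 2 38)"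
  by (rule tab_ds) (auto simp:  ac_simps)
lemmas acc_m_Neg_rules = acc_m_Neg[unfolded expand_table, unfolded neg_digit compl_digit]
lemma sh_p: "tab (\<lambda>x y z. sh (N x a) (Z y b) = sa z b a) (ds 0 40) (ds 0 242) (ds 0 242)"
  by (rule tab_ds) (auto simp:  ac_simps)
lemmas sh_p_rules = sh_p[unfolded expand_table, unfolded neg_digit compl_digit]
lemma sh_m: "tab (\<lambda>x y z. sh (N (- x) a) (Z z b) = sa y b a) (ds 1 14) (ds 0 242) (ds 1 241)"
  by (rule tab_ds) (auto simp:  ac_simps)
lemmas sh_m_rules = sh_m[unfolded expand_table, unfolded neg_digit compl_digit]
lemma sh_ml: "tab (\<lambda>x y z. sh (N (- x) a) (Z z b) = sa y b a) (ds 15 25) (ds 0 150) (ds 15 135)"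
  by (rule tab_ds) (auto simp:  ac_simps)
lemmas sh_ml_rules = sh_ml[unfolded expand_table, unfolded neg_digit compl_digit]
lemma sh_m1: "tab (\<lambda>x y z. sh (N (- z) a) (Z x b) = sa (- y) b a) (ds 0 40) (ds 1 1) (ds 1 39)"
  by (rule tab_ds) (auto simp:  ac_simps)
lemmas sh_m1_rules = sh_m1[unfolded expand_table, unfolded neg_digit compl_digit]
lemma sh_m_Neg: "tab (\<lambda>x y z. sh (N (- z) a) (Z x b) = Neg) (ds 0 40) (ds 2 38) (ds 2 38)"
  by (rule tab_ds) (auto simp:  ac_simps)
lemmas sh_m_Neg_rules = sh_m_Neg[unfolded expand_table, unfolded neg_digit compl_digit]
lemma Neg_simps: "acc v Neg = Neg" "sh v Neg = Neg"
  by (induction v; simp) (cases v; simp)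

lemma node_simps: "ad (B x y) (B x' y') = B (ad x x') (ad y y')"
  "neg (B x y) = B (neg x) (neg y)" "acc (B x y) z = acc y (acc x z)"
  "ad (V8 x1 x2 x3 x4 x5 x6 x7 x8) (V8 y1 y2 y3 y4 y5 y6 y7 y8) =
     V8 (ad x1 y1) (ad x2 y2) (ad x3 y3) (ad x4 y4) (ad x5 y5) (ad x6 y6) (ad x7 y7) (ad x8 y8)"
  "neg (V8 x1 x2 x3 x4 x5 x6 x7 x8) = V8 (neg x1) (neg x2) (neg x3) (neg x4) (neg x5) (neg x6) (neg x7) (neg x8)"
  "acc (V8 x1 x2 x3 x4 x5 x6 x7 x8) z =
     acc x8 (acc x7 (acc x6 (acc x5 (acc x4 (acc x3 (acc x2 (acc x1 z)))))))"
  by simp_all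
declare
  la.simps [simp del] tab.simps [simp del]
lemmas tables =
  ad_low_rules
  ad_carry_rules
  sb_low_rules
  sb_borrow_rules
  sa_low_rules
  sa_carry_rules
  dec_pos_rules
  sz_pos_rules
  ic_pos_rules
  h0_pp_rules
  h0_mm_rules
  h0_pm_rules
  h0_mp_rules
  h1_pp_rules
  h1_mm_rules
  h1_pm_rules
  h1_mp_rules
  n0_p_rules
  n0_m_rules
  n1_p_rules
  n1_m_rules
  neg_low_rules
  acc_p_rules
  acc_pl_rules
  acc_p_Neg_rules
  acc_m_rules
  acc_ml_rules
  acc_m1_rules
  acc_m_Neg_rules
  sh_p_rules
  sh_m_rules
  sh_ml_rules
  sh_m1_rules
  sh_m_Neg_rules

section \<open>The search and its certificates\<close>

text \<open>A level of \<open>cols\<close> holds the column of one setting and its negative; the component of row \<open>0\<close>,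
  which enters the functional without absolute value, is kept apart and added to the slack.
  At a \<open>CL\<close> level a branch is closed as soon as the slack covers the 1-norm of the partial sum;
  the leaf \<open>CE\<close> is false because it is reached only by uncovered branches.\<close>

datatype cols = CE | CK vec vec vec vec cols | CL vec vec vec vec cols

fun dfs :: "cols \<Rightarrow> slack \<Rightarrow> vec \<Rightarrow> bool" where
  "dfs CE s g = False"
| "dfs (CK v w e f k) s g = (dfs k (sh e s) (ad g v) \<and> dfs k (sh f s) (ad g w))"
| "dfs (CL v w e f k) s g =
     ((acc (ad g v) (sh e s) \<noteq> Neg \<or> dfs k (sh e s) (ad g v)) \<and>
      (acc (ad g w) (sh f s) \<noteq> Neg \<or> dfs k (sh f s) (ad g w)))"

datatype prefix = PAll | PNone | PBr prefix prefix

text \<open>\<open>PNone\<close> stands for strategies that are treated with the last two parties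
  exchanged, hence the value \<open>True\<close>.\<close>

fun dfp :: "prefix \<Rightarrow> cols \<Rightarrow> slack \<Rightarrow> vec \<Rightarrow> bool" where
  "dfp PAll k s g = dfs k s g"
| "dfp PNone k s g = True"
| "dfp (PBr p q) (CK v w e f k) s g = (dfp p k (sh e s) (ad g v) \<and> dfp q k (sh f s) (ad g w))"
| "dfp (PBr p q) k s g = False"

text \<open>\<open>Del t\<close> says that the bound for the tail of open signs drops by \<open>100 t\<close> at this level. These
  decrements are data found outside; \<open>tr\<close> and \<open>tl0\<close> check that they are valid bounds.\<close>

datatype plan = Fin | Skip plan | Tst plan | Del int plan

text \<open>The slack moves against row 0: taking the positive column uses up \<open>n\<close>, so
  \<open>neg n\<close> goes with \<open>v\<close> and \<open>n\<close> with \<open>neg v\<close>.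
  Decrements are merged into these increments, which saves an addition at every node.\<close>

fun mk :: "vec list \<Rightarrow> plan \<Rightarrow> cols" where
  "mk (B n v # cs) (Skip d) = CK v (neg v) (neg n) n (mk cs d)"
| "mk (B n v # cs) (Tst d) = CL v (neg v) (neg n) n (mk cs d)"
| "mk (B n v # cs) (Del t d) = CL v (neg v) (ad (N t D0) (neg n)) (ad (N t D0) n) (mk cs d)"
| "mk cs d = CE"

datatype tail = TE | TQ vec vec int tail

text \<open>Columns are stacked as they are met, so the last one ends up on top. The open columns
  always form a suffix of the list, and the check lets this suffix grow from its end.\<close>

fun tq :: "vec list \<Rightarrow> plan \<Rightarrow> tail \<Rightarrow> tail" where
  "tq (c # cs) (Skip d) q = tq cs d q"
| "tq (c # cs) (Tst d) q = tq cs d q"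
| "tq (c # cs) (Del t d) q = tq cs d (TQ c (neg c) t q)"
| "tq cs d q = q"

fun tr :: "tail \<Rightarrow> slack \<Rightarrow> vec \<Rightarrow> bool" where
  "tr TE r v = True"
| "tr (TQ c c' t q) r v =
     (acc (ad v c) (sh (N t D0) r) \<noteq> Neg \<and> tr q (sh (N t D0) r) (ad v c) \<and>
      acc (ad v c') (sh (N t D0) r) \<noteq> Neg \<and> tr q (sh (N t D0) r) (ad v c'))"

text \<open>The 1-norm is even, so the sign of the last column may be fixed. Columns enter here with
  row 0 included, because for open signs that component is bounded by its absolute value.\<close>

fun tl0 :: "tail \<Rightarrow> bool" where
  "tl0 (TQ c c' t q) = (acc c (Z t D0) \<noteq> Neg \<and> tr q (Z t D0) c)"
| "tl0 TE = False"

fun s0 :: "plan \<Rightarrow> slack \<Rightarrow> slack" where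
  "s0 Fin z = z"
| "s0 (Skip d) z = s0 d z"
| "s0 (Tst d) z = s0 d z"
| "s0 (Del t d) z = s0 d (sh (neg (N t D0)) z)"

text \<open>The search works with half the functional: \<open>26072 / 2 = 13036\<close>, with digits 130 and 36.\<close>

fun leaf :: "prefix \<Rightarrow> plan \<Rightarrow> vec list \<Rightarrow> bool" where
  "leaf p d (B n v # cs) = (tl0 (tq cs d TE) \<and> dfp p (mk cs d) (sh (neg n) (s0 d (Z D130 D36))) v)"
| "leaf p d cs = False"

text \<open>Six levels branch without a test, the seventh tests against the bound for six open
  columns, and each later level lowers this bound by one decrement. The five signs of a prefix fall
  on untested levels, as \<open>dfp\<close> requires.\<close>

definition plan6 :: "int \<Rightarrow> int \<Rightarrow> int \<Rightarrow> int \<Rightarrow> int \<Rightarrow> int \<Rightarrow> plan" where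
  "plan6 a b c d e f = Skip (Skip (Skip (Skip (Skip (Skip (Tst
     (Del a (Del b (Del c (Del d (Del e (Del f Fin))))))))))))"

fun lad :: "vec list \<Rightarrow> vec list \<Rightarrow> vec list" where
  "lad (x # xs) (y # ys) = ad x y # lad xs ys"
| "lad xs ys = []"

text \<open>A tree over the signs of settings 2--5 with six decrements at each leaf;
  \<open>DN\<close> marks strategies that are represented by another member of their orbit.\<close>

datatype deltas = DB deltas deltas | DL int int int int int int | DN

fun rt :: "prefix \<Rightarrow> deltas \<Rightarrow> vec list list \<Rightarrow> vec list \<Rightarrow> bool" where
  "rt p (DB x y) (t # ts) m = (rt p x ts (lad m t) \<and> rt p y ts m)"
| "rt p (DL a b c d e f) [] m = leaf p (plan6 a b c d e f) m"
| "rt p DN ts m = True"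
| "rt p x ts m = False"

text \<open>\<open>FE\<close> is the level of setting 1. Its sign is the only one outside the ring
  10--13 on which the prefix depends, so \<open>FP\<close> provides two prefixes, one for each
  branch of \<open>FE\<close>.\<close>

datatype forest = FB forest forest | FN | FP prefix prefix forest | FE deltas deltas

fun rf :: "prefix \<Rightarrow> prefix \<Rightarrow> forest \<Rightarrow> vec list list \<Rightarrow> vec list \<Rightarrow> bool" where
  "rf p q (FB x y) (t # ts) m = (rf p q x ts (lad m t) \<and> rf p q y ts m)"
| "rf p q FN ts m = True"
| "rf p q (FP p' q' x) ts m = rf p' q' x ts m"
| "rf p q (FE x y) (t # ts) m = (rt p x ts (lad m t) \<and> rt q y ts m)"
| "rf p q x ts m = False"

fun mm :: "bool list \<Rightarrow> vec list list \<Rightarrow> vec list \<Rightarrow> vec list" where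
  "mm (b # bs) (t # ts) m = mm bs ts (if b then lad m t else m)"
| "mm bs ts m = m"

text \<open>The simplifier evaluates both arguments of a conjunction or conditional, so lazy evaluation has
  to be expressed by functions that match on the value of the test.\<close>

definition tst :: "cols \<Rightarrow> slack \<Rightarrow> vec \<Rightarrow> bool" where
  "tst k s g = (acc g s \<noteq> Neg \<or> dfs k s g)"
fun chk :: "slack \<Rightarrow> cols \<Rightarrow> slack \<Rightarrow> vec \<Rightarrow> bool" where
  "chk (Z u b) k s g = True"
| "chk Neg k s g = dfs k s g"
fun trt :: "tail \<Rightarrow> slack \<Rightarrow> vec \<Rightarrow> bool" where "trt q r v = (acc v r \<noteq> Neg \<and> tr q r v)"
fun trc :: "slack \<Rightarrow> tail \<Rightarrow> slack \<Rightarrow> vec \<Rightarrow> bool" where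
  "trc (Z u b) q r v = tr q r v"
| "trc Neg q r v = False"
definition con :: "bool \<Rightarrow> bool \<Rightarrow> bool" where "con x y = (x \<and> y)"

lemma con_simps: "con True y = y" "con False y = False" by (simp_all add: con_def)
lemma tst_chk: "tst k s g = chk (acc g s) k s g"
  by (cases "acc g s") (simp_all add: tst_def)
lemma trt_trc: "trt q r v = trc (acc v r) q r v"
  by (cases "acc v r") simp_all
lemma tr_simps: "tr (TQ c c' t q) r v =
    con (trt q (sh (N t D0) r) (ad v c)) (trt q (sh (N t D0) r) (ad v c'))"
  unfolding con_def by simp
lemma tl0_simps: "tl0 (TQ c c' t q) = trt q (Z t D0) c"
  by simp
lemma dfs_simps:
  "dfs (CK v w e f k) s g = con (dfs k (sh e s) (ad g v)) (dfs k (sh f s) (ad g w))"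
  "dfs (CL v w e f k) s g = con (tst k (sh e s) (ad g v)) (tst k (sh f s) (ad g w))"
  "dfp (PBr p q) (CK v w e f k) s g = con (dfp p k (sh e s) (ad g v)) (dfp q k (sh f s) (ad g w))"
  "leaf p d (B n v # cs) =
     con (tl0 (tq cs d TE)) (dfp p (mk cs d) (sh (neg n) (s0 d (Z D130 D36))) v)"
  "rt p (DB x y) (t # ts) m = con (rt p x ts (lad m t)) (rt p y ts m)"
  "rf p q (FB h h') (t # ts) m = con (rf p q h ts (lad m t)) (rf p q h' ts m)"
  "rf p q (FE x y) (t # ts) m = con (rt p x ts (lad m t)) (rt q y ts m)"
  by (simp_all add: con_def tst_def)
lemma mm_simps: "mm (True # bs) (t # ts) m = mm bs ts (lad m t)"
  "mm (False # bs) (t # ts) m = mm bs ts m"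
  by simp_all
lemma rt_DN: "rt p DN ts m = True" by simp
lemmas machine = node_simps Neg_simps con_simps tst_chk chk.simps trt_trc trc.simps
  tr.simps(1) tr_simps tl0_simps dfs.simps(1) dfs_simps(1,2) dfp.simps(1,2) dfs_simps(3-7)
  rt.simps(2) rt_DN rf.simps(2,3) mm_simps mk.simps(1-3) tq.simps(1-3) s0.simps lad.simps(1) plan6_def
  slack_edge n0_0
lemma end_simps: "mk [] Fin = CE" "tq [] Fin q = q" "lad [] [] = []" "mm [] [] m = m"
  by simp_all

section \<open>Coefficients of the Bell inequality\<close>

text \<open>The coefficients were found numerically, by rounding the normal of a facet of the local polytope
  next to the W state to integers with even column sums. Settings 2--5, 6--9 and 10--13 form
  three rings around the axis of setting 1, each permuted cyclically by \<open>rot\<close>.\<close>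

definition mC :: "vec list list" where "mC =
  [[N D0 D0, N M13 D58, N M2 D25, N M2 D25, N M2 D25, N M2 D25, N M5 D99, N M5 D99, N M5 D99, N M5 D99, N M11 D91, N M11 D91, N M11 D91, N M11 D91],
   [N M13 D58, N M4 D0, N M1 D17, N M1 D17, N M1 D17, N M1 D17, N M2 D75, N M2 D75, N M2 D75, N M2 D75, N M1 D76, N M1 D76, N M1 D76, N M1 D76],
   [N M2 D25, N M1 D17, N M1 D69, N D0 D16, N D0 D1, N D0 D16, N D1 D39, N M2 D48, N M2 D48, N D1 D39, N D0 D68, N M1 D44, N M1 D84, N M1 D44],
   [N M2 D25, N M1 D17, N D0 D16, N M1 D69, N D0 D16, N D0 D1, N D1 D39, N D1 D39, N M2 D48, N M2 D48, N M1 D44, N D0 D68, N M1 D44, N M1 D84],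
   [N M2 D25, N M1 D17, N D0 D1, N D0 D16, N M1 D69, N D0 D16, N M2 D48, N D1 D39, N D1 D39, N M2 D48, N M1 D84, N M1 D44, N D0 D68, N M1 D44],
   [N M2 D25, N M1 D17, N D0 D16, N D0 D1, N D0 D16, N M1 D69, N M2 D48, N M2 D48, N D1 D39, N D1 D39, N M1 D44, N M1 D84, N M1 D44, N D0 D68],
   [N M5 D99, N M2 D75, N D1 D39, N D1 D39, N M2 D48, N M2 D48, N M1 D90, N M1 D35, N D0 D16, N M1 D35, N D1 D15, N D1 D15, N M2 D3, N M2 D3],
   [N M5 D99, N M2 D75, N M2 D48, N D1 D39, N D1 D39, N M2 D48, N M1 D35, N M1 D90, N M1 D35, N D0 D16, N M2 D3, N D1 D15, N D1 D15, N M2 D3],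
   [N M5 D99, N M2 D75, N M2 D48, N M2 D48, N D1 D39, N D1 D39, N D0 D16, N M1 D35, N M1 D90, N M1 D35, N M2 D3, N M2 D3, N D1 D15, N D1 D15],
   [N M5 D99, N M2 D75, N D1 D39, N M2 D48, N M2 D48, N D1 D39, N M1 D35, N D0 D16, N M1 D35, N M1 D90, N D1 D15, N M2 D3, N M2 D3, N D1 D15],
   [N M11 D91, N M1 D76, N D0 D68, N M1 D44, N M1 D84, N M1 D44, N D1 D15, N M2 D3, N M2 D3, N D1 D15, N M1 D22, N M3 D47, N D0 D7, N M3 D47],
   [N M11 D91, N M1 D76, N M1 D44, N D0 D68, N M1 D44, N M1 D84, N D1 D15, N D1 D15, N M2 D3, N M2 D3, N M3 D47, N M1 D22, N M3 D47, N D0 D7],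
   [N M11 D91, N M1 D76, N M1 D84, N M1 D44, N D0 D68, N M1 D44, N M2 D3, N D1 D15, N D1 D15, N M2 D3, N D0 D7, N M3 D47, N M1 D22, N M3 D47],
   [N M11 D91, N M1 D76, N M1 D44, N M1 D84, N M1 D44, N D0 D68, N M2 D3, N M2 D3, N D1 D15, N D1 D15, N M3 D47, N D0 D7, N M3 D47, N M1 D22]]"
definition mP :: "vec list list" where "mP =
  [[N M4 D31, N M2 D17, N M1 D65, N M1 D65, N M1 D65, N M1 D65, N M1 D0, N M1 D0, N M1 D0, N M1 D0, N D0 D18, N D0 D18, N D0 D18, N D0 D18],
   [N M2 D17, N M4 D51, N M1 D95, N M1 D95, N M1 D95, N M1 D95, N D0 D18, N D0 D18, N D0 D18, N D0 D18, N M1 D91, N M1 D91, N M1 D91, N M1 D91],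
   [N M1 D65, N M1 D95, N M1 D96, N D0 D76, N M1 D99, N D0 D76, N D0 D45, N M1 D18, N M1 D18, N D0 D45, N M1 D74, N M1 D83, N D0 D7, N M1 D83],
   [N M1 D65, N M1 D95, N D0 D76, N M1 D96, N D0 D76, N M1 D99, N D0 D45, N D0 D45, N M1 D18, N M1 D18, N M1 D83, N M1 D74, N M1 D83, N D0 D7],
   [N M1 D65, N M1 D95, N M1 D99, N D0 D76, N M1 D96, N D0 D76, N M1 D18, N D0 D45, N D0 D45, N M1 D18, N D0 D7, N M1 D83, N M1 D74, N M1 D83],
   [N M1 D65, N M1 D95, N D0 D76, N M1 D99, N D0 D76, N M1 D96, N M1 D18, N M1 D18, N D0 D45, N D0 D45, N M1 D83, N D0 D7, N M1 D83, N M1 D74],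
   [N M1 D0, N D0 D18, N D0 D45, N D0 D45, N M1 D18, N M1 D18, N M1 D66, N D0 D52, N M1 D16, N D0 D52, N M1 D78, N M1 D78, N M1 D84, N M1 D84],
   [N M1 D0, N D0 D18, N M1 D18, N D0 D45, N D0 D45, N M1 D18, N D0 D52, N M1 D66, N D0 D52, N M1 D16, N M1 D84, N M1 D78, N M1 D78, N M1 D84],
   [N M1 D0, N D0 D18, N M1 D18, N M1 D18, N D0 D45, N D0 D45, N M1 D16, N D0 D52, N M1 D66, N D0 D52, N M1 D84, N M1 D84, N M1 D78, N M1 D78],
   [N M1 D0, N D0 D18, N D0 D45, N M1 D18, N M1 D18, N D0 D45, N D0 D52, N M1 D16, N D0 D52, N M1 D66, N M1 D78, N M1 D84, N M1 D84, N M1 D78],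
   [N D0 D18, N M1 D91, N M1 D74, N M1 D83, N D0 D7, N M1 D83, N M1 D78, N M1 D84, N M1 D84, N M1 D78, N D0 D25, N M1 D98, N M2 D69, N M1 D98],
   [N D0 D18, N M1 D91, N M1 D83, N M1 D74, N M1 D83, N D0 D7, N M1 D78, N M1 D78, N M1 D84, N M1 D84, N M1 D98, N D0 D25, N M1 D98, N M2 D69],
   [N D0 D18, N M1 D91, N D0 D7, N M1 D83, N M1 D74, N M1 D83, N M1 D84, N M1 D78, N M1 D78, N M1 D84, N M2 D69, N M1 D98, N D0 D25, N M1 D98],
   [N D0 D18, N M1 D91, N M1 D83, N D0 D7, N M1 D83, N M1 D74, N M1 D84, N M1 D84, N M1 D78, N M1 D78, N M1 D98, N M2 D69, N M1 D98, N D0 D25]]"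
definition mR0 :: "vec list list" where "mR0 =
  [[N M1 D14, N M1 D33, N M1 D80, N D0 D1, N D0 D1, N D0 D1, N D0 D87, N M1 D16, N M1 D16, N D0 D87, N D0 D70, N M1 D63, N M1 D78, N M1 D63],
   [N M1 D33, N M1 D22, N M1 D49, N M1 D84, N M1 D59, N M1 D84, N D0 D37, N M1 D12, N M1 D12, N D0 D37, N D0 D24, N M1 D74, N D0 D3, N M1 D74],
   [N M1 D80, N M1 D49, N D0 D11, N M1 D92, N M1 D91, N M1 D92, N M1 D78, N D0 D55, N D0 D55, N M1 D78, N D0 D48, N D0 D62, N D0 D3, N D0 D62],
   [N D0 D1, N M1 D84, N M1 D92, N D0 D7, N M1 D96, N D0 D4, N M1 D98, N D0 D16, N M1 D91, N M1 D94, N D0 D27, N D0 D37, N M1 D66, N M1 D85],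
   [N D0 D1, N M1 D59, N M1 D91, N M1 D96, N M1 D92, N M1 D96, N D0 D4, N D0 D7, N D0 D7, N D0 D4, N M1 D95, N D0 D1, N D0 D16, N D0 D1],
   [N D0 D1, N M1 D84, N M1 D92, N D0 D4, N M1 D96, N D0 D7, N M1 D94, N M1 D91, N D0 D16, N M1 D98, N D0 D27, N M1 D85, N M1 D66, N D0 D37],
   [N D0 D87, N D0 D37, N M1 D78, N M1 D98, N D0 D4, N M1 D94, N D0 D36, N M1 D91, N M1 D99, N D0 D41, N D0 D90, N D0 D23, N M1 D71, N M1 D73],
   [N M1 D16, N M1 D12, N D0 D55, N D0 D16, N D0 D7, N M1 D91, N M1 D91, N D0 D19, N M1 D92, N M1 D99, N M1 D91, N M1 D29, N M1 D69, N D0 D19],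
   [N M1 D16, N M1 D12, N D0 D55, N M1 D91, N D0 D7, N D0 D16, N M1 D99, N M1 D92, N D0 D19, N M1 D91, N M1 D91, N D0 D19, N M1 D69, N M1 D29],
   [N D0 D87, N D0 D37, N M1 D78, N M1 D94, N D0 D4, N M1 D98, N D0 D41, N M1 D99, N M1 D91, N D0 D36, N D0 D90, N M1 D73, N M1 D71, N D0 D23],
   [N D0 D70, N D0 D24, N D0 D48, N D0 D27, N M1 D95, N D0 D27, N D0 D90, N M1 D91, N M1 D91, N D0 D90, N D0 D23, N D0 D6, N D0 D28, N D0 D6],
   [N M1 D63, N M1 D74, N D0 D62, N D0 D37, N D0 D1, N M1 D85, N D0 D23, N M1 D29, N D0 D19, N M1 D73, N D0 D6, N M1 D40, N M1 D95, N M1 D83],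
   [N M1 D78, N D0 D3, N D0 D3, N M1 D66, N D0 D16, N M1 D66, N M1 D71, N M1 D69, N M1 D69, N M1 D71, N D0 D28, N M1 D95, N M1 D32, N M1 D95],
   [N M1 D63, N M1 D74, N D0 D62, N M1 D85, N D0 D1, N D0 D37, N M1 D73, N D0 D19, N M1 D29, N D0 D23, N D0 D6, N M1 D83, N M1 D95, N M1 D40]]"
definition mR1 :: "vec list list" where "mR1 =
  [[N M2 D34, N M1 D13, N D0 D53, N D0 D53, N M1 D40, N M1 D40, N D0 D23, N M1 D59, N M1 D94, N M1 D59, N D0 D43, N D0 D43, N M1 D23, N M1 D23],
   [N M1 D13, N D0 D0, N D0 D22, N D0 D22, N M1 D1, N M1 D1, N M1 D85, N D0 D32, N M1 D28, N D0 D32, N D0 D14, N D0 D14, N M1 D85, N M1 D85],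
   [N D0 D53, N D0 D22, N M1 D75, N D0 D19, N D0 D5, N D0 D1, N D0 D21, N M1 D72, N D0 D5, N D0 D13, N D0 D58, N D0 D55, N M1 D50, N D0 D5],
   [N D0 D53, N D0 D22, N D0 D19, N M1 D75, N D0 D1, N D0 D5, N D0 D21, N D0 D13, N D0 D5, N M1 D72, N D0 D55, N D0 D58, N D0 D5, N M1 D50],
   [N M1 D40, N M1 D1, N D0 D5, N D0 D1, N D0 D35, N D0 D11, N D0 D80, N M1 D95, N D0 D5, N M1 D89, N M1 D75, N M1 D26, N D0 D19, N M1 D90],
   [N M1 D40, N M1 D1, N D0 D1, N D0 D5, N D0 D11, N D0 D35, N D0 D80, N M1 D89, N D0 D5, N M1 D95, N M1 D26, N M1 D75, N M1 D90, N D0 D19],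
   [N D0 D23, N M1 D85, N D0 D21, N D0 D21, N D0 D80, N D0 D80, N D0 D53, N D0 D34, N M1 D95, N D0 D34, N D0 D49, N D0 D49, N D0 D37, N D0 D37],
   [N M1 D59, N D0 D32, N M1 D72, N D0 D13, N M1 D95, N M1 D89, N D0 D34, N D0 D19, N M1 D90, N D0 D18, N M1 D26, N D0 D4, N M1 D34, N M1 D81],
   [N M1 D94, N M1 D28, N D0 D5, N D0 D5, N D0 D5, N D0 D5, N M1 D95, N M1 D90, N D0 D25, N M1 D90, N M1 D83, N M1 D83, N D0 D13, N D0 D13],
   [N M1 D59, N D0 D32, N D0 D13, N M1 D72, N M1 D89, N M1 D95, N D0 D34, N D0 D18, N M1 D90, N D0 D19, N D0 D4, N M1 D26, N M1 D81, N M1 D34],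
   [N D0 D43, N D0 D14, N D0 D58, N D0 D55, N M1 D75, N M1 D26, N D0 D49, N M1 D26, N M1 D83, N D0 D4, N M1 D90, N D0 D5, N M1 D89, N M1 D85],
   [N D0 D43, N D0 D14, N D0 D55, N D0 D58, N M1 D26, N M1 D75, N D0 D49, N D0 D4, N M1 D83, N M1 D26, N D0 D5, N M1 D90, N M1 D85, N M1 D89],
   [N M1 D23, N M1 D85, N M1 D50, N D0 D5, N D0 D19, N M1 D90, N D0 D37, N M1 D34, N D0 D13, N M1 D81, N M1 D89, N M1 D85, N M2 D86, N M1 D97],
   [N M1 D23, N M1 D85, N D0 D5, N M1 D50, N M1 D90, N D0 D19, N D0 D37, N M1 D81, N D0 D13, N M1 D34, N M1 D85, N M1 D89, N M1 D97, N M2 D86]]"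
definition mR2 :: "vec list list" where "mR2 =
  [[N M4 D10, N M1 D88, N D0 D26, N M1 D63, N M1 D62, N M1 D63, N D0 D35, N M1 D30, N M1 D30, N D0 D35, N M1 D69, N M1 D22, N M1 D75, N M1 D22],
   [N M1 D88, N M1 D80, N M1 D62, N M1 D96, N M1 D90, N M1 D96, N M1 D91, N M1 D95, N M1 D95, N M1 D91, N D0 D13, N M1 D93, N M2 D39, N M1 D93],
   [N D0 D26, N M1 D62, N D0 D19, N M1 D89, N M1 D79, N M1 D89, N D0 D57, N M1 D91, N M1 D91, N D0 D57, N D0 D33, N D0 D1, N D0 D21, N D0 D1],
   [N M1 D63, N M1 D96, N M1 D89, N D0 D14, N D0 D9, N M1 D62, N D0 D21, N D0 D6, N D0 D6, N M1 D43, N D0 D24, N M1 D86, N M1 D63, N M1 D96],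
   [N M1 D62, N M1 D90, N M1 D79, N D0 D9, N M1 D81, N D0 D9, N M1 D46, N M1 D58, N M1 D58, N M1 D46, N M1 D75, N M1 D94, N D0 D15, N M1 D94],
   [N M1 D63, N M1 D96, N M1 D89, N M1 D62, N D0 D9, N D0 D14, N M1 D43, N D0 D6, N D0 D6, N D0 D21, N D0 D24, N M1 D96, N M1 D63, N M1 D86],
   [N D0 D35, N M1 D91, N D0 D57, N D0 D21, N M1 D46, N M1 D43, N D0 D61, N M1 D68, N D0 D9, N M1 D53, N D0 D20, N D0 D38, N M1 D93, N M1 D95],
   [N M1 D30, N M1 D95, N M1 D91, N D0 D6, N M1 D58, N D0 D6, N M1 D68, N D0 D25, N M1 D77, N D0 D9, N M2 D56, N D0 D21, N M1 D86, N M1 D96],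
   [N M1 D30, N M1 D95, N M1 D91, N D0 D6, N M1 D58, N D0 D6, N D0 D9, N M1 D77, N D0 D25, N M1 D68, N M2 D56, N M1 D96, N M1 D86, N D0 D21],
   [N D0 D35, N M1 D91, N D0 D57, N M1 D43, N M1 D46, N D0 D21, N M1 D53, N D0 D9, N M1 D68, N D0 D61, N D0 D20, N M1 D95, N M1 D93, N D0 D38],
   [N M1 D69, N D0 D13, N D0 D33, N D0 D24, N M1 D75, N D0 D24, N D0 D20, N M2 D56, N M2 D56, N D0 D20, N D0 D74, N M1 D64, N D0 D60, N M1 D64],
   [N M1 D22, N M1 D93, N D0 D1, N M1 D86, N M1 D94, N M1 D96, N D0 D38, N D0 D21, N M1 D96, N M1 D95, N M1 D64, N M2 D85, N M1 D57, N M1 D38],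
   [N M1 D75, N M2 D39, N D0 D21, N M1 D63, N D0 D15, N M1 D63, N M1 D93, N M1 D86, N M1 D86, N M1 D93, N D0 D60, N M1 D57, N D1 D14, N M1 D57],
   [N M1 D22, N M1 D93, N D0 D1, N M1 D96, N M1 D94, N M1 D86, N M1 D95, N M1 D96, N D0 D21, N D0 D38, N M1 D64, N M1 D38, N M1 D57, N M2 D85]]"
definition mR3 :: "vec list list" where "mR3 =
  [[N M5 D20, N D0 D9, N D0 D54, N D0 D54, N M1 D9, N M1 D9, N D0 D37, N M1 D64, N D0 D28, N M1 D64, N M1 D86, N M1 D86, N M2 D68, N M2 D68],
   [N D0 D9, N D0 D29, N D0 D23, N D0 D23, N M1 D63, N M1 D63, N D0 D15, N M1 D85, N M1 D65, N M1 D85, N M1 D51, N M1 D51, N M1 D31, N M1 D31],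
   [N D0 D54, N D0 D23, N D0 D33, N D0 D8, N D0 D9, N D0 D19, N D1 D14, N M1 D80, N M1 D91, N D0 D37, N D0 D10, N M1 D86, N M1 D93, N D0 D5],
   [N D0 D54, N D0 D23, N D0 D8, N D0 D33, N D0 D19, N D0 D9, N D1 D14, N D0 D37, N M1 D91, N M1 D80, N M1 D86, N D0 D10, N D0 D5, N M1 D93],
   [N M1 D9, N M1 D63, N D0 D9, N D0 D19, N D0 D26, N M1 D53, N M1 D56, N M1 D93, N M1 D62, N M1 D91, N M1 D24, N M1 D7, N D0 D61, N D0 D31],
   [N M1 D9, N M1 D63, N D0 D19, N D0 D9, N M1 D53, N D0 D26, N M1 D56, N M1 D91, N M1 D62, N M1 D93, N M1 D7, N M1 D24, N D0 D31, N D0 D61],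
   [N D0 D37, N D0 D15, N D1 D14, N D1 D14, N M1 D56, N M1 D56, N D0 D52, N D0 D8, N D0 D22, N D0 D8, N D0 D2, N D0 D2, N D0 D44, N D0 D44],
   [N M1 D64, N M1 D85, N M1 D80, N D0 D37, N M1 D93, N M1 D91, N D0 D8, N M1 D97, N M1 D66, N M1 D58, N M1 D2, N D0 D9, N M1 D86, N D0 D8],
   [N D0 D28, N M1 D65, N M1 D91, N M1 D91, N M1 D62, N M1 D62, N D0 D22, N M1 D66, N D0 D9, N M1 D66, N M1 D42, N M1 D42, N M1 D88, N M1 D88],
   [N M1 D64, N M1 D85, N D0 D37, N M1 D80, N M1 D91, N M1 D93, N D0 D8, N M1 D58, N M1 D66, N M1 D97, N D0 D9, N M1 D2, N D0 D8, N M1 D86],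
   [N M1 D86, N M1 D51, N D0 D10, N M1 D86, N M1 D24, N M1 D7, N D0 D2, N M1 D2, N M1 D42, N D0 D9, N D0 D79, N D0 D0, N D0 D11, N M1 D15],
   [N M1 D86, N M1 D51, N M1 D86, N D0 D10, N M1 D7, N M1 D24, N D0 D2, N D0 D9, N M1 D42, N M1 D2, N D0 D0, N D0 D79, N M1 D15, N D0 D11],
   [N M2 D68, N M1 D31, N M1 D93, N D0 D5, N D0 D61, N D0 D31, N D0 D44, N M1 D86, N M1 D88, N D0 D8, N D0 D11, N M1 D15, N M2 D89, N D0 D48],
   [N M2 D68, N M1 D31, N D0 D5, N M1 D93, N D0 D31, N D0 D61, N D0 D44, N D0 D8, N M1 D88, N M1 D86, N M1 D15, N D0 D11, N D0 D48, N M2 D89]]"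
definition mR4 :: "vec list list" where "mR4 =
  [[N M1 D51, N M1 D99, N D0 D99, N D0 D99, N M1 D12, N M1 D12, N D0 D2, N M1 D86, N D0 D14, N M1 D86, N D0 D51, N D0 D51, N M1 D15, N M1 D15],
   [N M1 D99, N M1 D98, N D0 D70, N D0 D70, N M1 D13, N M1 D13, N D0 D12, N D0 D10, N M1 D87, N D0 D10, N M1 D87, N M1 D87, N M1 D44, N M1 D44],
   [N D0 D99, N D0 D70, N M1 D78, N D0 D9, N M1 D99, N D0 D8, N M1 D88, N M1 D89, N M1 D89, N M1 D92, N D0 D99, N D0 D8, N D0 D21, N M1 D75],
   [N D0 D99, N D0 D70, N D0 D9, N M1 D78, N D0 D8, N M1 D99, N M1 D88, N M1 D92, N M1 D89, N M1 D89, N D0 D8, N D0 D99, N M1 D75, N D0 D21],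
   [N M1 D12, N M1 D13, N M1 D99, N D0 D8, N D0 D20, N D0 D5, N D0 D59, N M1 D87, N D0 D11, N D0 D13, N D0 D6, N M1 D5, N D0 D35, N M1 D43],
   [N M1 D12, N M1 D13, N D0 D8, N M1 D99, N D0 D5, N D0 D20, N D0 D59, N D0 D13, N D0 D11, N M1 D87, N M1 D5, N D0 D6, N M1 D43, N D0 D35],
   [N D0 D2, N D0 D12, N M1 D88, N M1 D88, N D0 D59, N D0 D59, N D0 D37, N D0 D23, N D0 D3, N D0 D23, N D0 D62, N D0 D62, N D0 D7, N D0 D7],
   [N M1 D86, N D0 D10, N M1 D89, N M1 D92, N M1 D87, N D0 D13, N D0 D23, N D0 D43, N M1 D81, N M1 D86, N D0 D25, N M1 D84, N M1 D84, N M1 D53],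
   [N D0 D14, N M1 D87, N M1 D89, N M1 D89, N D0 D11, N D0 D11, N D0 D3, N M1 D81, N D0 D0, N M1 D81, N D0 D14, N D0 D14, N M1 D51, N M1 D51],
   [N M1 D86, N D0 D10, N M1 D92, N M1 D89, N D0 D13, N M1 D87, N D0 D23, N M1 D86, N M1 D81, N D0 D43, N M1 D84, N D0 D25, N M1 D53, N M1 D84],
   [N D0 D51, N M1 D87, N D0 D99, N D0 D8, N D0 D6, N M1 D5, N D0 D62, N D0 D25, N D0 D14, N M1 D84, N D0 D60, N D0 D33, N M1 D85, N D0 D45],
   [N D0 D51, N M1 D87, N D0 D8, N D0 D99, N M1 D5, N D0 D6, N D0 D62, N M1 D84, N D0 D14, N D0 D25, N D0 D33, N D0 D60, N D0 D45, N M1 D85],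
   [N M1 D15, N M1 D44, N D0 D21, N M1 D75, N D0 D35, N M1 D43, N D0 D7, N M1 D84, N M1 D51, N M1 D53, N M1 D85, N D0 D45, N M2 D46, N D0 D38],
   [N M1 D15, N M1 D44, N M1 D75, N D0 D21, N M1 D43, N D0 D35, N D0 D7, N M1 D53, N M1 D51, N M1 D84, N D0 D45, N M1 D85, N D0 D38, N M2 D46]]"
definition mR5 :: "vec list list" where "mR5 =
  [[N M2 D18, N M1 D26, N D0 D38, N M1 D82, N D0 D30, N M1 D82, N D0 D65, N M2 D99, N M2 D99, N D0 D65, N M1 D87, N M1 D46, N D0 D11, N M1 D46],
   [N M1 D26, N D0 D82, N M1 D58, N D0 D21, N M1 D77, N D0 D21, N D0 D41, N M2 D95, N M2 D95, N D0 D41, N M1 D98, N M1 D87, N M1 D33, N M1 D87],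
   [N D0 D38, N M1 D58, N D0 D48, N M1 D89, N D0 D29, N M1 D89, N D0 D9, N D0 D54, N D0 D54, N D0 D9, N D0 D67, N D0 D20, N D0 D4, N D0 D20],
   [N M1 D82, N D0 D21, N M1 D89, N D0 D26, N D0 D4, N M1 D97, N D0 D19, N M1 D76, N D0 D1, N M1 D92, N M1 D89, N M1 D95, N D0 D24, N M1 D51],
   [N D0 D30, N M1 D77, N D0 D29, N D0 D4, N D0 D1, N D0 D4, N D0 D18, N M1 D83, N M1 D83, N D0 D18, N M1 D73, N M1 D64, N D0 D4, N M1 D64],
   [N M1 D82, N D0 D21, N M1 D89, N M1 D97, N D0 D4, N D0 D26, N M1 D92, N D0 D1, N M1 D76, N D0 D19, N M1 D89, N M1 D51, N D0 D24, N M1 D95],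
   [N D0 D65, N D0 D41, N D0 D9, N D0 D19, N D0 D18, N M1 D92, N D0 D39, N M1 D71, N M1 D84, N D0 D4, N D0 D85, N D0 D13, N M1 D75, N M1 D69],
   [N M2 D99, N M2 D95, N D0 D54, N M1 D76, N M1 D83, N D0 D1, N M1 D71, N D0 D90, N D0 D33, N M1 D84, N D0 D10, N M1 D9, N D0 D20, N M1 D69],
   [N M2 D99, N M2 D95, N D0 D54, N D0 D1, N M1 D83, N M1 D76, N M1 D84, N D0 D33, N D0 D90, N M1 D71, N D0 D10, N M1 D69, N D0 D20, N M1 D9],
   [N D0 D65, N D0 D41, N D0 D9, N M1 D92, N D0 D18, N D0 D19, N D0 D4, N M1 D84, N M1 D71, N D0 D39, N D0 D85, N M1 D69, N M1 D75, N D0 D13],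
   [N M1 D87, N M1 D98, N D0 D67, N M1 D89, N M1 D73, N M1 D89, N D0 D85, N D0 D10, N D0 D10, N D0 D85, N M1 D50, N D0 D11, N D0 D29, N D0 D11],
   [N M1 D46, N M1 D87, N D0 D20, N M1 D95, N M1 D64, N M1 D51, N D0 D13, N M1 D9, N M1 D69, N M1 D69, N D0 D11, N M1 D73, N M1 D53, N M1 D94],
   [N D0 D11, N M1 D33, N D0 D4, N D0 D24, N D0 D4, N D0 D24, N M1 D75, N D0 D20, N D0 D20, N M1 D75, N D0 D29, N M1 D53, N M1 D67, N M1 D53],
   [N M1 D46, N M1 D87, N D0 D20, N M1 D51, N M1 D64, N M1 D95, N M1 D69, N M1 D69, N M1 D9, N D0 D13, N D0 D11, N M1 D94, N M1 D53, N M1 D73]]"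
definition mR6 :: "vec list list" where "mR6 =
  [[N M3 D48, N M1 D7, N D0 D23, N D0 D23, N M1 D77, N M1 D77, N D0 D22, N M1 D49, N M1 D63, N M1 D49, N D0 D21, N D0 D21, N M1 D24, N M1 D24],
   [N M1 D7, N M2 D61, N M1 D83, N M1 D83, N M1 D91, N M1 D91, N M1 D56, N M1 D93, N D0 D54, N M1 D93, N D0 D77, N D0 D77, N M1 D51, N M1 D51],
   [N D0 D23, N M1 D83, N D0 D19, N M1 D82, N M1 D91, N M1 D85, N D0 D56, N M1 D56, N D0 D11, N D0 D21, N D0 D7, N D0 D6, N D0 D31, N M1 D79],
   [N D0 D23, N M1 D83, N M1 D82, N D0 D19, N M1 D85, N M1 D91, N D0 D56, N D0 D21, N D0 D11, N M1 D56, N D0 D6, N D0 D7, N M1 D79, N D0 D31],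
   [N M1 D77, N M1 D91, N M1 D91, N M1 D85, N M1 D94, N M1 D80, N M1 D28, N D0 D10, N M1 D90, N M1 D61, N M1 D68, N D0 D2, N D0 D23, N D0 D0],
   [N M1 D77, N M1 D91, N M1 D85, N M1 D91, N M1 D80, N M1 D94, N M1 D28, N M1 D61, N M1 D90, N D0 D10, N D0 D2, N M1 D68, N D0 D0, N D0 D23],
   [N D0 D22, N M1 D56, N D0 D56, N D0 D56, N M1 D28, N M1 D28, N D0 D50, N M1 D68, N M1 D86, N M1 D68, N D0 D6, N D0 D6, N D0 D7, N D0 D7],
   [N M1 D49, N M1 D93, N M1 D56, N D0 D21, N D0 D10, N M1 D61, N M1 D68, N M1 D87, N M1 D75, N M1 D61, N M1 D67, N D0 D14, N D0 D7, N D0 D27],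
   [N M1 D63, N D0 D54, N D0 D11, N D0 D11, N M1 D90, N M1 D90, N M1 D86, N M1 D75, N M1 D95, N M1 D75, N M1 D34, N M1 D34, N M1 D80, N M1 D80],
   [N M1 D49, N M1 D93, N D0 D21, N M1 D56, N M1 D61, N D0 D10, N M1 D68, N M1 D61, N M1 D75, N M1 D87, N D0 D14, N M1 D67, N D0 D27, N D0 D7],
   [N D0 D21, N D0 D77, N D0 D7, N D0 D6, N M1 D68, N D0 D2, N D0 D6, N M1 D67, N M1 D34, N D0 D14, N M1 D48, N M1 D50, N M1 D16, N M1 D30],
   [N D0 D21, N D0 D77, N D0 D6, N D0 D7, N D0 D2, N M1 D68, N D0 D6, N D0 D14, N M1 D34, N M1 D67, N M1 D50, N M1 D48, N M1 D30, N M1 D16],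
   [N M1 D24, N M1 D51, N D0 D31, N M1 D79, N D0 D23, N D0 D0, N D0 D7, N D0 D7, N M1 D80, N D0 D27, N M1 D16, N M1 D30, N D0 D67, N D0 D70],
   [N M1 D24, N M1 D51, N M1 D79, N D0 D31, N D0 D0, N D0 D23, N D0 D7, N D0 D27, N M1 D80, N D0 D7, N M1 D30, N M1 D16, N D0 D70, N D0 D67]]"
definition mX :: "vec list list" where "mX =
  [[N D0 D0, N D0 D0, N M1 D94, N D0 D0, N D0 D6, N D0 D0, N D0 D63, N M1 D37, N M1 D37, N D0 D63, N D0 D58, N D0 D0, N M1 D42, N D0 D0],
   [N D0 D0, N D0 D0, N D0 D2, N D0 D0, N M1 D98, N D0 D0, N D0 D40, N M1 D60, N M1 D60, N D0 D40, N M1 D98, N D0 D0, N D0 D2, N D0 D0],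
   [N M1 D94, N D0 D2, N M1 D94, N M1 D97, N D0 D0, N M1 D97, N M1 D97, N M1 D94, N M1 D94, N M1 D97, N D0 D4, N D0 D18, N M1 D94, N D0 D18],
   [N D0 D0, N D0 D0, N M1 D97, N D0 D0, N D0 D3, N D0 D0, N M1 D68, N D0 D32, N M1 D74, N D0 D26, N D0 D29, N D0 D0, N M1 D71, N D0 D0],
   [N D0 D6, N M1 D98, N D0 D0, N D0 D3, N D0 D6, N D0 D3, N D0 D6, N D0 D3, N D0 D3, N D0 D6, N D0 D6, N M1 D82, N M1 D96, N M1 D82],
   [N D0 D0, N D0 D0, N M1 D97, N D0 D0, N D0 D3, N D0 D0, N D0 D26, N M1 D74, N D0 D32, N M1 D68, N D0 D29, N D0 D0, N M1 D71, N D0 D0],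
   [N D0 D63, N D0 D40, N M1 D97, N M1 D68, N D0 D6, N D0 D26, N M1 D68, N D0 D0, N D0 D0, N D0 D3, N D0 D69, N D0 D98, N M1 D54, N D0 D8],
   [N M1 D37, N M1 D60, N M1 D94, N D0 D32, N D0 D3, N M1 D74, N D0 D0, N D0 D32, N M1 D97, N D0 D0, N D0 D46, N M1 D2, N M1 D31, N M1 D92],
   [N M1 D37, N M1 D60, N M1 D94, N M1 D74, N D0 D3, N D0 D32, N D0 D0, N M1 D97, N D0 D32, N D0 D0, N D0 D46, N M1 D92, N M1 D31, N M1 D2],
   [N D0 D63, N D0 D40, N M1 D97, N D0 D26, N D0 D6, N M1 D68, N D0 D3, N D0 D0, N D0 D0, N M1 D68, N D0 D69, N D0 D8, N M1 D54, N D0 D98],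
   [N D0 D58, N M1 D98, N D0 D4, N D0 D29, N D0 D6, N D0 D29, N D0 D69, N D0 D46, N D0 D46, N D0 D69, N D0 D52, N M1 D82, N D0 D0, N M1 D82],
   [N D0 D0, N D0 D0, N D0 D18, N D0 D0, N M1 D82, N D0 D0, N D0 D98, N M1 D2, N M1 D92, N D0 D8, N M1 D82, N D0 D0, N D0 D18, N D0 D0],
   [N M1 D42, N D0 D2, N M1 D94, N M1 D71, N M1 D96, N M1 D71, N M1 D54, N M1 D31, N M1 D31, N M1 D54, N D0 D0, N D0 D18, N M1 D48, N D0 D18],
   [N D0 D0, N D0 D0, N D0 D18, N D0 D0, N M1 D82, N D0 D0, N D0 D8, N M1 D92, N M1 D2, N D0 D98, N M1 D82, N D0 D0, N D0 D18, N D0 D0]]"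
definition rot :: "nat list" where "rot = [0, 1, 5, 2, 3, 4, 9, 6, 7, 8, 13, 10, 11, 12]"
text \<open>The order in which the search fixes the signs of the third party. Setting 1 and the ring
  10--13 come directly after the trivial setting, so the orbit key of the third party is known after
  five levels.\<close>

definition order :: "nat list" where "order = [0, 1, 10, 11, 12, 13, 8, 9, 6, 7, 5, 2, 3, 4]"
definition perm :: "nat list \<Rightarrow> 'a list \<Rightarrow> 'a list" where "perm p xs = map (\<lambda>i. xs ! i) p"
definition permute :: "nat list \<Rightarrow> 'a list list \<Rightarrow> 'a list list" where
  "permute p m = map (perm p) (perm p m)"
text \<open>\<open>mC\<close> belongs to the trivial observable and \<open>mP\<close> to the axis;
  both are fixed by \<open>rot\<close>. Each of the seven \<open>mR\<close> matrices yields a ring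
  of four settings. The rotation takes \<open>mX\<close> to the last matrix and that one to the
  negative of \<open>mX\<close>, which closes up with two settings. This makes 2 + 28 + 2 =
  32.\<close>

definition tens :: "vec list list list" where
  "tens = [mC, mP, mR0, permute rot (mR0), permute rot (permute rot (mR0)), permute rot (permute rot (permute rot (mR0))), mR1, permute rot (mR1), permute rot (permute rot (mR1)), permute rot (permute rot (permute rot (mR1))), mR2, permute rot (mR2), permute rot (permute rot (mR2)), permute rot (permute rot (permute rot (mR2))), mR3, permute rot (mR3), permute rot (permute rot (mR3)), permute rot (permute rot (permute rot (mR3))), mR4, permute rot (mR4), permute rot (permute rot (mR4)), permute rot (permute rot (permute rot (mR4))), mR5, permute rot (mR5), permute rot (permute rot (mR5)), permute rot (permute rot (permute rot (mR5))), mR6, permute rot (mR6), permute rot (permute rot (mR6)), permute rot (permute rot (permute rot (mR6))), mX, permute rot mX]"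
definition enc :: "int \<Rightarrow> vec" where "enc x = N (x div 100) (x mod 100)"
definition mkv :: "vec list \<Rightarrow> vec" where
  "mkv x = B (x ! 0) (B (B (V8 (x ! 1) (x ! 2) (x ! 3) (x ! 4) (x ! 5) (x ! 6) (x ! 7) (x ! 8)) (V8 (x ! 9) (x ! 10) (x ! 11) (x ! 12) (x ! 13) (x ! 14) (x ! 15) (x ! 16))) (B (V8 (x ! 17) (x ! 18) (x ! 19) (x ! 20) (x ! 21) (x ! 22) (x ! 23) (x ! 24)) (B (B (x ! 25) (B (x ! 26) (x ! 27))) (B (B (x ! 28) (x ! 29)) (B (x ! 30) (x ! 31))))))"
definition columns :: "vec list list \<Rightarrow> vec list" where
  "columns rs = map (\<lambda>k. mkv (map (\<lambda>r. r ! k) rs)) order"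
definition row :: "nat \<Rightarrow> vec list" where
  "row j = columns (map (\<lambda>m. m ! j) tens)"
fun vl :: "vec \<Rightarrow> int" where "vl (N t a) = 100 * t + a" | "vl (B x y) = 0"
definition vdiff :: "int list \<Rightarrow> int list \<Rightarrow> int list" where "vdiff = map2 (-)"
definition halves :: "int list \<Rightarrow> vec list" where "halves = map (\<lambda>x. enc (x div 2))"
definition ints :: "vec list \<Rightarrow> int list" where "ints = map vl"
text \<open>Half of row 0 minus all other rows: the half functional when every nontrivial sign of
  the second party is negative.\<close>

definition brow :: "vec list list \<Rightarrow> vec list" where
  "brow m = halves (foldl vdiff (ints (hd m)) (map ints (tl m)))"
definition base :: "vec list" where "base = columns (map brow tens)"

lemma perm_lit:
  "perm rot [x0,x1,x2,x3,x4,x5,x6,x7,x8,x9,x10,x11,x12,x13] = [x0,x1,x5,x2,x3,x4,x9,x6,x7,x8,x13,x10,x11,x12]"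
  by (simp add: perm_def rot_def)
lemma mkv_lit:
  "mkv [x0,x1,x2,x3,x4,x5,x6,x7,x8,x9,x10,x11,x12,x13,x14,x15,x16,x17,x18,x19,x20,x21,x22,x23,x24,x25,x26,x27,x28,x29,x30,x31] =
   B x0 (B (B (V8 x1 x2 x3 x4 x5 x6 x7 x8) (V8 x9 x10 x11 x12 x13 x14 x15 x16)) (B (V8 x17 x18 x19 x20 x21 x22 x23 x24) (B (B x25 (B x26 x27)) (B (B x28 x29) (B x30 x31)))))"
  by (simp add: mkv_def)
lemma vdiff_simps: "vdiff [] [] = []" "vdiff (x # xs) (y # ys) = (x - y) # vdiff xs ys"
  by (simp_all add: vdiff_def)
lemma nth_one: "(x # y # xs) ! 1 = y" "(x # xs) ! numeral k = xs ! pred_numeral k"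
  by (simp_all add: numeral_eq_Suc)

lemmas m_defs = mC_def mP_def mR0_def mR1_def mR2_def mR3_def mR4_def mR5_def mR6_def mX_def
lemmas tens_lit = tens_def[unfolded m_defs permute_def perm_lit list.map]
lemmas nth_lit = nth_one nth_Cons_0 pred_num
lemmas digit_fold = D_defs[symmetric] M_defs[symmetric] neg_digit
lemmas row1 = row_def[of 1, unfolded tens_lit, unfolded list.map nth_lit, unfolded columns_def order_def, unfolded list.map nth_lit, unfolded mkv_lit]
lemmas row2 = row_def[of 2, unfolded tens_lit, unfolded list.map nth_lit, unfolded columns_def order_def, unfolded list.map nth_lit, unfolded mkv_lit]
lemmas row3 = row_def[of 3, unfolded tens_lit, unfolded list.map nth_lit, unfolded columns_def order_def, unfolded list.map nth_lit, unfolded mkv_lit]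
lemmas row4 = row_def[of 4, unfolded tens_lit, unfolded list.map nth_lit, unfolded columns_def order_def, unfolded list.map nth_lit, unfolded mkv_lit]
lemmas row5 = row_def[of 5, unfolded tens_lit, unfolded list.map nth_lit, unfolded columns_def order_def, unfolded list.map nth_lit, unfolded mkv_lit]
lemmas row6 = row_def[of 6, unfolded tens_lit, unfolded list.map nth_lit, unfolded columns_def order_def, unfolded list.map nth_lit, unfolded mkv_lit]
lemmas row7 = row_def[of 7, unfolded tens_lit, unfolded list.map nth_lit, unfolded columns_def order_def, unfolded list.map nth_lit, unfolded mkv_lit]
lemmas row8 = row_def[of 8, unfolded tens_lit, unfolded list.map nth_lit, unfolded columns_def order_def, unfolded list.map nth_lit, unfolded mkv_lit]
lemmas row9 = row_def[of 9, unfolded tens_lit, unfolded list.map nth_lit, unfolded columns_def order_def, unfolded list.map nth_lit, unfolded mkv_lit]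
lemmas row10 = row_def[of 10, unfolded tens_lit, unfolded list.map nth_lit, unfolded columns_def order_def, unfolded list.map nth_lit, unfolded mkv_lit]
lemmas row11 = row_def[of 11, unfolded tens_lit, unfolded list.map nth_lit, unfolded columns_def order_def, unfolded list.map nth_lit, unfolded mkv_lit]
lemmas row12 = row_def[of 12, unfolded tens_lit, unfolded list.map nth_lit, unfolded columns_def order_def, unfolded list.map nth_lit, unfolded mkv_lit]
lemmas row13 = row_def[of 13, unfolded tens_lit, unfolded list.map nth_lit, unfolded columns_def order_def, unfolded list.map nth_lit, unfolded mkv_lit]
text \<open>The digit tables are not designed for this subtraction and halving, so
  \<open>base\<close> is computed with ordinary numerals and folded back into digit constants at the
  end.\<close>

lemmas base_lit = base_def[unfolded tens_lit, unfolded list.map brow_def list.sel ints_def, unfolded list.map vl.simps D_defs M_defs, simplified, unfolded foldl_Cons foldl_Nil vdiff_simps, simplified, unfolded halves_def, simplified, unfolded enc_def, simplified, unfolded columns_def order_def, unfolded list.map nth_lit, unfolded mkv_lit, unfolded digit_fold]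

section \<open>The cases for the second party\<close>

text \<open>By the symmetry in the last two parties only those \<open>\<gamma>\<close> are needed whose orbit key is at least
  that of \<open>\<beta>\<close>; \<open>pre\<close>\<open>k\<close> lists the admissible first five signs of \<open>\<gamma>\<close> for key \<open>k\<close>.\<close>

definition pre0 :: prefix where "pre0 = (PBr (PBr (PBr (PBr (PBr PAll PAll) (PBr PAll PAll)) (PBr (PBr PAll PAll) (PBr PAll PAll))) (PBr (PBr (PBr PAll PAll) (PBr PAll PAll)) (PBr (PBr PAll PAll) (PBr PAll PAll)))) (PBr (PBr (PBr (PBr PAll PAll) (PBr PAll PAll)) (PBr (PBr PAll PAll) (PBr PAll PAll))) (PBr (PBr (PBr PAll PAll) (PBr PAll PAll)) (PBr (PBr PAll PAll) (PBr PAll PAll)))))"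
definition pre1 :: prefix where "pre1 = (PBr (PBr (PBr (PBr (PBr PAll PAll) (PBr PAll PAll)) (PBr (PBr PAll PAll) (PBr PAll PAll))) (PBr (PBr (PBr PAll PAll) (PBr PAll PAll)) (PBr (PBr PAll PAll) (PBr PAll PAll)))) (PBr (PBr (PBr (PBr PAll PAll) (PBr PAll PAll)) (PBr (PBr PAll PAll) (PBr PAll PAll))) (PBr (PBr (PBr PAll PAll) (PBr PAll PAll)) (PBr (PBr PAll PAll) (PBr PAll PNone)))))"
definition pre2 :: prefix where "pre2 = (PBr (PBr (PBr (PBr (PBr PAll PAll) (PBr PAll PAll)) (PBr (PBr PAll PAll) (PBr PAll PAll))) (PBr (PBr (PBr PAll PAll) (PBr PAll PAll)) (PBr (PBr PAll PAll) (PBr PAll PAll)))) (PBr (PBr (PBr (PBr PAll PAll) (PBr PAll PAll)) (PBr (PBr PAll PAll) (PBr PAll PNone))) (PBr (PBr (PBr PAll PAll) (PBr PAll PNone)) (PBr (PBr PAll PNone) PNone))))"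
definition pre3 :: prefix where "pre3 = (PBr (PBr (PBr (PBr (PBr PAll PAll) (PBr PAll PAll)) (PBr (PBr PAll PAll) (PBr PAll PAll))) (PBr (PBr (PBr PAll PAll) (PBr PAll PAll)) (PBr (PBr PAll PAll) (PBr PAll PAll)))) (PBr (PBr (PBr (PBr PAll PAll) (PBr PAll PNone)) (PBr (PBr PAll PAll) PNone)) (PBr (PBr (PBr PAll PNone) (PBr PAll PNone)) PNone)))"
definition pre4 :: prefix where "pre4 = (PBr (PBr (PBr (PBr (PBr PAll PAll) (PBr PAll PAll)) (PBr (PBr PAll PAll) (PBr PAll PAll))) (PBr (PBr (PBr PAll PAll) (PBr PAll PAll)) (PBr (PBr PAll PAll) (PBr PAll PAll)))) (PBr (PBr (PBr (PBr PAll PAll) (PBr PAll PNone)) (PBr (PBr PAll PNone) PNone)) (PBr (PBr (PBr PAll PNone) PNone) PNone)))"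
definition pre5 :: prefix where "pre5 = (PBr (PBr (PBr (PBr (PBr PAll PAll) (PBr PAll PAll)) (PBr (PBr PAll PAll) (PBr PAll PAll))) (PBr (PBr (PBr PAll PAll) (PBr PAll PAll)) (PBr (PBr PAll PAll) (PBr PAll PAll)))) (PBr (PBr (PBr (PBr PAll PNone) PNone) PNone) PNone))"
definition pre6 :: prefix where "pre6 = (PBr (PBr (PBr (PBr (PBr PAll PAll) (PBr PAll PAll)) (PBr (PBr PAll PAll) (PBr PAll PAll))) (PBr (PBr (PBr PAll PAll) (PBr PAll PAll)) (PBr (PBr PAll PAll) (PBr PAll PAll)))) PNone)"
definition pre7 :: prefix where "pre7 = (PBr (PBr (PBr (PBr (PBr PAll PAll) (PBr PAll PAll)) (PBr (PBr PAll PAll) (PBr PAll PAll))) (PBr (PBr (PBr PAll PAll) (PBr PAll PAll)) (PBr (PBr PAll PAll) (PBr PAll PNone)))) PNone)"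
definition pre8 :: prefix where "pre8 = (PBr (PBr (PBr (PBr (PBr PAll PAll) (PBr PAll PAll)) (PBr (PBr PAll PAll) (PBr PAll PNone))) (PBr (PBr (PBr PAll PAll) (PBr PAll PNone)) (PBr (PBr PAll PNone) PNone))) PNone)"
definition pre9 :: prefix where "pre9 = (PBr (PBr (PBr (PBr (PBr PAll PAll) (PBr PAll PNone)) (PBr (PBr PAll PAll) PNone)) (PBr (PBr (PBr PAll PNone) (PBr PAll PNone)) PNone)) PNone)"
definition pre10 :: prefix where "pre10 = (PBr (PBr (PBr (PBr (PBr PAll PAll) (PBr PAll PNone)) (PBr (PBr PAll PNone) PNone)) (PBr (PBr (PBr PAll PNone) PNone) PNone)) PNone)"
definition pre11 :: prefix where "pre11 = (PBr (PBr (PBr (PBr (PBr PAll PNone) PNone) PNone) PNone) PNone)"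
lemmas pre_defs = pre0_def pre1_def pre2_def pre3_def pre4_def pre5_def pre6_def pre7_def pre8_def pre9_def pre10_def pre11_def
text \<open>The number in the name codes the signs of settings 10--13 in binary, setting 10 being
  the lowest bit and 1 a positive sign. The levels are the signs of 6--9, of 1 and of 2--5, and the
  numbers at a leaf are its decrements in hundreds.\<close>

definition for15 :: forest where "for15 =
  FP pre11 pre5 (FB (FB (FB (FB (FE (DB (DB (DB (DB (DL D14 D34 D3 D15 D8 D23) (DL D13 D27 D6 D15 D7 D24)) (DB DN (DL D10 D26 D5 D16 D7 D25))) (DB (DB DN (DL D12 D25 D10 D11 D8 D25)) (DB DN (DL D9 D27 D6 D13 D7 D26)))) (DB (DB (DB DN DN) (DB DN DN)) (DB (DB DN DN) (DB DN (DL D7 D27 D2 D13 D9 D25)))))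
    (DB (DB (DB (DB (DL D11 D24 D5 D7 D9 D19) (DL D12 D19 D7 D7 D8 D20)) (DB DN (DL D10 D19 D6 D8 D9 D19))) (DB (DB DN (DL D11 D19 D8 D6 D8 D20)) (DB DN (DL D6 D20 D6 D6 D9 D20)))) (DB (DB (DB DN DN) (DB DN DN)) (DB (DB DN DN) (DB DN (DL D5 D19 D2 D7 D10 D19)))))) (FE (DB (DB (DB (DB (DL D21 D15 D7 D21 D3 D22) (DL D12 D19 D10 D18 D6 D21)) (DB (DL D23 D13 D6 D18 D6 D23) (DL D18 D13 D7 D19 D6 D22))) (DB (DB DN (DL D16 D13 D11 D15 D7 D22)) (DB (DL D23 D15 D7 D21 D3 D22) (DL D19 D11 D8 D19 D3 D23)))) (DB (DB (DB DN (DL D3 D22 D12 D21 D4 D21)) (DB DN (DL D8 D16 D8 D19 D7 D22))) (DB (DB DN DN) (DB DN (DL D12 D11 D7 D19 D5 D23)))))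
    (DB (DB (DB (DB (DL D16 D11 D8 D9 D7 D18) (DL D7 D16 D9 D9 D8 D17)) (DB (DL D14 D14 D5 D11 D6 D19) (DL D15 D9 D7 D10 D7 D18))) (DB (DB DN (DL D11 D9 D9 D9 D7 D18)) (DB (DL D14 D15 D7 D10 D7 D18) (DL D11 D10 D8 D8 D7 D19)))) (DB (DB (DB DN (DL D4 D18 D10 D11 D8 D17)) (DB DN (DL D5 D13 D8 D11 D7 D18))) (DB (DB DN DN) (DB DN (DL D9 D8 D6 D8 D9 D19))))))) (FB FN (FE (DB (DB (DB (DB (DL D6 D18 D13 D10 D8 D19) (DL D5 D17 D16 D9 D9 D19)) (DB (DL D9 D18 D15 D11 D6 D21) (DL D15 D10 D17 D10 D9 D20))) (DB (DB (DL D3 D17 D14 D8 D11 D19) (DL D7 D10 D18 D5 D12 D20)) (DB (DL D5 D22 D13 D11 D7 D20) (DL D10 D14 D16 D9 D8 D21)))) (DB (DB (DB DN DN) (DB (DL D6 D13 D14 D11 D7 D20) (DL D6 D14 D17 D11 D7 D20))) (DB (DB DN DN) (DB (DL D7 D16 D12 D11 D7 D20) (DL D5 D10 D15 D9 D8 D21)))))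
    (DB (DB (DB (DB (DL D8 D12 D10 D5 D9 D14) (DL D6 D14 D12 D5 D10 D14)) (DB (DL D11 D13 D12 D6 D8 D15) (DL D16 D6 D13 D6 D9 D15))) (DB (DB (DL D9 D16 D9 D4 D11 D14) (DL D5 D7 D13 D4 D10 D15)) (DB (DL D3 D19 D10 D5 D9 D15) (DL D10 D12 D12 D4 D9 D16)))) (DB (DB (DB DN DN) (DB (DL D9 D9 D12 D6 D8 D14) (DL D6 D12 D12 D5 D10 D14))) (DB (DB DN DN) (DB (DL D7 D13 D9 D5 D10 D14) (DL D4 D6 D10 D5 D10 D16)))))))) (FB (FB FN (FE (DB (DB (DB (DB (DL D15 D23 D3 D15 D6 D21) (DL D14 D16 D6 D18 D3 D21)) (DB DN (DL D15 D16 D5 D18 D4 D22))) (DB (DB DN (DL D12 D18 D7 D14 D6 D21)) (DB (DL D10 D31 D3 D13 D7 D22) (DL D9 D23 D6 D11 D7 D23)))) (DB (DB (DB DN DN) (DB DN DN)) (DB (DB DN DN) (DB DN (DL D13 D18 D1 D14 D7 D23)))))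
    (DB (DB (DB (DB (DL D15 D14 D3 D12 D4 D15) (DL D16 D9 D6 D11 D5 D15)) (DB DN (DL D17 D10 D4 D13 D5 D16))) (DB (DB DN (DL D11 D9 D7 D7 D7 D16)) (DB (DL D8 D23 D3 D7 D7 D17) (DL D12 D13 D6 D6 D7 D17)))) (DB (DB (DB DN DN) (DB DN DN)) (DB (DB DN DN) (DB DN (DL D10 D6 D6 D8 D8 D17))))))) (FB FN (FE (DB (DB (DB (DB (DL D7 D16 D10 D14 D5 D20) (DL D10 D10 D11 D15 D6 D20)) (DB DN (DL D13 D14 D10 D16 D5 D23))) (DB (DB (DL D9 D19 D9 D10 D8 D20) (DL D3 D15 D11 D10 D8 D21)) (DB (DL D3 D26 D8 D12 D6 D23) (DL D7 D19 D10 D12 D6 D24)))) (DB (DB (DB DN DN) (DB DN DN)) (DB (DB (DL D10 D13 D7 D13 D8 D19) (DL D7 D12 D7 D11 D9 D20)) (DB DN (DL D7 D14 D8 D9 D9 D23)))))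
    (DB (DB (DB (DB (DL D10 D10 D7 D10 D6 D14) (DL D12 D4 D9 D10 D6 D15)) (DB DN (DL D16 D7 D7 D13 D5 D17))) (DB (DB (DL D6 D13 D6 D7 D8 D15) (DL D7 D8 D7 D7 D8 D16)) (DB (DL D5 D20 D6 D8 D6 D17) (DL D11 D12 D7 D10 D5 D18)))) (DB (DB (DB DN DN) (DB DN DN)) (DB (DB (DL D11 D7 D7 D9 D6 D15) (DL D9 D8 D6 D6 D8 D16)) (DB DN (DL D7 D7 D8 D6 D8 D18))))))))) (FB FN (FB FN (FB FN (FE (DB (DB (DB (DB (DL D10 D21 D1 D10 D6 D17) (DL D8 D16 D6 D8 D7 D17)) (DB DN (DL D11 D18 D2 D10 D5 D21))) (DB (DB DN (DL D8 D18 D6 D6 D9 D18)) (DB DN (DL D10 D19 D5 D5 D9 D22)))) (DB (DB (DB DN DN) (DB DN DN)) (DB (DB DN DN) (DB DN (DL D14 D21 D4 D7 D11 D22)))))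
    (DB (DB (DB (DB (DL D5 D12 D3 D4 D4 D11) (DL D8 D6 D7 D5 D4 D12)) (DB DN (DL D10 D8 D3 D6 D4 D15))) (DB (DB DN (DL D3 D8 D6 D6 D5 D14)) (DB DN (DL D8 D11 D3 D7 D6 D16)))) (DB (DB (DB DN DN) (DB DN DN)) (DB (DB DN DN) (DB DN (DL D10 D11 D6 D8 D9 D17))))))))))"
definition for7 :: forest where "for7 =
  FP pre10 pre4 (FB (FB (FB (FB (FE (DB (DB (DB (DB (DL D13 D22 D8 D9 D8 D20) (DL D8 D19 D10 D9 D8 D20)) (DB (DL D10 D21 D5 D12 D7 D21) (DL D9 D17 D8 D11 D7 D21))) (DB (DB (DL D13 D22 D9 D8 D9 D20) (DL D8 D18 D11 D8 D8 D21)) (DB (DL D9 D22 D7 D10 D8 D21) (DL D8 D19 D8 D9 D8 D21)))) (DB (DB (DB DN DN) (DB (DL D5 D18 D5 D11 D9 D20) (DL D5 D18 D4 D12 D8 D20))) (DB (DB DN DN) (DB (DL D7 D20 D6 D9 D9 D20) (DL D3 D17 D6 D9 D8 D21)))))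
    (DB (DB (DB (DB (DL D11 D12 D10 D6 D9 D20) (DL D9 D13 D10 D6 D8 D20)) (DB (DL D9 D12 D8 D8 D8 D19) (DL D10 D11 D9 D8 D7 D19))) (DB (DB (DL D18 D13 D11 D6 D6 D21) (DL D8 D10 D10 D6 D6 D21)) (DB (DL D10 D17 D9 D7 D7 D19) (DL D7 D10 D9 D6 D7 D19)))) (DB (DB (DB DN DN) (DB (DL D5 D11 D9 D5 D9 D18) (DL D8 D9 D10 D5 D10 D17))) (DB (DB DN DN) (DB (DL D12 D11 D9 D5 D8 D18) (DL D4 D7 D8 D5 D8 D18)))))) (FE (DB (DB (DB (DB (DL D11 D15 D9 D12 D6 D20) (DL D4 D19 D14 D11 D8 D18)) (DB (DL D15 D13 D5 D12 D7 D21) (DL D10 D13 D8 D13 D7 D20))) (DB (DB (DL D15 D9 D12 D10 D9 D19) (DL D4 D14 D14 D9 D10 D18)) (DB (DL D15 D14 D8 D12 D6 D20) (DL D11 D12 D10 D12 D6 D20)))) (DB (DB (DB (DL D6 D20 D10 D12 D8 D19) (DL D2 D23 D15 D12 D8 D18)) (DB (DL D6 D13 D6 D12 D9 D20) (DL D5 D18 D10 D12 D9 D19))) (DB (DB (DL D9 D15 D9 D11 D10 D18) (DL D3 D19 D14 D11 D9 D18)) (DB (DL D11 D11 D6 D13 D8 D19) (DL D1 D14 D10 D13 D7 D19)))))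
    (DB (DB (DB (DB (DL D9 D8 D10 D9 D6 D18) (DL D8 D13 D9 D9 D8 D16)) (DB (DL D11 D6 D10 D9 D7 D17) (DL D16 D5 D10 D10 D8 D15))) (DB (DB (DL D14 D10 D6 D10 D6 D18) (DL D4 D9 D8 D11 D6 D17)) (DB (DL D10 D13 D7 D8 D7 D17) (DL D9 D4 D11 D8 D8 D16)))) (DB (DB (DB (DL D9 D11 D10 D8 D6 D18) (DL D3 D19 D10 D9 D8 D15)) (DB (DL D10 D6 D8 D8 D8 D16) (DL D8 D11 D10 D7 D9 D15))) (DB (DB (DL D12 D11 D5 D9 D7 D17) (DL D3 D14 D10 D8 D8 D16)) (DB (DL D12 D7 D5 D7 D9 D16) (DL D4 D8 D8 D7 D10 D15))))))) (FB FN (FE (DB (DB (DB (DB (DL D6 D11 D21 D2 D12 D15) (DL D9 D16 D23 D3 D12 D15)) (DB (DL D12 D11 D19 D2 D11 D17) (DL D16 D10 D24 D1 D13 D16))) (DB (DB (DL D9 D9 D19 D4 D13 D16) (DL D4 D10 D20 D4 D15 D15)) (DB (DL D7 D13 D18 D3 D12 D16) (DL D10 D9 D22 D3 D12 D16)))) (DB (DB (DB DN DN) (DB (DL D4 D11 D19 D4 D11 D16) (DL D11 D15 D25 D2 D12 D15))) (DB (DB DN DN) (DB (DL D8 D9 D18 D3 D12 D15) (DL D5 D12 D24 D2 D11 D16)))))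
    (DB (DB (DB (DB (DL D6 D5 D19 D5 D10 D13) (DL D12 D11 D20 D5 D11 D12)) (DB (DL D10 D4 D19 D5 D10 D12) (DL D16 D6 D21 D5 D12 D10))) (DB (DB (DL D6 D7 D14 D5 D11 D13) (DL D8 D9 D16 D5 D11 D13)) (DB (DL D6 D10 D14 D4 D12 D12) (DL D11 D5 D15 D5 D12 D12)))) (DB (DB (DB DN DN) (DB (DL D6 D4 D18 D5 D11 D11) (DL D11 D11 D20 D4 D13 D9))) (DB (DB DN DN) (DB (DL D6 D6 D15 D3 D12 D11) (DL D7 D7 D13 D5 D14 D11)))))))) (FB (FB FN (FE (DB (DB (DB (DB (DL D7 D16 D9 D9 D7 D18) (DL D13 D11 D11 D9 D7 D17)) (DB (DL D8 D20 D6 D10 D7 D19) (DL D16 D12 D9 D10 D7 D18))) (DB (DB (DL D7 D16 D12 D7 D8 D18) (DL D6 D12 D14 D7 D8 D18)) (DB (DL D3 D25 D8 D7 D8 D19) (DL D8 D18 D10 D7 D8 D19)))) (DB (DB (DB (DL D5 D12 D9 D9 D9 D16) (DL D6 D14 D8 D10 D8 D16)) (DB (DL D3 D17 D5 D9 D9 D18) (DL D11 D11 D6 D11 D8 D17))) (DB (DB (DL D12 D13 D10 D9 D8 D17) (DL D7 D11 D12 D9 D7 D18)) (DB (DL D8 D21 D7 D8 D9 D18) (DL D4 D13 D10 D8 D9 D18)))))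
    (DB (DB (DB (DB (DL D15 D8 D8 D8 D5 D15) (DL D15 D8 D9 D8 D6 D14)) (DB (DL D16 D10 D8 D7 D6 D15) (DL D18 D8 D8 D9 D7 D13))) (DB (DB (DL D8 D11 D8 D7 D6 D15) (DL D8 D9 D8 D7 D6 D16)) (DB (DL D5 D16 D6 D7 D8 D15) (DL D12 D9 D5 D9 D8 D15)))) (DB (DB (DB (DL D10 D8 D7 D6 D7 D14) (DL D8 D12 D6 D7 D6 D14)) (DB (DL D9 D8 D6 D6 D9 D13) (DL D11 D6 D6 D6 D10 D12))) (DB (DB (DL D13 D9 D7 D6 D7 D14) (DL D8 D10 D5 D7 D7 D15)) (DB (DL D5 D15 D5 D6 D9 D14) (DL D6 D7 D4 D7 D10 D14))))))) (FB FN (FE (DB (DB (DB (DB (DL D7 D10 D14 D5 D10 D16) (DL D11 D13 D16 D7 D10 D16)) (DB (DL D12 D15 D13 D7 D8 D19) (DL D15 D10 D15 D8 D9 D19))) (DB (DB (DL D9 D15 D11 D5 D11 D17) (DL D5 D12 D15 D4 D11 D18)) (DB (DL D7 D20 D10 D8 D8 D20) (DL D10 D15 D16 D6 D8 D20)))) (DB (DB (DB (DL D3 D18 D8 D9 D10 D15) (DL D5 D20 D14 D7 D10 D15)) (DB (DL D3 D13 D11 D7 D10 D18) (DL D9 D16 D15 D7 D9 D18))) (DB (DB (DL D9 D12 D10 D7 D11 D16) (DL D3 D15 D14 D6 D11 D16)) (DB (DL D7 D17 D7 D10 D8 D19) (DL D6 D13 D12 D6 D10 D19)))))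
    (DB (DB (DB (DB (DL D11 D4 D10 D5 D7 D14) (DL D16 D7 D11 D7 D7 D14)) (DB (DL D15 D9 D9 D7 D7 D15) (DL D18 D4 D12 D8 D8 D14))) (DB (DB (DL D9 D9 D7 D4 D9 D15) (DL D11 D6 D9 D6 D8 D15)) (DB (DL D9 D15 D8 D5 D7 D16) (DL D14 D8 D11 D6 D8 D15)))) (DB (DB (DB (DL D7 D7 D12 D5 D7 D13) (DL D8 D12 D13 D5 D7 D13)) (DB (DL D4 D6 D11 D4 D8 D14) (DL D11 D12 D10 D7 D8 D13))) (DB (DB (DL D10 D7 D8 D4 D9 D14) (DL D8 D7 D11 D4 D8 D15)) (DB (DL D5 D12 D7 D6 D7 D15) (DL D10 D6 D8 D5 D10 D15))))))))) (FB FN (FB FN (FB FN (FE (DB (DB (DB (DB (DL D6 D11 D15 D4 D8 D15) (DL D5 D11 D16 D4 D8 D14)) (DB (DL D5 D9 D12 D5 D7 D19) (DL D9 D8 D14 D6 D6 D18))) (DB (DB (DL D13 D9 D16 D5 D10 D15) (DL D7 D14 D17 D4 D9 D16)) (DB (DL D9 D13 D15 D5 D7 D19) (DL D12 D10 D16 D3 D9 D19)))) (DB (DB (DB DN DN) (DB (DL D5 D8 D11 D6 D8 D20) (DL D7 D9 D14 D7 D7 D18))) (DB (DB DN DN) (DB (DL D13 D10 D13 D7 D7 D20) (DL D15 D10 D16 D5 D9 D20)))))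
    (DB (DB (DB (DB (DL D5 D7 D4 D5 D7 D10) (DL D9 D9 D8 D5 D7 D10)) (DB (DL D9 D9 D3 D4 D7 D13) (DL D10 D8 D6 D5 D6 D12))) (DB (DB (DL D10 D6 D7 D5 D8 D11) (DL D6 D9 D6 D7 D7 D12)) (DB (DL D3 D13 D7 D4 D6 D13) (DL D8 D10 D4 D7 D8 D13)))) (DB (DB (DB DN DN) (DB (DL D5 D7 D3 D6 D9 D13) (DL D8 D10 D6 D4 D8 D12))) (DB (DB DN DN) (DB (DL D8 D11 D5 D5 D7 D14) (DL D11 D12 D4 D7 D10 D14))))))))))"
definition for11 :: forest where "for11 =
  FP pre10 pre4 (FB (FB (FB (FB FN (FE (DB (DB (DB (DB (DL D15 D13 D6 D13 D4 D22) (DL D15 D8 D8 D12 D6 D21)) (DB (DL D15 D11 D5 D13 D5 D24) (DL D16 D9 D4 D14 D6 D22))) (DB (DB (DL D18 D12 D6 D12 D6 D21) (DL D12 D8 D8 D11 D7 D21)) (DB (DL D15 D13 D7 D14 D4 D22) (DL D11 D10 D6 D14 D5 D21)))) (DB (DB (DB (DL D14 D8 D8 D15 D4 D22) (DL D9 D10 D9 D15 D5 D21)) (DB (DL D15 D7 D6 D13 D6 D24) (DL D15 D5 D6 D14 D7 D22))) (DB (DB (DL D23 D8 D5 D14 D7 D20) (DL D12 D6 D7 D14 D6 D21)) (DB (DL D14 D10 D6 D14 D5 D22) (DL D10 D7 D5 D15 D4 D22)))))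
    (DB (DB (DB (DB (DL D16 D14 D7 D10 D9 D17) (DL D12 D10 D6 D9 D10 D17)) (DB (DL D15 D15 D6 D9 D11 D17) (DL D13 D10 D5 D10 D11 D16))) (DB (DB (DL D14 D16 D6 D8 D10 D17) (DL D9 D10 D6 D7 D11 D17)) (DB (DL D12 D18 D7 D9 D9 D16) (DL D9 D11 D6 D8 D10 D16)))) (DB (DB (DB (DL D14 D11 D8 D8 D9 D17) (DL D11 D8 D7 D9 D8 D17)) (DB (DL D12 D13 D7 D8 D9 D18) (DL D11 D9 D6 D8 D10 D17))) (DB (DB (DL D14 D11 D7 D8 D9 D17) (DL D9 D7 D7 D7 D9 D17)) (DB (DL D11 D14 D7 D9 D8 D16) (DL D9 D8 D7 D8 D7 D17))))))) (FB FN (FE (DB (DB (DB (DB (DL D5 D17 D10 D8 D8 D19) (DL D12 D8 D14 D6 D11 D18)) (DB (DL D12 D17 D12 D9 D7 D22) (DL D15 D11 D13 D9 D9 D21))) (DB (DB (DL D9 D15 D11 D6 D11 D19) (DL D7 D9 D15 D4 D12 D19)) (DB (DL D6 D24 D8 D9 D8 D21) (DL D11 D16 D12 D6 D10 D21)))) (DB (DB (DB (DL D11 D10 D11 D10 D8 D19) (DL D13 D7 D14 D8 D10 D18)) (DB (DL D8 D13 D11 D8 D8 D22) (DL D15 D6 D13 D8 D10 D20))) (DB (DB (DL D15 D14 D9 D7 D11 D18) (DL D10 D10 D13 D6 D11 D19)) (DB (DL D11 D17 D8 D10 D8 D20) (DL D7 D11 D13 D7 D9 D20)))))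
    (DB (DB (DB (DB (DL D8 D16 D7 D5 D11 D14) (DL D5 D11 D9 D4 D12 D14)) (DB (DL D10 D18 D8 D6 D11 D14) (DL D16 D9 D9 D6 D12 D14))) (DB (DB (DL D11 D18 D6 D4 D12 D14) (DL D3 D12 D8 D4 D12 D15)) (DB (DL D6 D21 D6 D5 D12 D14) (DL D11 D14 D6 D6 D11 D15)))) (DB (DB (DB (DL D14 D11 D10 D4 D10 D14) (DL D8 D10 D10 D4 D11 D14)) (DB (DL D11 D12 D9 D4 D12 D14) (DL D14 D5 D12 D4 D11 D14))) (DB (DB (DL D17 D13 D6 D5 D11 D14) (DL D8 D11 D8 D4 D10 D16)) (DB (DL D9 D15 D6 D5 D11 D14) (DL D6 D10 D7 D5 D10 D15)))))))) FN) FN)"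
definition for3 :: forest where "for3 =
  FP pre8 pre2 (FB (FB (FB (FB (FE (DB (DB (DB (DB (DL D12 D13 D9 D6 D8 D20) (DL D10 D7 D12 D7 D6 D20)) (DB DN (DL D14 D6 D10 D11 D5 D20))) (DB (DB (DL D18 D14 D9 D5 D8 D20) (DL D10 D6 D11 D6 D6 D21)) (DB (DL D12 D16 D8 D7 D7 D20) (DL D11 D9 D11 D6 D5 D21)))) (DB (DB (DB DN DN) (DB DN DN)) (DB (DB (DL D19 D11 D8 D5 D9 D20) (DL D13 D8 D8 D5 D8 D20)) (DB DN (DL D11 D8 D6 D7 D7 D20)))))
    (DB (DB (DB (DB (DL D12 D13 D5 D10 D7 D20) (DL D11 D6 D7 D10 D6 D20)) (DB DN (DL D13 D3 D7 D13 D7 D17))) (DB (DB (DL D17 D14 D4 D10 D7 D20) (DL D8 D5 D5 D8 D8 D20)) (DB (DL D11 D15 D4 D12 D7 D17) (DL D10 D5 D6 D11 D6 D18)))) (DB (DB (DB DN DN) (DB DN DN)) (DB (DB (DL D22 D5 D5 D9 D7 D19) (DL D10 D7 D4 D8 D6 D20)) (DB DN (DL D9 D5 D4 D11 D6 D17)))))) (FE (DB (DB (DB (DB (DL D9 D13 D8 D9 D7 D19) (DL D13 D6 D11 D8 D8 D18)) (DB (DL D11 D10 D7 D10 D6 D21) (DL D14 D7 D8 D11 D7 D19))) (DB (DB (DL D16 D9 D13 D7 D8 D18) (DL D6 D8 D14 D6 D9 D18)) (DB (DL D10 D14 D8 D9 D6 D19) (DL D10 D10 D13 D7 D7 D18))))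 (DB (DB (DB (DL D12 D9 D7 D9 D7 D19) (DL D11 D11 D11 D8 D7 D19)) (DB (DL D9 D8 D6 D10 D6 D21) (DL D16 D4 D9 D10 D7 D19))) (DB (DB (DL D20 D7 D10 D8 D8 D18) (DL D11 D8 D11 D8 D8 D18)) (DB (DL D15 D9 D8 D8 D7 D19) (DL D9 D7 D12 D9 D5 D19)))))
    (DB (DB (DB (DB (DL D7 D11 D6 D10 D9 D16) (DL D11 D5 D7 D10 D10 D15)) (DB (DL D9 D8 D5 D12 D10 D15) (DL D12 D4 D6 D13 D10 D14))) (DB (DB (DL D15 D10 D4 D9 D11 D15) (DL D7 D6 D6 D7 D13 D14)) (DB (DL D10 D12 D5 D11 D9 D14) (DL D8 D7 D6 D11 D9 D14)))) (DB (DB (DB (DL D9 D9 D6 D10 D8 D16) (DL D11 D6 D7 D10 D8 D15)) (DB (DL D6 D6 D6 D10 D10 D15) (DL D11 D3 D7 D10 D10 D14))) (DB (DB (DL D16 D7 D6 D9 D10 D15) (DL D5 D8 D6 D8 D9 D15)) (DB (DL D10 D8 D4 D11 D9 D14) (DL D5 D7 D6 D10 D8 D14))))))) (FB FN (FE (DB (DB (DB (DB (DL D8 D6 D17 D4 D11 D16) (DL D20 D3 D21 D3 D13 D15)) (DB (DL D12 D13 D15 D6 D10 D19) (DL D19 D5 D19 D5 D13 D17))) (DB (DB (DL D6 D10 D16 D4 D15 D15) (DL D6 D7 D16 D6 D14 D16)) (DB (DL D8 D16 D15 D4 D12 D17) (DL D12 D10 D19 D3 D13 D17)))) (DB (DB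 (DB (DL D8 D5 D17 D4 D11 D16) (DL D14 D8 D23 D3 D12 D15)) (DB (DL D8 D7 D14 D4 D12 D18) (DL D17 D6 D19 D5 D13 D16))) (DB (DB (DL D13 D8 D15 D3 D14 D15) (DL D8 D4 D19 D3 D14 D16)) (DB (DL D7 D11 D14 D4 D12 D17) (DL D7 D6 D20 D3 D12 D17)))))
    (DB (DB (DB (DB (DL D11 D6 D11 D6 D14 D12) (DL D18 D7 D14 D6 D15 D11)) (DB (DL D13 D10 D12 D8 D15 D11) (DL D21 D4 D15 D7 D17 D10))) (DB (DB (DL D10 D10 D9 D3 D17 D11) (DL D13 D4 D13 D3 D16 D12)) (DB (DL D8 D13 D11 D6 D16 D10) (DL D14 D6 D14 D6 D15 D11)))) (DB (DB (DB (DL D10 D6 D12 D5 D13 D11) (DL D14 D11 D15 D5 D14 D10)) (DB (DL D11 D5 D13 D5 D16 D10) (DL D18 D8 D15 D6 D15 D10))) (DB (DB (DL D12 D9 D9 D3 D15 D11) (DL D11 D7 D11 D3 D14 D12)) (DB (DL D6 D10 D11 D4 D15 D10) (DL D15 D3 D14 D4 D14 D11)))))))) (FB (FB FN (FE (DB (DB (DB (DB (DL D13 D14 D11 D5 D7 D18) (DL D11 D10 D13 D6 D7 D17)) (DB DN (DL D15 D14 D10 D10 D5 D19))) (DB (DB (DL D8 D16 D11 D6 D8 D17) (DL D8 D12 D13 D5 D7 D18)) (DB (DL D11 D22 D9 D6 D6 D19) (DL D13 D15 D11 D7 D5 D19)))) (DB (DB (DB DN DN) (DB DN DN)) (DB (DB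 (DL D13 D12 D9 D9 D7 D17) (DL D12 D11 D11 D8 D6 D18)) (DB DN (DL D9 D11 D10 D7 D7 D19)))))
    (DB (DB (DB (DB (DL D12 D9 D7 D9 D9 D14) (DL D14 D7 D9 D9 D10 D13)) (DB DN (DL D19 D8 D9 D11 D10 D12))) (DB (DB (DL D8 D9 D7 D6 D11 D14) (DL D10 D10 D8 D6 D10 D15)) (DB (DL D13 D12 D8 D8 D9 D13) (DL D15 D11 D9 D8 D9 D13)))) (DB (DB (DB DN DN) (DB DN DN)) (DB (DB (DL D7 D7 D8 D8 D10 D13) (DL D5 D10 D7 D7 D8 D15)) (DB DN (DL D9 D10 D8 D8 D8 D13))))))) (FB FN (FE (DB (DB (DB (DB (DL D10 D10 D13 D9 D8 D18) (DL D12 D7 D16 D7 D10 D18)) (DB DN (DL D18 D10 D14 D12 D8 D21))) (DB (DB (DL D6 D15 D12 D5 D10 D18) (DL D8 D12 D16 D4 D11 D18)) (DB (DL D11 D19 D11 D10 D7 D21) (DL D15 D14 D15 D9 D8 D21)))) (DB (DB (DB DN DN) (DB DN DN)) (DB (DB (DL D12 D11 D8 D7 D11 D17) (DL D10 D11 D13 D6 D11 D17)) (DB DN (DL D10 D11 D12 D10 D8 D20)))))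
    (DB (DB (DB (DB (DL D15 D5 D9 D10 D12 D13) (DL D17 D2 D11 D11 D12 D13)) (DB DN (DL D21 D6 D11 D13 D12 D14))) (DB (DB (DL D9 D10 D8 D6 D13 D14) (DL D13 D7 D10 D7 D12 D15)) (DB (DL D14 D14 D8 D11 D10 D15) (DL D18 D10 D11 D10 D11 D15)))) (DB (DB (DB DN DN) (DB DN DN)) (DB (DB (DL D8 D8 D7 D5 D12 D13) (DL D8 D5 D9 D5 D13 D13)) (DB DN (DL D13 D7 D10 D10 D9 D14))))))))) (FB FN (FB FN (FB FN (FE (DB (DB (DB (DB (DL D5 D8 D8 D8 D7 D17) (DL D7 D10 D10 D8 D7 D16)) (DB DN (DL D11 D7 D10 D9 D4 D20))) (DB (DB (DL D11 D9 D10 D7 D9 D17) (DL D11 D12 D11 D8 D8 D17)) (DB (DL D8 D14 D8 D9 D6 D20) (DL D12 D11 D10 D9 D6 D20)))) (DB (DB (DB DN DN) (DB DN DN)) (DB (DB (DL D15 D11 D9 D7 D10 D17) (DL D14 D13 D11 D7 D9 D18)) (DB DN (DL D15 D12 D10 D7 D9 D21)))))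
    (DB (DB (DB (DB (DL D10 D3 D7 D5 D9 D11) (DL D13 D3 D10 D6 D8 D10)) (DB DN (DL D15 D3 D8 D8 D7 D13))) (DB (DB (DL D8 D3 D7 D3 D11 D11) (DL D8 D4 D9 D4 D9 D12)) (DB (DL D8 D7 D7 D5 D7 D14) (DL D11 D5 D9 D6 D6 D14)))) (DB (DB (DB DN DN) (DB DN DN)) (DB (DB (DL D11 D3 D8 D3 D10 D12) (DL D9 D8 D9 D4 D8 D12)) (DB DN (DL D15 D9 D7 D6 D7 D14))))))))))"
definition for13 :: forest where "for13 =
  FP pre10 pre4 (FB (FB (FB FN (FB FN (FE (DB (DB (DB (DB (DL D10 D8 D13 D7 D11 D17) (DL D8 D3 D17 D7 D12 D17)) (DB (DL D3 D12 D15 D6 D8 D18) (DL D7 D7 D16 D8 D10 D17))) (DB (DB (DL D12 D11 D12 D5 D13 D16) (DL D6 D7 D14 D6 D13 D17)) (DB (DL D4 D16 D13 D6 D10 D17) (DL D3 D10 D13 D8 D12 D17)))) (DB (DB (DB DN DN) (DB (DL D7 D4 D17 D7 D7 D17) (DL D8 D4 D17 D7 D10 D17))) (DB (DB DN DN) (DB (DL D7 D9 D15 D6 D10 D16) (DL D6 D7 D12 D9 D12 D17)))))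
    (DB (DB (DB (DB (DL D13 D14 D12 D4 D9 D15) (DL D6 D6 D13 D7 D9 D15)) (DB (DL D7 D14 D12 D6 D8 D14) (DL D8 D7 D12 D8 D9 D14))) (DB (DB (DL D14 D15 D9 D5 D12 D14) (DL D5 D9 D10 D6 D10 D16)) (DB (DL D7 D19 D9 D6 D9 D14) (DL D4 D11 D8 D10 D8 D15)))) (DB (DB (DB DN DN) (DB (DL D8 D8 D9 D8 D8 D14) (DL D4 D4 D11 D8 D8 D14))) (DB (DB DN DN) (DB (DL D10 D11 D10 D6 D8 D13) (DL D6 D6 D6 D8 D10 D15)))))))) (FB FN (FB FN (FE (DB (DB (DB (DB (DL D8 D11 D10 D7 D11 D16) (DL D8 D7 D11 D9 D10 D17)) (DB (DL D4 D14 D10 D10 D8 D18) (DL D7 D9 D12 D10 D8 D19))) (DB (DB (DL D11 D13 D11 D5 D11 D17) (DL D8 D10 D11 D7 D11 D18)) (DB (DL D5 D22 D8 D8 D9 D19) (DL D2 D16 D10 D7 D11 D19)))) (DB (DB (DB (DL D8 D9 D9 D9 D10 D15) (DL D6 D10 D10 D9 D9 D17)) (DB (DL D8 D9 D9 D10 D7 D18) (DL D9 D8 D10 D8 D9 D19))) (DB (DB (DL D11 D9 D10 D7 D11 D16) (DL D10 D8 D7 D9 D12 D17)) (DB (DL D10 D13 D9 D6 D11 D18) (DL D8 D9 D5 D10 D12 D19)))))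
    (DB (DB (DB (DB (DL D9 D6 D8 D5 D7 D15) (DL D7 D5 D9 D6 D6 D16)) (DB (DL D3 D12 D7 D7 D5 D16) (DL D9 D6 D8 D8 D4 D17))) (DB (DB (DL D15 D7 D8 D3 D9 D15) (DL D8 D5 D6 D5 D8 D17)) (DB (DL D6 D15 D6 D6 D5 D16) (DL D3 D9 D7 D6 D6 D17)))) (DB (DB (DB (DL D14 D7 D7 D5 D6 D15) (DL D8 D9 D8 D6 D5 D16)) (DB (DL D10 D9 D6 D7 D5 D15) (DL D9 D5 D8 D6 D4 D17))) (DB (DB (DL D16 D4 D7 D4 D8 D15) (DL D9 D6 D6 D7 D6 D17)) (DB (DL D12 D7 D6 D5 D5 D16) (DL D8 D5 D3 D7 D8 D17))))))))) FN)"
definition for5 :: forest where "for5 =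
  FP pre9 pre3 (FB (FB (FB (FB (FE (DB (DB (DB (DB (DL D14 D15 D5 D7 D8 D19) (DL D6 D14 D7 D6 D8 D19)) (DB (DL D10 D14 D5 D8 D8 D19) (DL D9 D12 D7 D7 D8 D18))) (DB (DB DN (DL D14 D13 D8 D5 D9 D19)) (DB DN (DL D8 D17 D6 D6 D10 D18)))) (DB (DB (DB DN DN) (DB (DL D5 D10 D8 D6 D11 D17) (DL D6 D12 D5 D8 D9 D17))) (DB (DB DN DN) (DB DN (DL D10 D11 D5 D6 D10 D17)))))
    (DB (DB (DB (DB (DL D12 D11 D5 D6 D7 D21) (DL D8 D12 D4 D6 D6 D21)) (DB (DL D8 D11 D5 D7 D7 D20) (DL D8 D9 D4 D7 D7 D19))) (DB (DB DN (DL D11 D11 D5 D5 D7 D21)) (DB DN (DL D6 D15 D4 D7 D6 D19)))) (DB (DB (DB DN DN) (DB (DL D2 D9 D4 D7 D9 D19) (DL D4 D8 D7 D4 D8 D18))) (DB (DB DN DN) (DB DN (DL D8 D7 D5 D5 D7 D18)))))) (FE (DB (DB (DB (DB (DL D10 D10 D6 D8 D8 D19) (DL D5 D10 D10 D7 D10 D17)) (DB (DL D8 D12 D5 D8 D9 D19) (DL D12 D8 D6 D8 D9 D18))) (DB (DB (DL D16 D14 D7 D7 D12 D17) (DL D13 D10 D9 D6 D12 D17)) (DB (DL D10 D17 D5 D9 D9 D18) (DL D6 D14 D7 D9 D9 D17)))) (DB (DB (DB (DL D8 D8 D6 D8 D11 D18) (DL D2 D13 D11 D8 D11 D16)) (DB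 (DL D8 D6 D7 D6 D11 D19) (DL D4 D6 D9 D7 D11 D17))) (DB (DB (DL D19 D8 D4 D10 D11 D17) (DL D10 D8 D8 D9 D12 D16)) (DB (DL D12 D10 D5 D9 D11 D17) (DL D7 D10 D6 D10 D9 D17)))))
    (DB (DB (DB (DB (DL D8 D11 D5 D6 D6 D21) (DL D6 D8 D5 D7 D7 D19)) (DB (DL D6 D12 D7 D6 D6 D20) (DL D8 D7 D7 D7 D7 D18))) (DB (DB (DL D13 D18 D4 D5 D8 D20) (DL D7 D12 D6 D5 D8 D19)) (DB (DL D7 D18 D8 D5 D6 D19) (DL D3 D15 D6 D6 D6 D18)))) (DB (DB (DB (DL D10 D5 D7 D4 D8 D20) (DL D5 D10 D7 D5 D7 D19)) (DB (DL D8 D5 D7 D5 D8 D19) (DL D5 D7 D7 D5 D7 D18))) (DB (DB (DL D17 D8 D7 D4 D8 D19) (DL D8 D8 D7 D5 D8 D18)) (DB (DL D10 D9 D8 D4 D8 D18) (DL D5 D8 D7 D6 D6 D17))))))) (FB FN (FE (DB (DB (DB (DB (DL D7 D7 D15 D4 D12 D14) (DL D5 D6 D18 D5 D13 D13)) (DB (DL D4 D10 D14 D4 D11 D14) (DL D11 D4 D19 D4 D12 D13))) (DB (DB (DL D14 D12 D14 D5 D15 D13) (DL D10 D6 D15 D5 D16 D13)) (DB (DL D9 D16 D13 D4 D14 D12) (DL D6 D9 D15 D5 D13 D13)))) (DB (DB (DB DN DN) (DB (DL D4 D4 D12 D6 D12 D13) (DL D5 D7 D19 D4 D12 D12))) (DB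 (DB DN DN) (DB (DL D12 D10 D12 D5 D12 D12) (DL D6 D7 D13 D5 D14 D12)))))
    (DB (DB (DB (DB (DL D9 D4 D12 D5 D8 D15) (DL D7 D7 D15 D7 D7 D15)) (DB (DL D6 D6 D14 D6 D7 D14) (DL D10 D4 D14 D8 D8 D13))) (DB (DB (DL D14 D13 D8 D4 D10 D15) (DL D7 D5 D11 D5 D10 D15)) (DB (DL D8 D14 D10 D5 D9 D13) (DL D4 D6 D11 D7 D9 D13)))) (DB (DB (DB DN DN) (DB (DL D4 D6 D11 D7 D8 D13) (DL D5 D8 D14 D7 D9 D12))) (DB (DB DN DN) (DB (DL D10 D9 D11 D4 D9 D12) (DL D6 D3 D10 D6 D11 D12)))))))) (FB (FB FN (FE (DB (DB (DB (DB (DL D5 D13 D5 D6 D9 D16) (DL D7 D11 D8 D6 D10 D14)) (DB (DL D4 D16 D5 D6 D9 D16) (DL D9 D11 D7 D7 D10 D14))) (DB (DB DN (DL D7 D12 D10 D4 D11 D15)) (DB (DL D7 D20 D6 D5 D10 D15) (DL D5 D14 D8 D4 D11 D15)))) (DB (DB (DB DN DN) (DB (DL D7 D11 D3 D5 D12 D15) (DL D8 D10 D4 D6 D11 D14))) (DB (DB DN DN) (DB DN (DL D10 D13 D5 D5 D12 D14)))))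
    (DB (DB (DB (DB (DL D9 D6 D4 D4 D8 D17) (DL D11 D7 D3 D6 D9 D15)) (DB (DL D8 D11 D4 D3 D9 D16) (DL D13 D8 D3 D5 D9 D14))) (DB (DB DN (DL D7 D8 D4 D6 D9 D16)) (DB (DL D4 D17 D3 D4 D7 D16) (DL D8 D10 D5 D5 D7 D15)))) (DB (DB (DB DN DN) (DB (DL D7 D6 D5 D5 D10 D15) (DL D9 D4 D5 D3 D10 D14))) (DB (DB DN DN) (DB DN (DL D7 D6 D5 D5 D6 D15))))))) (FB FN (FE (DB (DB (DB (DB (DL D6 D7 D12 D3 D12 D14) (DL D4 D7 D14 D4 D12 D14)) (DB (DL D5 D10 D12 D6 D9 D16) (DL D8 D9 D13 D8 D10 D15))) (DB (DB (DL D15 D11 D10 D4 D12 D15) (DL D11 D10 D13 D4 D12 D15)) (DB (DL D7 D18 D7 D8 D10 D16) (DL D4 D13 D12 D5 D12 D16)))) (DB (DB (DB (DL D8 D9 D8 D7 D10 D13) (DL D4 D13 D12 D5 D11 D13)) (DB (DL D6 D5 D10 D7 D8 D15) (DL D5 D9 D12 D6 D10 D15))) (DB (DB (DL D17 D6 D8 D7 D12 D13) (DL D12 D9 D11 D4 D14 D13)) (DB (DL D12 D12 D5 D7 D12 D15) (DL D11 D7 D8 D5 D14 D15)))))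
    (DB (DB (DB (DB (DL D9 D5 D9 D4 D6 D15) (DL D8 D3 D12 D5 D6 D15)) (DB (DL D9 D8 D8 D5 D6 D15) (DL D11 D5 D9 D8 D6 D14))) (DB (DB (DL D11 D8 D6 D5 D8 D15) (DL D8 D6 D6 D6 D6 D17)) (DB (DL D5 D13 D7 D5 D5 D16) (DL D8 D9 D7 D7 D4 D16)))) (DB (DB (DB (DL D8 D5 D7 D7 D6 D14) (DL D7 D5 D11 D6 D4 D15)) (DB (DL D7 D5 D9 D8 D6 D14) (DL D9 D3 D11 D6 D5 D14))) (DB (DB (DL D14 D4 D6 D4 D7 D15) (DL D8 D4 D8 D5 D5 D16)) (DB (DL D8 D10 D7 D5 D6 D14) (DL D7 D3 D7 D6 D6 D15))))))))) (FB FN (FB FN (FB FN (FE (DB (DB (DB (DB (DL D8 D10 D6 D4 D11 D12) (DL D6 D7 D13 D3 D12 D12)) (DB (DL D9 D13 D4 D4 D10 D15) (DL D11 D9 D8 D5 D9 D15))) (DB (DB DN (DL D12 D11 D9 D4 D14 D13)) (DB DN (DL D10 D12 D9 D3 D12 D15)))) (DB (DB (DB DN DN) (DB (DL D12 D9 D5 D7 D10 D15) (DL D6 D14 D5 D6 D11 D14))) (DB (DB DN DN) (DB DN (DL D10 D15 D5 D6 D14 D14)))))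
    (DB (DB (DB (DB (DL D7 D6 D3 D9 D5 D13) (DL D7 D6 D7 D8 D4 D13)) (DB (DL D6 D12 D2 D7 D7 D14) (DL D7 D11 D4 D6 D6 D13))) (DB (DB DN (DL D8 D6 D4 D9 D7 D14)) (DB DN (DL D8 D10 D3 D7 D7 D13)))) (DB (DB (DB DN DN) (DB (DL D9 D8 D5 D8 D9 D13) (DL D10 D11 D4 D6 D7 D13))) (DB (DB DN DN) (DB DN (DL D10 D10 D4 D5 D7 D14))))))))))"
definition for9 :: forest where "for9 =
  FP pre8 pre2 (FB (FB (FB (FB FN (FE (DB (DB (DB (DB (DL D9 D17 D8 D10 D6 D20) (DL D6 D9 D10 D11 D6 D19)) (DB (DL D5 D15 D9 D11 D5 D21) (DL D7 D12 D8 D11 D5 D20))) (DB (DB DN (DL D8 D11 D10 D11 D6 D19)) (DB (DL D6 D17 D10 D10 D7 D20) (DL D2 D14 D9 D11 D6 D19)))) (DB (DB (DB DN (DL D8 D6 D10 D12 D6 D19)) (DB DN (DL D8 D8 D8 D13 D4 D20))) (DB (DB DN DN) (DB DN (DL D3 D10 D7 D10 D6 D20)))))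
    (DB (DB (DB (DB (DL D9 D21 D9 D9 D4 D19) (DL D5 D14 D10 D9 D6 D17)) (DB (DL D8 D19 D11 D10 D4 D18) (DL D8 D16 D8 D10 D6 D16))) (DB (DB DN (DL D5 D15 D9 D10 D6 D17)) (DB (DL D6 D21 D11 D10 D7 D16) (DL D3 D15 D10 D10 D6 D16)))) (DB (DB (DB DN (DL D7 D7 D12 D8 D7 D17)) (DB DN (DL D9 D9 D13 D7 D5 D17))) (DB (DB DN DN) (DB DN (DL D2 D11 D10 D6 D8 D16))))))) (FB FN (FE (DB (DB (DB (DB (DL D10 D15 D9 D6 D10 D18) (DL D4 D8 D12 D6 D11 D17)) (DB (DL D3 D15 D10 D7 D7 D20) (DL D9 D8 D13 D4 D9 D19))) (DB (DB (DL D10 D14 D10 D5 D12 D17) (DL D6 D11 D12 D4 D12 D17)) (DB (DL D4 D17 D10 D6 D10 D19) (DL D4 D12 D9 D6 D9 D19)))) (DB (DB (DB (DL D10 D9 D11 D7 D9 D18) (DL D6 D10 D12 D6 D11 D17)) (DB (DL D4 D12 D10 D7 D7 D20) (DL D8 D7 D13 D5 D9 D19))) (DB (DB (DL D15 D11 D9 D6 D10 D17) (DL D9 D10 D9 D6 D11 D18)) (DB (DL D6 D15 D8 D7 D8 D19) (DL D5 D8 D8 D7 D10 D19)))))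
    (DB (DB (DB (DB (DL D8 D20 D13 D4 D9 D14) (DL D3 D12 D14 D3 D11 D14)) (DB (DL D3 D19 D12 D5 D9 D14) (DL D8 D13 D13 D3 D11 D13))) (DB (DB (DL D11 D19 D10 D7 D9 D14) (DL D4 D13 D11 D5 D10 D15)) (DB (DL D5 D19 D12 D7 D10 D13) (DL D4 D14 D10 D5 D10 D14)))) (DB (DB (DB (DL D13 D12 D14 D4 D9 D14) (DL D5 D8 D15 D3 D11 D14)) (DB (DL D5 D13 D15 D4 D8 D14) (DL D4 D8 D14 D2 D12 D13))) (DB (DB (DL D16 D14 D12 D4 D9 D14) (DL D9 D10 D12 D3 D11 D15)) (DB (DL D7 D15 D12 D4 D10 D13) (DL D2 D10 D8 D4 D12 D14)))))))) FN) FN)"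
definition for1 :: forest where "for1 =
  FP pre7 pre1 (FB (FB (FB (FB (FE (DB (DB (DB (DB (DL D9 D15 D7 D7 D8 D19) (DL D8 D12 D5 D8 D7 D18)) (DB (DL D7 D13 D7 D7 D7 D18) (DL D11 D10 D6 D8 D7 D17))) (DB (DB DN (DL D12 D10 D5 D7 D8 D18)) (DB DN (DL D6 D10 D6 D7 D7 D18)))) (DB (DB (DB (DL D15 D8 D7 D8 D7 D18) (DL D4 D13 D5 D8 D7 D17)) (DB (DL D6 D7 D9 D9 D6 D18) (DL D6 D8 D7 D9 D6 D17))) (DB (DB DN (DL D11 D11 D5 D6 D8 D17)) (DB DN (DL D7 D8 D6 D7 D8 D17)))))
    (DB (DB (DB (DB (DL D7 D18 D5 D8 D5 D22) (DL D7 D10 D3 D9 D4 D21)) (DB (DL D3 D13 D4 D10 D6 D19) (DL D11 D6 D1 D12 D5 D18))) (DB (DB DN (DL D7 D10 D3 D9 D3 D21)) (DB DN (DL D5 D12 D2 D10 D2 D19)))) (DB (DB (DB (DL D14 D10 D5 D8 D4 D21) (DL D5 D14 D3 D6 D5 D20)) (DB (DL D5 D7 D6 D7 D7 D18) (DL D6 D7 D4 D8 D6 D17))) (DB (DB DN (DL D8 D13 D2 D6 D3 D21)) (DB DN (DL D5 D9 D3 D6 D5 D17)))))) (FE (DB (DB (DB (DB (DL D3 D16 D10 D8 D6 D18) (DL D6 D11 D9 D8 D5 D17)) (DB (DL D7 D15 D3 D8 D6 D19) (DL D14 D9 D5 D9 D5 D18))) (DB (DB (DL D14 D16 D5 D9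 D8 D16) (DL D10 D12 D8 D8 D9 D15)) (DB (DL D7 D18 D6 D9 D5 D18) (DL D6 D14 D6 D9 D6 D16)))) (DB (DB (DB (DL D7 D11 D7 D7 D6 D18) (DL D5 D6 D10 D9 D5 D17)) (DB (DL D5 D10 D6 D5 D7 D19) (DL D14 D6 D7 D7 D6 D18))) (DB (DB (DL D17 D12 D5 D9 D6 D17) (DL D13 D10 D8 D9 D8 D15)) (DB (DL D9 D14 D6 D6 D6 D18) (DL D7 D11 D7 D8 D5 D17)))))
    (DB (DB (DB (DB (DL D2 D19 D4 D10 D4 D20) (DL D7 D10 D2 D11 D5 D18)) (DB (DL D6 D13 D4 D9 D7 D18) (DL D11 D8 D1 D12 D6 D17))) (DB (DB (DL D12 D18 D3 D9 D6 D18) (DL D6 D12 D3 D10 D6 D17)) (DB (DL D8 D20 D4 D11 D5 D16) (DL D3 D16 D2 D12 D5 D15)))) (DB (DB (DB (DL D10 D9 D6 D7 D6 D19) (DL D5 D10 D5 D8 D5 D18)) (DB (DL D8 D6 D7 D6 D7 D18) (DL D8 D5 D5 D8 D6 D17))) (DB (DB (DL D18 D10 D6 D8 D5 D18) (DL D9 D9 D5 D8 D5 D17)) (DB (DL D11 D11 D7 D7 D6 D16) (DL D5 D8 D4 D8 D6 D15))))))) (FB FN (FE (DB (DB (DB (DB (DL D5 D10 D10 D5 D10 D15) (DL D8 D5 D14 D4 D11 D14)) (DB (DL D8 D10 D11 D5 D7 D17) (DL D12 D6 D18 D3 D9 D15))) (DB (DB (DL D10 D12 D11 D6 D11 D14)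 (DL D6 D9 D13 D5 D12 D14)) (DB (DL D6 D15 D7 D7 D9 D16) (DL D7 D10 D15 D4 D9 D16)))) (DB (DB (DB (DL D7 D5 D11 D5 D9 D15) (DL D3 D10 D13 D4 D11 D14)) (DB (DL D7 D6 D11 D5 D8 D16) (DL D12 D5 D14 D4 D9 D15))) (DB (DB (DL D15 D10 D9 D5 D10 D14) (DL D11 D8 D12 D5 D10 D14)) (DB (DL D9 D10 D8 D6 D9 D15) (DL D7 D6 D13 D5 D9 D15)))))
    (DB (DB (DB (DB (DL D5 D13 D9 D7 D7 D14) (DL D9 D8 D10 D6 D10 D13)) (DB (DL D9 D15 D8 D6 D9 D13) (DL D16 D8 D12 D6 D10 D12))) (DB (DB (DL D12 D15 D7 D6 D10 D13) (DL D6 D8 D8 D6 D9 D14)) (DB (DL D5 D19 D6 D7 D9 D12) (DL D10 D12 D11 D6 D9 D12)))) (DB (DB (DB (DL D8 D7 D11 D5 D8 D14) (DL D5 D15 D11 D4 D11 D13)) (DB (DL D5 D8 D10 D3 D10 D13) (DL D9 D9 D12 D3 D10 D12))) (DB (DB (DL D16 D12 D8 D4 D9 D13) (DL D7 D9 D8 D3 D11 D13)) (DB (DL D5 D15 D7 D5 D8 D12) (DL D8 D9 D7 D4 D10 D12)))))))) (FB (FB FN (FE (DB (DB (DB (DB (DL D5 D15 D8 D6 D8 D18) (DL D10 D15 D7 D6 D8 D16)) (DB (DL D11 D15 D8 D5 D6 D19) (DL D13 D16 D8 D8 D5 D17))) (DB (DB (DL D6 D16 D6 D6 D10 D16) (DL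 D4 D17 D7 D7 D9 D15)) (DB (DL D8 D20 D4 D8 D8 D17) (DL D10 D19 D5 D6 D9 D17)))) (DB (DB (DB (DL D4 D12 D8 D7 D8 D17) (DL D6 D14 D5 D9 D7 D16)) (DB (DL D5 D9 D8 D10 D5 D18) (DL D7 D9 D7 D9 D7 D17))) (DB (DB (DL D11 D12 D6 D8 D10 D15) (DL D8 D15 D5 D6 D11 D15)) (DB (DL D9 D15 D6 D8 D10 D16) (DL D5 D14 D7 D6 D10 D17)))))
    (DB (DB (DB (DB (DL D8 D10 D6 D6 D7 D15) (DL D11 D11 D7 D7 D6 D15)) (DB (DL D12 D14 D4 D5 D8 D15) (DL D17 D14 D4 D8 D8 D13))) (DB (DB (DL D5 D14 D5 D7 D8 D14) (DL D7 D13 D5 D7 D6 D15)) (DB (DL D10 D17 D4 D9 D6 D13) (DL D16 D15 D4 D9 D5 D13)))) (DB (DB (DB (DL D3 D10 D6 D3 D8 D15) (DL D5 D14 D4 D6 D6 D14)) (DB (DL D7 D9 D6 D3 D8 D15) (DL D12 D12 D4 D5 D7 D14))) (DB (DB (DL D9 D12 D5 D6 D7 D14) (DL D5 D14 D4 D6 D5 D15)) (DB (DL D3 D14 D6 D7 D7 D13) (DL D10 D10 D5 D6 D6 D14))))))) (FB FN (FE (DB (DB (DB (DB (DL D7 D9 D8 D6 D10 D17) (DL D8 D7 D11 D7 D10 D16)) (DB (DL D10 D12 D8 D11 D5 D20) (DL D14 D10 D12 D10 D6 D19))) (DB (DB (DL D7 D11 D6 D9 D11 D16) (DL D7 D10 D9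 D8 D11 D16)) (DB (DL D5 D17 D7 D10 D9 D19) (DL D10 D14 D9 D9 D9 D19)))) (DB (DB (DB (DL D7 D6 D7 D9 D8 D17) (DL D3 D9 D8 D9 D9 D16)) (DB (DL D6 D6 D7 D12 D5 D20) (DL D10 D5 D9 D11 D6 D19))) (DB (DB (DL D13 D5 D6 D9 D12 D15) (DL D11 D6 D8 D8 D11 D16)) (DB (DL D6 D10 D7 D11 D10 D18) (DL D6 D8 D7 D9 D11 D19)))))
    (DB (DB (DB (DB (DL D9 D9 D6 D10 D6 D15) (DL D14 D6 D9 D10 D6 D15)) (DB (DL D15 D14 D4 D12 D6 D16) (DL D21 D11 D7 D12 D7 D15))) (DB (DB (DL D5 D13 D5 D8 D7 D15) (DL D9 D9 D7 D8 D8 D15)) (DB (DL D9 D18 D5 D11 D5 D15) (DL D15 D14 D7 D12 D5 D15)))) (DB (DB (DB (DL D5 D6 D6 D8 D5 D15) (DL D10 D6 D7 D9 D5 D14)) (DB (DL D10 D9 D5 D8 D6 D16) (DL D18 D5 D7 D9 D6 D15))) (DB (DB (DL D9 D8 D5 D8 D7 D14) (DL D7 D5 D6 D7 D7 D14)) (DB (DL D3 D13 D5 D12 D4 D15) (DL D12 D7 D6 D9 D6 D15))))))))) (FB FN (FB FN (FB FN (FE (DB (DB (DB (DB (DL D7 D6 D5 D6 D12 D15) (DL D10 D4 D7 D7 D13 D13)) (DB (DL D3 D8 D6 D9 D7 D19) (DL D10 D6 D7 D9 D9 D17))) (DB (DB DN (DL D12 D6 D7 D8 D13 D14)) (DB DN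 (DL D10 D10 D6 D9 D11 D17)))) (DB (DB (DB (DL D9 D5 D6 D8 D12 D15) (DL D10 D9 D7 D9 D11 D15)) (DB (DL D11 D5 D6 D9 D8 D19) (DL D14 D4 D7 D9 D10 D18))) (DB (DB DN (DL D12 D7 D8 D8 D13 D15)) (DB DN (DL D12 D7 D8 D8 D12 D18)))))
    (DB (DB (DB (DB (DL D3 D4 D3 D8 D7 D10) (DL D7 D5 D6 D8 D7 D10)) (DB (DL D5 D9 D3 D9 D5 D12) (DL D8 D7 D5 D10 D5 D11))) (DB (DB DN (DL D6 D6 D5 D9 D8 D10)) (DB DN (DL D8 D11 D4 D9 D8 D11)))) (DB (DB (DB (DL D4 D6 D4 D8 D7 D11) (DL D10 D7 D5 D9 D7 D11)) (DB (DL D7 D6 D4 D9 D5 D13) (DL D8 D7 D6 D9 D6 D12))) (DB (DB DN (DL D8 D6 D7 D8 D8 D11)) (DB DN (DL D9 D9 D7 D8 D8 D12))))))))))"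
definition for6 :: forest where "for6 =
  FP pre8 pre2 (FB (FB (FB (FB FN (FE (DB (DB (DB (DB (DL D4 D14 D10 D11 D7 D18) (DL D3 D18 D15 D11 D7 D17)) (DB (DL D7 D10 D8 D13 D5 D19) (DL D7 D15 D11 D14 D6 D17))) (DB (DB DN (DL D4 D13 D14 D10 D7 D18)) (DB (DL D9 D15 D7 D13 D4 D19) (DL D4 D11 D11 D12 D4 D19)))) (DB (DB (DB DN (DL D1 D22 D15 D16 D7 D16)) (DB DN (DL D4 D18 D15 D14 D6 D17))) (DB (DB DN DN) (DB DN (DL D2 D15 D13 D14 D5 D18)))))
    (DB (DB (DB (DB (DL D4 D12 D5 D7 D13 D18) (DL D5 D15 D9 D8 D14 D16)) (DB (DL D9 D7 D8 D6 D12 D16) (DL D9 D12 D10 D7 D12 D15))) (DB (DB DN (DL D2 D11 D7 D11 D9 D18)) (DB (DL D10 D11 D4 D10 D9 D16) (DL D5 D8 D7 D9 D9 D16)))) (DB (DB (DB DN (DL D1 D19 D11 D11 D12 D16)) (DB DN (DL D6 D15 D11 D9 D13 D14))) (DB (DB DN DN) (DB DN (DL D1 D12 D10 D8 D11 D15))))))) FN) (FB (FB FN (FE (DB (DB (DB (DB (DL D4 D12 D6 D7 D10 D17) (DL D7 D9 D7 D10 D7 D16)) (DB (DL D8 D12 D6 D10 D6 D19) (DL D9 D10 D7 D9 D6 D18))) (DB (DB DN (DL D5 D11 D9 D9 D6 D18)) (DB (DL D7 D18 D7 D6 D8 D19) (DL D7 D14 D10 D5 D7 D19)))) (DB (DB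 (DB DN (DL D3 D12 D10 D10 D8 D15)) (DB DN (DL D8 D9 D7 D11 D7 D17))) (DB (DB DN DN) (DB DN (DL D8 D10 D8 D7 D8 D18)))))
    (DB (DB (DB (DB (DL D7 D9 D4 D5 D9 D15) (DL D10 D7 D5 D6 D9 D14)) (DB (DL D9 D13 D3 D7 D7 D15) (DL D15 D8 D5 D6 D8 D14))) (DB (DB DN (DL D8 D8 D5 D6 D6 D16)) (DB (DL D9 D14 D4 D6 D8 D15) (DL D11 D9 D4 D7 D8 D15)))) (DB (DB (DB DN (DL D6 D10 D7 D6 D10 D14)) (DB DN (DL D12 D6 D6 D6 D10 D13))) (DB (DB DN DN) (DB DN (DL D7 D7 D5 D4 D10 D14))))))) (FB FN (FE (DB (DB (DB (DB (DL D2 D10 D6 D10 D8 D17) (DL D7 D13 D10 D9 D8 D17)) (DB (DL D4 D13 D4 D12 D6 D20) (DL D10 D13 D7 D12 D7 D19))) (DB (DB (DL D8 D11 D8 D7 D10 D18) (DL D7 D9 D11 D7 D10 D18)) (DB (DL D6 D15 D4 D12 D5 D21) (DL D9 D11 D9 D10 D6 D21)))) (DB (DB (DB (DL D5 D14 D6 D13 D6 D16) (DL D2 D18 D10 D11 D7 D16)) (DB (DL D2 D15 D4 D13 D6 D19) (DL D4 D18 D9 D12 D6 D19))) (DB (DB (DL D10 D9 D6 D11 D8 D17) (DL D7 D10 D10 D9 D9 D17)) (DB (DL D9 D12 D4 D12 D6 D20) (DL D7 D11 D9 D10 D7 D20)))))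
    (DB (DB (DB (DB (DL D8 D10 D5 D4 D7 D15) (DL D9 D11 D9 D3 D7 D15)) (DB (DL D9 D10 D5 D6 D5 D16) (DL D13 D10 D6 D6 D6 D15))) (DB (DB (DL D10 D10 D4 D6 D5 D16) (DL D8 D8 D8 D4 D6 D16)) (DB (DL D4 D15 D6 D6 D5 D16) (DL D12 D8 D7 D3 D6 D17)))) (DB (DB (DB (DL D5 D10 D5 D8 D7 D14) (DL D6 D13 D8 D7 D8 D14)) (DB (DL D6 D9 D5 D8 D6 D14) (DL D8 D15 D7 D5 D8 D14))) (DB (DB (DL D10 D9 D5 D7 D5 D15) (DL D3 D12 D7 D4 D8 D15)) (DB (DL D8 D9 D6 D7 D6 D15) (DL D3 D13 D5 D4 D9 D15))))))))) FN)"
definition for10 :: forest where "for10 =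
  FP pre9 pre3 (FB (FB (FB FN (FB FN (FE (DB (DB (DB (DB (DL D10 D13 D7 D4 D12 D18) (DL D9 D6 D9 D6 D15 D16)) (DB (DL D9 D14 D10 D4 D11 D20) (DL D5 D9 D10 D4 D15 D18))) (DB (DB (DL D13 D14 D5 D6 D15 D16) (DL D7 D8 D7 D7 D16 D16)) (DB (DL D11 D19 D7 D4 D12 D19) (DL D6 D13 D9 D4 D15 D18)))) (DB (DB (DB DN DN) (DB (DL D8 D12 D9 D6 D11 D19) (DL D7 D9 D10 D7 D13 D18))) (DB (DB DN DN) (DB (DL D13 D16 D8 D5 D11 D18) (DL D9 D10 D9 D7 D12 D18)))))
    (DB (DB (DB (DB (DL D11 D8 D8 D6 D14 D12) (DL D12 D4 D8 D8 D15 D12)) (DB (DL D8 D13 D9 D4 D14 D13) (DL D10 D5 D9 D5 D16 D12))) (DB (DB (DL D11 D12 D6 D6 D15 D12) (DL D5 D5 D6 D7 D15 D13)) (DB (DL D8 D17 D6 D5 D15 D12) (DL D4 D9 D6 D6 D15 D13)))) (DB (DB (DB DN DN) (DB (DL D12 D7 D8 D6 D14 D12) (DL D10 D6 D11 D6 D15 D11))) (DB (DB DN DN) (DB (DL D13 D12 D7 D5 D13 D12) (DL D7 D4 D8 D6 D13 D13)))))))) FN) FN)"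
definition for2 :: forest where "for2 =
  FP pre7 pre1 (FB (FB (FB (FB FN (FE (DB (DB (DB (DB (DL D5 D7 D13 D7 D7 D16) (DL D7 D5 D14 D8 D9 D15)) (DB (DL D7 D9 D10 D6 D8 D18) (DL D11 D2 D15 D6 D9 D16))) (DB (DB (DL D8 D9 D11 D9 D8 D16) (DL D2 D5 D11 D10 D9 D16)) (DB (DL D8 D14 D10 D8 D7 D16) (DL D5 D8 D12 D10 D8 D15)))) (DB (DB (DB (DL D7 D9 D8 D10 D7 D16) (DL D6 D12 D12 D9 D8 D15)) (DB (DL D6 D8 D8 D7 D9 D17) (DL D11 D8 D12 D7 D9 D16))) (DB (DB (DL D16 D6 D10 D9 D7 D16) (DL D9 D8 D13 D7 D8 D16)) (DB (DL D12 D10 D9 D9 D7 D16) (DL D9 D4 D13 D9 D6 D16)))))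
    (DB (DB (DB (DB (DL D6 D6 D9 D5 D9 D15) (DL D12 D8 D9 D6 D10 D13)) (DB (DL D6 D9 D8 D4 D12 D13) (DL D16 D4 D8 D4 D12 D12))) (DB (DB (DL D12 D10 D8 D5 D10 D14) (DL D6 D2 D8 D6 D10 D14)) (DB (DL D7 D14 D7 D6 D9 D13) (DL D5 D5 D7 D7 D9 D13)))) (DB (DB (DB (DL D4 D10 D8 D7 D9 D14) (DL D7 D16 D9 D8 D9 D13)) (DB (DL D7 D5 D9 D3 D12 D13) (DL D14 D10 D10 D4 D11 D12))) (DB (DB (DL D17 D6 D5 D8 D8 D14) (DL D3 D11 D7 D7 D8 D14)) (DB (DL D12 D8 D7 D6 D8 D13) (DL D7 D7 D8 D6 D8 D12))))))) (FB FN (FE (DB (DB (DB (DB (DL D3 D4 D15 D5 D12 D15) (DL D9 D6 D17 D7 D15 D13)) (DB (DL D5 D7 D16 D4 D12 D17) (DL D13 D2 D18 D5 D15 D15))) (DB (DB (DL D5 D9 D12 D8 D14 D14) (DL D2 D4 D13 D8 D17 D13)) (DB (DL D5 D13 D13 D5 D14 D15) (DL D6 D7 D16 D6 D15 D15)))) (DB (DB (DB DN DN) (DB (DL D5 D3 D15 D6 D12 D16) (DL D10 D5 D19 D6 D16 D13))) (DB (DB DN DN) (DB (DL D8 D9 D15 D4 D14 D14) (DL D4 D3 D17 D6 D15 D14)))))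
    (DB (DB (DB (DB (DL D8 D3 D15 D2 D15 D10) (DL D14 D8 D14 D3 D17 D9)) (DB (DL D6 D8 D13 D2 D17 D9) (DL D19 D5 D15 D1 D20 D7))) (DB (DB (DL D11 D9 D9 D4 D16 D10) (DL D7 D5 D9 D5 D16 D11)) (DB (DL D5 D13 D10 D3 D16 D9) (DL D10 D3 D12 D3 D17 D9)))) (DB (DB (DB DN DN) (DB (DL D8 D6 D12 D4 D17 D8) (DL D13 D11 D16 D3 D19 D6))) (DB (DB DN DN) (DB (DL D9 D7 D12 D3 D15 D8) (DL D8 D8 D13 D3 D16 D8)))))))) FN) FN)"
definition for12 :: forest where "for12 =
  FP pre8 pre2 (FB (FB FN (FB FN (FB FN (FE (DB (DB (DB (DB (DL D10 D6 D6 D14 D7 D17) (DL D11 D5 D7 D14 D7 D18)) (DB DN (DL D12 D5 D6 D15 D7 D19))) (DB (DB (DL D13 D7 D5 D12 D10 D17) (DL D10 D4 D7 D10 D9 D19)) (DB (DL D10 D14 D3 D15 D7 D18) (DL D10 D10 D6 D12 D7 D20)))) (DB (DB (DB DN DN) (DB DN DN)) (DB (DB (DL D13 D4 D5 D15 D8 D17) (DL D8 D8 D5 D13 D8 D18)) (DB DN (DL D12 D12 D2 D11 D10 D19)))))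
    (DB (DB (DB (DB (DL D12 D4 D9 D8 D8 D15) (DL D6 D4 D10 D8 D8 D16)) (DB DN (DL D11 D1 D10 D10 D7 D17))) (DB (DB (DL D16 D5 D8 D8 D9 D16) (DL D9 D2 D8 D7 D8 D18)) (DB (DL D9 D12 D7 D9 D6 D17) (DL D4 D5 D9 D9 D6 D18)))) (DB (DB (DB DN DN) (DB DN DN)) (DB (DB (DL D15 D4 D9 D9 D7 D16) (DL D9 D7 D7 D8 D6 D18)) (DB DN (DL D7 D6 D6 D11 D4 D18))))))))) FN)"
definition for4 :: forest where "for4 =
  FP pre7 pre1 (FB (FB FN (FB FN (FB FN (FE (DB (DB (DB (DB (DL D8 D5 D5 D8 D10 D15) (DL D2 D9 D8 D9 D9 D15)) (DB (DL D5 D7 D4 D11 D8 D16) (DL D7 D7 D6 D12 D8 D16))) (DB (DB (DL D13 D8 D4 D8 D10 D16) (DL D10 D6 D6 D8 D10 D16)) (DB (DL D7 D12 D4 D10 D9 D16) (DL D9 D9 D6 D9 D9 D17)))) (DB (DB (DB (DL D9 D9 D4 D11 D8 D14) (DL D3 D16 D6 D10 D8 D14)) (DB (DL D2 D10 D4 D13 D7 D15) (DL D1 D16 D4 D12 D8 D15))) (DB (DB (DL D13 D5 D5 D10 D10 D14) (DL D10 D9 D4 D9 D10 D15)) (DB (DL D5 D9 D4 D10 D10 D15) (DL D5 D12 D4 D8 D11 D16)))))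
    (DB (DB (DB (DB (DL D9 D1 D5 D7 D6 D16) (DL D8 D6 D6 D8 D6 D16)) (DB (DL D8 D5 D4 D9 D6 D16) (DL D14 D3 D6 D9 D6 D16))) (DB (DB (DL D15 D5 D3 D7 D8 D16) (DL D5 D4 D3 D7 D7 D18)) (DB (DL D8 D10 D2 D8 D7 D16) (DL D8 D7 D4 D9 D6 D17)))) (DB (DB (DB (DL D10 D7 D3 D10 D4 D15) (DL D4 D14 D5 D8 D4 D16)) (DB (DL D3 D6 D3 D9 D5 D15) (DL D10 D12 D5 D10 D4 D15))) (DB (DB (DL D15 D4 D2 D9 D6 D16) (DL D7 D7 D3 D8 D5 D17)) (DB (DL D10 D5 D2 D10 D5 D15) (DL D7 D7 D3 D9 D5 D16))))))))) FN)"
definition for8 :: forest where "for8 =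
  FP pre7 pre1 (FB (FB (FB FN (FB FN (FE (DB (DB (DB (DB (DL D12 D14 D9 D6 D9 D16) (DL D7 D6 D10 D4 D11 D16)) (DB (DL D8 D13 D10 D3 D9 D18) (DL D10 D6 D10 D4 D10 D17))) (DB (DB (DL D13 D12 D8 D3 D11 D15) (DL D8 D9 D6 D4 D12 D16)) (DB (DL D8 D17 D8 D3 D10 D16) (DL D6 D10 D8 D4 D11 D16)))) (DB (DB (DB DN DN) (DB (DL D6 D11 D10 D5 D8 D17) (DL D7 D9 D10 D7 D9 D16))) (DB (DB DN DN) (DB (DL D7 D15 D8 D6 D7 D16) (DL D5 D8 D6 D9 D9 D16)))))
    (DB (DB (DB (DB (DL D13 D14 D13 D2 D10 D13) (DL D8 D7 D11 D5 D11 D13)) (DB (DL D8 D14 D13 D3 D10 D12) (DL D7 D7 D12 D4 D11 D12))) (DB (DB (DL D13 D15 D8 D5 D11 D12) (DL D8 D8 D6 D6 D11 D14)) (DB (DL D8 D18 D10 D4 D10 D11) (DL D4 D10 D8 D6 D9 D13)))) (DB (DB (DB DN DN) (DB (DL D8 D8 D13 D4 D8 D12) (DL D8 D8 D13 D3 D10 D12))) (DB (DB DN DN) (DB (DL D7 D14 D11 D2 D9 D11) (DL D5 D6 D8 D5 D9 D13)))))))) FN) FN)"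
definition for0 :: forest where "for0 =
  FP pre6 pre0 (FB (FB (FB (FB (FE (DB (DB (DB (DB (DL D9 D9 D11 D7 D11 D15) (DL D6 D6 D6 D7 D8 D14)) (DB DN (DL D9 D7 D5 D5 D7 D13))) (DB (DB DN (DL D7 D10 D6 D6 D6 D14)) (DB DN (DL D5 D14 D5 D4 D6 D13)))) (DB (DB (DB DN DN) (DB DN DN)) (DB (DB DN DN) (DB DN (DL D4 D13 D3 D4 D6 D12)))))
    (DB (DB (DB (DB (DL D11 D11 D8 D5 D11 D17) (DL D4 D9 D3 D6 D9 D17)) (DB DN (DL D10 D6 D4 D9 D8 D14))) (DB (DB DN (DL D6 D6 D4 D8 D4 D18)) (DB DN (DL D6 D9 D4 D9 D5 D14)))) (DB (DB (DB DN DN) (DB DN DN)) (DB (DB DN DN) (DB DN (DL D3 D8 D1 D8 D5 D13)))))) (FE (DB (DB (DB (DB (DL D5 D11 D10 D11 D6 D15) (DL D3 D8 D8 D8 D6 D13)) (DB (DL D4 D12 D8 D7 D4 D16) (DL D12 D8 D7 D7 D5 D14))) (DB (DB DN (DL D8 D7 D10 D5 D8 D12)) (DB (DL D7 D17 D5 D7 D5 D14) (DL D6 D11 D9 D6 D5 D13)))) (DB (DB (DB DN (DL D5 D6 D10 D10 D6 D13)) (DB DN (DL D10 D5 D10 D8 D5 D14))) (DB (DB DN DN) (DB DN (DL D5 D9 D9 D9 D4 D13)))))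
    (DB (DB (DB (DB (DL D6 D13 D3 D9 D8 D16) (DL D6 D10 D6 D10 D6 D16)) (DB (DL D8 D10 D3 D9 D8 D15) (DL D11 D7 D3 D11 D8 D13))) (DB (DB DN (DL D6 D5 D4 D9 D7 D16)) (DB (DL D8 D17 D3 D13 D4 D14) (DL D6 D8 D4 D11 D6 D12)))) (DB (DB (DB DN (DL D2 D16 D8 D9 D8 D15)) (DB DN (DL D8 D12 D8 D8 D8 D13))) (DB (DB DN DN) (DB DN (DL D3 D8 D7 D9 D6 D12))))))) (FB FN (FE (DB (DB (DB (DB (DL D7 D5 D13 D5 D9 D12) (DL D3 D7 D14 D2 D11 D11)) (DB (DL D4 D8 D10 D4 D9 D14) (DL D14 D2 D13 D4 D11 D12))) (DB (DB (DL D11 D9 D10 D4 D12 D11) (DL D4 D4 D12 D4 D14 D10)) (DB (DL D6 D13 D10 D2 D11 D12) (DL D9 D6 D13 D1 D13 D11)))) (DB (DB (DB DN DN) (DB (DL D5 D7 D10 D4 D9 D13) (DL D1 D11 D13 D4 D11 D11))) (DB (DB DN DN) (DB (DL D4 D11 D9 D4 D10 D11) (DL D6 D5 D14 D3 D10 D11)))))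
    (DB (DB (DB (DB (DL D3 D7 D11 D4 D12 D11) (DL D8 D15 D11 D5 D12 D11)) (DB (DL D9 D9 D11 D7 D11 D10) (DL D19 D5 D13 D7 D13 D8))) (DB (DB (DL D11 D10 D8 D6 D10 D11) (DL D3 D10 D9 D6 D10 D12)) (DB (DL D5 D13 D9 D8 D10 D9) (DL D15 D6 D11 D7 D11 D9)))) (DB (DB (DB DN DN) (DB (DL D4 D8 D14 D3 D11 D10) (DL D9 D17 D14 D3 D13 D8))) (DB (DB DN DN) (DB (DL D4 D10 D11 D5 D9 D9) (DL D3 D13 D11 D5 D10 D9)))))))) (FB (FB FN (FE (DB (DB (DB (DB (DL D4 D8 D9 D8 D9 D15) (DL D8 D9 D6 D7 D8 D13)) (DB DN (DL D15 D8 D5 D6 D6 D14))) (DB (DB DN (DL D6 D8 D7 D5 D7 D13)) (DB (DL D9 D15 D4 D3 D9 D14) (DL D12 D10 D6 D3 D8 D14)))) (DB (DB (DB DN DN) (DB DN DN)) (DB (DB DN DN) (DB DN (DL D10 D9 D3 D5 D9 D13)))))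
    (DB (DB (DB (DB (DL D7 D7 D3 D9 D6 D14) (DL D14 D3 D5 D10 D6 D13)) (DB DN (DL D21 D4 D5 D10 D8 D11))) (DB (DB DN (DL D7 D7 D5 D7 D7 D14)) (DB (DL D8 D15 D3 D9 D5 D12) (DL D14 D8 D6 D8 D6 D11)))) (DB (DB (DB DN DN) (DB DN DN)) (DB (DB DN DN) (DB DN (DL D9 D9 D3 D5 D6 D12))))))) (FB FN (FE (DB (DB (DB (DB (DL D4 D6 D7 D6 D9 D14) (DL D7 D3 D10 D7 D9 D13)) (DB DN (DL D15 D4 D9 D11 D7 D15))) (DB (DB (DL D6 D9 D7 D4 D10 D14) (DL D3 D6 D10 D4 D10 D14)) (DB (DL D3 D13 D6 D7 D8 D16) (DL D10 D9 D9 D7 D8 D16)))) (DB (DB (DB DN DN) (DB DN DN)) (DB (DB (DL D12 D2 D8 D7 D8 D14) (DL D7 D7 D9 D5 D9 D14)) (DB DN (DL D7 D5 D8 D6 D9 D16)))))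
    (DB (DB (DB (DB (DL D11 D1 D8 D11 D7 D14) (DL D19 D4 D8 D12 D7 D14)) (DB DN (DL D24 D3 D9 D12 D9 D13))) (DB (DB (DL D5 D8 D5 D10 D8 D14) (DL D11 D4 D6 D10 D8 D15)) (DB (DL D13 D11 D6 D12 D7 D13) (DL D20 D7 D7 D13 D7 D13)))) (DB (DB (DB DN DN) (DB DN DN)) (DB (DB (DL D6 D3 D8 D9 D6 D14) (DL D9 D7 D6 D9 D6 D15)) (DB DN (DL D14 D6 D8 D10 D6 D13))))))))) (FB FN (FB FN (FB FN (FE (DB (DB (DB (DB (DL D5 D6 D3 D4 D9 D14) (DL D8 D6 D6 D5 D8 D14)) (DB DN (DL D13 D4 D6 D7 D7 D16))) (DB (DB DN (DL D8 D7 D8 D4 D9 D14)) (DB DN (DL D8 D10 D6 D5 D9 D16)))) (DB (DB (DB DN DN) (DB DN DN)) (DB (DB DN DN) (DB DN (DL D13 D10 D3 D6 D10 D16)))))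
    (DB (DB (DB (DB (DL D4 D10 D3 D5 D8 D11) (DL D9 D10 D5 D7 D7 D11)) (DB DN (DL D13 D7 D7 D8 D6 D11))) (DB (DB DN (DL D3 D10 D4 D8 D7 D12)) (DB DN (DL D10 D13 D5 D9 D5 D11)))) (DB (DB (DB DN DN) (DB DN DN)) (DB (DB DN DN) (DB DN (DL D8 D15 D3 D7 D6 D11))))))))))"
text \<open>Code 14 is empty: the dihedral group moves its strategies to cases listed under 7, 11 or
  13.\<close>

definition forest :: forest where "forest = (FB (FB (FB (FB for15 for7) (FB for11 for3)) (FB (FB for13 for5) (FB for9 for1))) (FB (FB (FB FN for6) (FB for10 for2)) (FB (FB for12 for4) (FB for8 for0))))"
lemmas for_defs = for15_def for7_def for11_def for3_def for13_def for5_def for9_def for1_def for6_def for10_def for2_def for12_def for4_def for8_def for0_def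

text \<open>Fixing the signs of the ring 10--13 beforehand splits the check into 15 evaluations that
  are independent of each other.\<close>

definition run :: "bool list \<Rightarrow> forest \<Rightarrow> bool" where
  "run bs f = rf PNone PNone f [row 6, row 7, row 8, row 9, row 1, row 2, row 3, row 4, row 5]
     (mm bs [row 10, row 11, row 12, row 13] base)"

lemmas compute = run_def base_lit row1 row2 row3 row4 row5 row6 row7 row8 row9 row10 row11 row12 row13 machine end_simps
  rf.simps(2,3) pre_defs for_defs tables

lemma run_0:
  "run [True, False, False, False] for1"
  "run [True, True, True, False] for7"
  "run [True, True, True, True] for15"
  "run [True, False, True, False] for5"
  "run [True, True, False, True] for11"
  "run [False, False, True, False] for4"
  "run [False, False, False, True] for8"
  by (simp_all only: compute)

lemma run_1:
  "run [True, True, False, False] for3"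
  "run [False, False, False, False] for0"
  "run [False, True, False, False] for2"
  "run [False, True, True, False] for6"
  "run [True, False, False, True] for9"
  "run [True, False, True, True] for13"
  "run [False, True, False, True] for10"
  "run [False, False, True, True] for12"
  by (simp_all only: compute)

section \<open>Meaning of vectors and slacks\<close>

fun leaves :: "vec \<Rightarrow> int list" where
  "leaves (N t a) = [100 * t + a]"
| "leaves (B x y) = leaves x @ leaves y"
| "leaves (V8 x1 x2 x3 x4 x5 x6 x7 x8) =
     leaves x1 @ leaves x2 @ leaves x3 @ leaves x4 @ leaves x5 @ leaves x6 @ leaves x7 @ leaves x8"

fun wf :: "vec \<Rightarrow> bool" where
  "wf (N t a) = (0 \<le> a \<and> a < 100)"
| "wf (B x y) = (wf x \<and> wf y)"
| "wf (V8 x1 x2 x3 x4 x5 x6 x7 x8) =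
     (wf x1 \<and> wf x2 \<and> wf x3 \<and> wf x4 \<and> wf x5 \<and> wf x6 \<and> wf x7 \<and> wf x8)"

fun same :: "vec \<Rightarrow> vec \<Rightarrow> bool" where
  "same (N t a) (N t' b) = True"
| "same (B x y) (B x' y') = (same x x' \<and> same y y')"
| "same (V8 x1 x2 x3 x4 x5 x6 x7 x8) (V8 y1 y2 y3 y4 y5 y6 y7 y8) =
     (same x1 y1 \<and> same x2 y2 \<and> same x3 y3 \<and> same x4 y4 \<and> same x5 y5 \<and> same x6 y6 \<and> same x7 y7 \<and> same x8 y8)"
| "same x y = False"

definition absum :: "vec \<Rightarrow> int" where "absum v = sum_list (map abs (leaves v))"

lemma same_refl [simp]: "same x x" by (induction x) auto
lemma same_sym: "same x y \<Longrightarrow> same y x" by (induction x y rule: same.induct) auto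
lemma same_trans: "same x y \<Longrightarrow> same y z \<Longrightarrow> same x z"
proof (induction x y arbitrary: z rule: same.induct)
  case 1 then show ?case by (cases z) auto
next
  case 2 then show ?case by (cases z) auto
next
  case 3 then show ?case by (cases z) auto
qed auto
lemma same_length: "same x y \<Longrightarrow> length (leaves x) = length (leaves y)"
  by (induction x y rule: same.induct) auto

lemma ad_sound:
  "same x y \<Longrightarrow> wf x \<Longrightarrow> wf y \<Longrightarrow>
    wf (ad x y) \<and> same (ad x y) x \<and> leaves (ad x y) = map2 (+) (leaves x) (leaves y)"
proof (induction x y rule: same.induct)
  case (2 x y x' y')
  then show ?case by (auto simp: same_length zip_append)
next
  case 3
  then show ?case by (auto simp: same_length zip_append)
qed (auto simp: h0_def h1_def)

lemma neg_sound: "wf x \<Longrightarrow> wf (neg x) \<and> same (neg x) x \<and> leaves (neg x) = map uminus (leaves x)"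
  by (induction x) (auto simp: n0_def n1_def D0_def)

text \<open>\<open>Neg\<close> is compatible with every number: it carries no information, and no
  test succeeds on it.\<close>

fun okz :: "slack \<Rightarrow> int \<Rightarrow> bool" where
  "okz (Z u b) x = (0 \<le> b \<and> b < 100 \<and> 100 * u + b = x)"
| "okz Neg x = True"

lemma okz_sa: "0 \<le> b \<Longrightarrow> b < 100 \<Longrightarrow> 0 \<le> a \<Longrightarrow> a < 100 \<Longrightarrow> okz (sa w b a) (100 * w + b + a)"
  by (auto simp: sa_def sz_def ic_def)

lemma okz_sh: "wf (N t a) \<Longrightarrow> okz z x \<Longrightarrow> okz (sh (N t a) z) (x + (100 * t + a))"
  using okz_sa[of _ a "_ + t"] by (cases z) (auto simp: algebra_simps)

lemma acc_leaf:
  assumes "0 \<le> a" "a < 100" "0 \<le> b" "b < 100"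
  shows "okz (acc (N t a) (Z u b)) (100 * u + b - \<bar>100 * t + a\<bar>) \<and>
    (\<forall>u' b'. acc (N t a) (Z u b) = Z u' b' \<longrightarrow> 0 \<le> u')"
proof (cases "0 \<le> t")
  case True
  then show ?thesis using assms by (auto simp: sb_def dec_def)
next
  case False
  then have "\<bar>100 * t + a\<bar> = - (100 * t + a)" using assms by auto
  then show ?thesis using assms False by (auto simp: sa_def sz_def ic_def)
qed

text \<open>Kept apart from the induction because it serves twice: accumulating over the eight parts
  of a \<open>V8\<close> in sequence is the same as accumulating over a tree of \<open>B\<close>
  nodes.\<close>

lemma acc_sound_B:
  assumes "\<And>z x. wf v \<Longrightarrow> okz z x \<Longrightarrow> okz (acc v z) (x - absum v) \<and> (\<forall>u b. acc v z = Z u b \<longrightarrow> 0 \<le> u)"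
    and "\<And>z x. wf w \<Longrightarrow> okz z x \<Longrightarrow> okz (acc w z) (x - absum w) \<and> (\<forall>u b. acc w z = Z u b \<longrightarrow> 0 \<le> u)"
    and "wf (B v w)" "okz z x"
  shows "okz (acc (B v w) z) (x - absum (B v w)) \<and> (\<forall>u b. acc (B v w) z = Z u b \<longrightarrow> 0 \<le> u)"
proof -
  have 1: "okz (acc v z) (x - absum v)" using assms(1)[of z x] assms(3,4) by simp
  have "okz (acc w (acc v z)) (x - absum v - absum w) \<and> (\<forall>u b. acc w (acc v z) = Z u b \<longrightarrow> 0 \<le> u)"
    using assms(2)[OF _ 1] assms(3) by simp
  then show ?thesis by (simp add: absum_def algebra_simps)
qed

text \<open>The nonnegative high digit of the result is what turns survival of the slack into an
  inequality. It holds even if the slack before was negative.\<close>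

lemma acc_sound:
  "wf v \<Longrightarrow> okz z x \<Longrightarrow> okz (acc v z) (x - absum v) \<and> (\<forall>u b. acc v z = Z u b \<longrightarrow> 0 \<le> u)"
proof (induction v arbitrary: z x)
  case (N t a)
  show ?case
  proof (cases z)
    case (Z u b)
    then have *: "0 \<le> a" "a < 100" "0 \<le> b" "b < 100" "x = 100 * u + b" using N by auto
    show ?thesis unfolding Z *(5) using acc_leaf[OF *(1-4), of t u] by (simp add: absum_def del: acc.simps)
  qed simp
next
  case (B v w)
  then show ?case by (rule acc_sound_B)
next
  case (V8 v1 v2 v3 v4 v5 v6 v7 v8)
  have "wf (B (B (B v1 v2) (B v3 v4)) (B (B v5 v6) (B v7 v8)))" using V8.prems(1) by simp
  from acc_sound_B[OF acc_sound_B[OF acc_sound_B[OF V8.IH(1,2)] acc_sound_B[OF V8.IH(3,4)]]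
      acc_sound_B[OF acc_sound_B[OF V8.IH(5,6)] acc_sound_B[OF V8.IH(7,8)]] this V8.prems(2)]
  show ?case by (simp add: absum_def algebra_simps)
qed

lemma acc_bound:
  assumes "wf v" "okz z x" "acc v z \<noteq> Neg" shows "absum v \<le> x"
proof (cases "acc v z")
  case (Z u b)
  then show ?thesis using acc_sound[OF assms(1,2)] by auto
qed (use assms in auto)

section \<open>Soundness of the search\<close>

fun li :: "nat \<Rightarrow> vec list \<Rightarrow> bool list \<Rightarrow> int" where
  "li i (c # cs) (s # ss) = (if s then leaves c ! i else - (leaves c ! i)) + li i cs ss"
| "li i cs ss = 0"

lemma li_Nil [simp]: "li i [] ss = 0" "li i cs [] = 0"
  by (cases ss; simp) (cases cs; simp)

lemma li_Not: "li i cs (map Not ss) = - li i cs ss"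
  by (induction i cs ss rule: li.induct) auto

lemma li_append: "length cs = length ss \<Longrightarrow> li i (cs @ cs') (ss @ ts) = li i cs ss + li i cs' ts"
  by (induction cs ss rule: list_induct2) auto

lemma li_rev: "length cs = length ss \<Longrightarrow> li i (rev cs) (rev ss) = li i cs ss"
  by (induction cs ss rule: list_induct2) (auto simp: li_append)

definition sgn_vec :: "bool \<Rightarrow> vec \<Rightarrow> vec" where "sgn_vec s v = (if s then v else neg v)"

lemma sgn_vec:
  assumes "same v g" "wf v" "wf g" "length (leaves g) = n"
  shows "wf (ad g (sgn_vec s v))" "same (ad g (sgn_vec s v)) g"
    "length (leaves (ad g (sgn_vec s v))) = n"
    "i < n \<Longrightarrow> leaves (ad g (sgn_vec s v)) ! i = leaves g ! i + (if s then leaves v ! i else - (leaves v ! i))"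
proof -
  have n: "wf (neg v)" "same (neg v) v" "leaves (neg v) = map uminus (leaves v)"
    using neg_sound[OF assms(2)] by auto
  have g: "same g v" by (rule same_sym[OF assms(1)])
  have "same g (neg v)" by (rule same_trans[OF g same_sym[OF n(2)]])
  then have 1: "wf (sgn_vec s v)" "same g (sgn_vec s v)"
    "leaves (sgn_vec s v) = (if s then leaves v else map uminus (leaves v))"
    using n g assms(2) unfolding sgn_vec_def by auto
  note 2 = ad_sound[OF 1(2) assms(3) 1(1)]
  have 3: "length (leaves v) = n" using assms(4) same_length[OF assms(1)] by simp
  show "wf (ad g (sgn_vec s v))" "same (ad g (sgn_vec s v)) g" using 2 by auto
  show "length (leaves (ad g (sgn_vec s v))) = n" using 2 1 3 assms by auto
  show "leaves (ad g (sgn_vec s v)) ! i = leaves g ! i + (if s then leaves v ! i else - (leaves v ! i))" if "i < n"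
    using 2 1 3 assms that by auto
qed

lemma absum_nth: "length (leaves v) = n \<Longrightarrow> absum v = (\<Sum>i<n. \<bar>leaves v ! i\<bar>)"
  by (auto simp: absum_def sum_list_sum_nth atLeast0LessThan)

fun rad :: "plan \<Rightarrow> int" where
  "rad Fin = 0" | "rad (Skip d) = rad d" | "rad (Tst d) = rad d" | "rad (Del t d) = 100 * t + rad d"

text \<open>The sum includes row 0. This gives away the sign of its open part, but a single number
  then serves all branches.\<close>

definition tailb :: "nat \<Rightarrow> vec list \<Rightarrow> int \<Rightarrow> bool" where
  "tailb n cs r = (\<forall>ss. length ss = length cs \<longrightarrow> (\<Sum>i\<le>n. \<bar>li i cs ss\<bar>) \<le> r)"

fun tok :: "nat \<Rightarrow> vec list \<Rightarrow> plan \<Rightarrow> bool" where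
  "tok n (c # cs) (Skip d) = tok n cs d"
| "tok n (c # cs) (Tst d) = (tailb n cs (rad d) \<and> tok n cs d)"
| "tok n (c # cs) (Del t d) = (tailb n cs (rad d) \<and> tok n cs d)"
| "tok n [] Fin = True"
| "tok n cs d = False"

definition col :: "nat \<Rightarrow> vec \<Rightarrow> vec \<Rightarrow> bool" where
  "col n g c = (\<exists>t a v. c = B (N t a) v \<and> wf c \<and> same v g \<and> length (leaves v) = n)"

lemma col_same:
  assumes "col n g c" "same g' g" shows "col n g' c"
proof -
  obtain t a v where "c = B (N t a) v" "wf c" "same v g" "length (leaves v) = n"
    using assms(1) unfolding col_def by blast
  then show ?thesis
    unfolding col_def using same_trans[OF \<open>same v g\<close> same_sym[OF assms(2)]] by blast
qed

lemma split_sum: "(\<Sum>i\<le>n. f i) = f 0 + (\<Sum>i<n. f (Suc i :: nat))" for f :: "nat \<Rightarrow> int"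
  by (simp only: lessThan_Suc_atMost[symmetric] sum.lessThan_Suc_shift)

text \<open>Triangle inequality: by the test the fixed part is at most the slack, and by the tail
  bound the open part is at most \<open>r\<close>.\<close>

lemma tested:
  assumes g: "wf g" "length (leaves g) = n" and z: "okz z x" and d: "tailb n cs r"
    and acc: "acc g z \<noteq> Neg" and ss: "length ss = length cs"
  shows "li 0 cs ss + (\<Sum>i<n. \<bar>leaves g ! i + li (Suc i) cs ss\<bar>) \<le> x + r"
proof -
  have "(\<Sum>i<n. \<bar>leaves g ! i\<bar>) \<le> x"
    using acc_bound[OF g(1) z acc] absum_nth[OF g(2)] by simp
  moreover have "\<bar>li 0 cs ss\<bar> + (\<Sum>i<n. \<bar>li (Suc i) cs ss\<bar>) \<le> r"
    using d ss unfolding tailb_def split_sum by auto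
  moreover have "(\<Sum>i<n. \<bar>leaves g ! i + li (Suc i) cs ss\<bar>) \<le>
      (\<Sum>i<n. \<bar>leaves g ! i\<bar>) + (\<Sum>i<n. \<bar>li (Suc i) cs ss\<bar>)"
    unfolding sum.distrib[symmetric] by (intro sum_mono) auto
  ultimately show ?thesis by linarith
qed

lemma leaf_N: "wf (N t a) \<Longrightarrow> \<exists>t' a'. neg (N t a) = N t' a' \<and> wf (N t' a') \<and> 100 * t' + a' = - (100 * t + a)"
  by (auto simp: n0_def n1_def D0_def)

lemma delta_N: "wf (N t' a') \<Longrightarrow> \<exists>u b. ad (N t D0) (N t' a') = N u b \<and> wf (N u b) \<and> 100 * u + b = 100 * t + (100 * t' + a')"
  by (auto simp: h0_def D0_def)

text \<open>Three of the four increments that \<open>mk\<close> attaches to a level; the remaining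
  one, a negative sign without decrement, is plain \<open>okz_sh\<close>.\<close>

lemma step_slack:
  assumes "wf (N t a)" "okz z x"
  shows "okz (sh (neg (N t a)) z) (x - (100 * t + a))"
    "okz (sh (ad (N d D0) (neg (N t a))) z) (x + 100 * d - (100 * t + a))"
    "okz (sh (ad (N d D0) (N t a)) z) (x + 100 * d + (100 * t + a))"
proof -
  obtain t' a' where n: "neg (N t a) = N t' a'" "wf (N t' a')" "100 * t' + a' = - (100 * t + a)"
    using leaf_N[OF assms(1)] by blast
  have "x - (100 * t + a) = x + (100 * t' + a')" using n(3) by simp
  then show "okz (sh (neg (N t a)) z) (x - (100 * t + a))"
    unfolding n(1) by (simp only: okz_sh[OF n(2) assms(2)])
  obtain u b where u: "ad (N d D0) (N t' a') = N u b" "wf (N u b)" "100 * u + b = 100 * d + (100 * t' + a')"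
    using delta_N[OF n(2)] by blast
  have "x + 100 * d - (100 * t + a) = x + (100 * u + b)" using n(3) u(3) by simp
  then show "okz (sh (ad (N d D0) (neg (N t a))) z) (x + 100 * d - (100 * t + a))"
    unfolding n(1) u(1) by (simp only: okz_sh[OF u(2) assms(2)])
  obtain u' b' where u': "ad (N d D0) (N t a) = N u' b'" "wf (N u' b')" "100 * u' + b' = 100 * d + (100 * t + a)"
    using delta_N[OF assms(1)] by blast
  have "x + 100 * d + (100 * t + a) = x + (100 * u' + b')" using u'(3) by simp
  then show "okz (sh (ad (N d D0) (N t a)) z) (x + 100 * d + (100 * t + a))"
    unfolding u'(1) by (simp only: okz_sh[OF u'(2) assms(2)])
qed

text \<open>The value of the functional for a completion \<open>ss\<close> of the fixed signs,
  without the row-0 part of the latter, which has already been charged to the slack.\<close>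

definition bound :: "nat \<Rightarrow> vec \<Rightarrow> vec list \<Rightarrow> bool list \<Rightarrow> int" where
  "bound n g cs ss = li 0 cs ss + (\<Sum>i<n. \<bar>leaves g ! i + li (Suc i) cs ss\<bar>)"

lemma bound_Cons:
  assumes "wf (B (N t a) v)" "same v g" "wf g" "length (leaves g) = n"
  shows "bound n g (B (N t a) v # cs) (s # ss) =
    (if s then 100 * t + a else - (100 * t + a)) + bound n (ad g (sgn_vec s v)) cs ss"
  unfolding bound_def using sgn_vec(4)[of v g n _ s] assms by (auto simp: algebra_simps)

text \<open>The sum of slack and remaining decrements is the room that is left; a \<open>Del\<close>
  level only moves its decrement from the second term to the first. The induction starts trivially
  because \<open>CE\<close> is false.\<close>

lemma dfs_sound:
  assumes "dfs (mk cs d) z g" "tok n cs d" "okz z x" "wf g" "length (leaves g) = n"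
    "\<forall>c\<in>set cs. col n g c" "length ss = length cs"
  shows "bound n g cs ss \<le> x + rad d"
  using assms
proof (induction cs arbitrary: d z g x ss)
  case Nil
  then show ?case by simp
next
  case (Cons c cs)
  obtain t a v where c: "c = B (N t a) v" "wf (N t a)" "wf v" "same v g" "length (leaves v) = n"
    using Cons.prems(6) by (auto simp: col_def)
  obtain s ss' where ss: "ss = s # ss'" "length ss' = length cs"
    using Cons.prems(7) by (cases ss) auto
  let ?g = "ad g (sgn_vec s v)"
  note g = sgn_vec[OF c(4,3) Cons.prems(4,5), where s = s]
  have cols: "\<forall>c\<in>set cs. col n ?g c"
    using Cons.prems(6) col_same[OF _ g(2)] by simp
  have b: "bound n g (c # cs) ss = (if s then 100 * t + a else - (100 * t + a)) + bound n ?g cs ss'"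
    unfolding ss c(1) by (rule bound_Cons) (use c Cons.prems in auto)
  \<comment> \<open>A child is closed either by the search below it or by its own test; the kinds of
    levels differ only in the slack they pass on.\<close>
  have main: "bound n ?g cs ss' \<le> y + rad d'"
    if "tok n cs d'" "okz z' y" "dfs (mk cs d') z' ?g \<or> (tailb n cs (rad d') \<and> acc ?g z' \<noteq> Neg)" for d' z' y
    using that(3)
  proof
    assume "dfs (mk cs d') z' ?g"
    then show ?thesis by (rule Cons.IH) (use that g cols ss in auto)
  next
    assume "tailb n cs (rad d') \<and> acc ?g z' \<noteq> Neg"
    then show ?thesis unfolding bound_def using tested[OF g(1,3) that(2)] ss(2) by blast
  qed
  note st = step_slack[OF c(2) Cons.prems(3)] okz_sh[OF c(2) Cons.prems(3)]
  show ?case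
  proof (cases d)
    case (Skip d')
    have tok: "tok n cs d'" using Cons.prems(2) Skip by simp_all
    show ?thesis
    proof (cases s)
      case True
      have "dfs (mk cs d') (sh (neg (N t a)) z) ?g \<or> (tailb n cs (rad d') \<and> acc ?g (sh (neg (N t a)) z) \<noteq> Neg)"
        using Cons.prems(1) True unfolding Skip c(1)
        by (auto simp: sgn_vec_def simp del: neg.simps(1) ad.simps sh.simps acc.simps)
      from main[OF tok st(1) this] show ?thesis unfolding b Skip using True by simp
    next
      case False
      have "dfs (mk cs d') (sh (N t a) z) ?g \<or> (tailb n cs (rad d') \<and> acc ?g (sh (N t a) z) \<noteq> Neg)"
        using Cons.prems(1) False unfolding Skip c(1)
        by (auto simp: sgn_vec_def simp del: neg.simps(1) ad.simps sh.simps acc.simps)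
      from main[OF tok st(4) this] show ?thesis unfolding b Skip using False by simp
    qed
  next
    case (Tst d')
    have tok: "tok n cs d'" and tb: "tailb n cs (rad d')" using Cons.prems(2) Tst by simp_all
    show ?thesis
    proof (cases s)
      case True
      have "dfs (mk cs d') (sh (neg (N t a)) z) ?g \<or> (tailb n cs (rad d') \<and> acc ?g (sh (neg (N t a)) z) \<noteq> Neg)"
        using Cons.prems(1) True tb unfolding Tst c(1)
        by (auto simp: sgn_vec_def simp del: neg.simps(1) ad.simps sh.simps acc.simps)
      from main[OF tok st(1) this] show ?thesis unfolding b Tst using True by simp
    next
      case False
      have "dfs (mk cs d') (sh (N t a) z) ?g \<or> (tailb n cs (rad d') \<and> acc ?g (sh (N t a) z) \<noteq> Neg)"
        using Cons.prems(1) False tb unfolding Tst c(1)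
        by (auto simp: sgn_vec_def simp del: neg.simps(1) ad.simps sh.simps acc.simps)
      from main[OF tok st(4) this] show ?thesis unfolding b Tst using False by simp
    qed
  next
    case (Del e d')
    have tok: "tok n cs d'" and tb: "tailb n cs (rad d')" using Cons.prems(2) Del by simp_all
    show ?thesis
    proof (cases s)
      case True
      have "dfs (mk cs d') (sh (ad (N e D0) (neg (N t a))) z) ?g \<or> (tailb n cs (rad d') \<and> acc ?g (sh (ad (N e D0) (neg (N t a))) z) \<noteq> Neg)"
        using Cons.prems(1) True tb unfolding Del c(1)
        by (auto simp: sgn_vec_def simp del: neg.simps(1) ad.simps sh.simps acc.simps)
      from main[OF tok st(2) this] show ?thesis unfolding b Del using True by simp
    next
      case False
      have "dfs (mk cs d') (sh (ad (N e D0) (N t a)) z) ?g \<or> (tailb n cs (rad d') \<and> acc ?g (sh (ad (N e D0) (N t a)) z) \<noteq> Neg)"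
        using Cons.prems(1) False tb unfolding Del c(1)
        by (auto simp: sgn_vec_def simp del: neg.simps(1) ad.simps sh.simps acc.simps)
      from main[OF tok st(3) this] show ?thesis unfolding b Del using False by simp
    qed
  qed (use Cons.prems in auto)
qed

fun allowed :: "prefix \<Rightarrow> bool list \<Rightarrow> bool" where
  "allowed PAll ss = True"
| "allowed (PBr p q) (s # ss) = allowed (if s then p else q) ss"
| "allowed p ss = False"

text \<open>A branching prefix succeeds only on a \<open>CK\<close> level and so forces a
  \<open>Skip\<close> of the plan; no test intervenes before the prefix is used up.\<close>

lemma dfp_sound:
  assumes "dfp p (mk cs d) z g" "tok n cs d" "okz z x" "wf g" "length (leaves g) = n"
    "\<forall>c\<in>set cs. col n g c" "length ss = length cs" "allowed p ss"
  shows "bound n g cs ss \<le> x + rad d"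
  using assms
proof (induction p arbitrary: cs d z g x ss)
  case PAll
  then show ?case using dfs_sound by simp
next
  case (PBr p q)
  obtain v w e f k where k: "mk cs d = CK v w e f k"
    using PBr.prems(1) by (cases "mk cs d") auto
  obtain c cs' where cs: "cs = c # cs'" using k by (cases cs) auto
  obtain t a v where c: "c = B (N t a) v" "wf (N t a)" "wf v" "same v g" "length (leaves v) = n"
    using PBr.prems(6) cs by (auto simp: col_def)
  obtain d' where d: "d = Skip d'" using k unfolding cs c(1) by (cases d) auto
  obtain s ss' where ss: "ss = s # ss'" "length ss' = length cs'"
    using PBr.prems(7) cs by (cases ss) auto
  let ?g = "ad g (sgn_vec s v)"
  note g = sgn_vec[OF c(4,3) PBr.prems(4,5), where s = s]
  have cols: "\<forall>c\<in>set cs'. col n ?g c"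
    using PBr.prems(6) cs col_same[OF _ g(2)] by simp
  have b: "bound n g cs ss = (if s then 100 * t + a else - (100 * t + a)) + bound n ?g cs' ss'"
    unfolding cs ss c(1) by (rule bound_Cons) (use c PBr.prems in auto)
  note st = step_slack(1)[OF c(2) PBr.prems(3)] okz_sh[OF c(2) PBr.prems(3)]
  have tok: "tok n cs' d'" using PBr.prems(2) unfolding cs d by simp
  show ?case
  proof (cases s)
    case True
    have "dfp p (mk cs' d') (sh (neg (N t a)) z) ?g"
      using PBr.prems(1) True unfolding cs d c(1) by (simp add: sgn_vec_def)
    then have "bound n ?g cs' ss' \<le> x - (100 * t + a) + rad d'"
      by (rule PBr.IH(1)) (use tok st g cols ss PBr.prems(8) True in auto)
    then show ?thesis unfolding b d using True by simp
  next
    case False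
    have "dfp q (mk cs' d') (sh (N t a) z) ?g"
      using PBr.prems(1) False unfolding cs d c(1) by (simp add: sgn_vec_def)
    then have "bound n ?g cs' ss' \<le> x + (100 * t + a) + rad d'"
      by (rule PBr.IH(2)) (use tok st g cols ss PBr.prems(8) False in auto)
    then show ?thesis unfolding b d using False by simp
  qed
qed simp

fun chain :: "(vec \<times> int) list \<Rightarrow> tail" where
  "chain [] = TE"
| "chain ((c, t) # xs) = TQ c (neg c) t (chain xs)"

lemma okz_delta: "okz z x \<Longrightarrow> okz (sh (N t D0) z) (x + 100 * t)"
  using okz_sh[of t D0 z x] by (simp add: D0_def del: sh.simps)

text \<open>Since \<open>tr\<close> tests after every column, one traversal bounds the sums of all
  lengths.\<close>

lemma tr_sound:
  assumes "tr (chain xs) z v" "okz z x" "wf v" "length (leaves v) = m"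
    "\<forall>c\<in>fst ` set xs. wf c \<and> same c v" "j < length xs" "length ss = Suc j"
  shows "(\<Sum>i<m. \<bar>leaves v ! i + li i (map fst (take (Suc j) xs)) ss\<bar>)
    \<le> x + 100 * sum_list (map snd (take (Suc j) xs))"
  using assms
proof (induction xs arbitrary: z v x j ss)
  case (Cons y xs)
  obtain c t where y: "y = (c, t)" by (cases y)
  obtain s ss' where ss: "ss = s # ss'" "length ss' = j" using Cons.prems(7) by (cases ss) auto
  have c: "wf c" "same c v" using Cons.prems(5) y by auto
  let ?w = "ad v (sgn_vec s c)" and ?z = "sh (N t D0) z"
  note w = sgn_vec[OF c(2,1) Cons.prems(3,4), where s = s]
  have z: "okz ?z (x + 100 * t)" by (rule okz_delta[OF Cons.prems(2)])
  have run: "acc ?w ?z \<noteq> Neg" "tr (chain xs) ?z ?w"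
    using Cons.prems(1) unfolding y by (cases s; simp add: sgn_vec_def)+
  have eq: "(\<Sum>i<m. \<bar>leaves v ! i + li i (map fst (take (Suc j) (y # xs))) ss\<bar>) =
      (\<Sum>i<m. \<bar>leaves ?w ! i + li i (map fst (take j xs)) ss'\<bar>)"
    by (intro sum.cong refl) (use w(4) in \<open>auto simp: y ss(1) algebra_simps\<close>)
  show ?case
  proof (cases j)
    case 0
    then show ?thesis unfolding eq using acc_bound[OF w(1) z run(1)] absum_nth[OF w(3)] by (simp add: y)
  next
    case (Suc j')
    have "(\<Sum>i<m. \<bar>leaves ?w ! i + li i (map fst (take (Suc j') xs)) ss'\<bar>)
        \<le> x + 100 * t + 100 * sum_list (map snd (take (Suc j') xs))"
    proof (rule Cons.IH[OF run(2) z w(1) w(3)])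
      show "\<forall>c\<in>fst ` set xs. wf c \<and> same c ?w"
        using Cons.prems(5) same_trans[OF _ same_sym[OF w(2)]] by simp
    qed (use Cons.prems(6) Suc ss in auto)
    then show ?thesis unfolding eq using Suc by (simp add: y)
  qed
qed simp

lemma tl0_sound:
  assumes "tl0 (chain xs)" "length (leaves (fst (hd xs))) = m"
    "\<forall>c\<in>fst ` set xs. wf c \<and> same c (fst (hd xs))" "j \<le> length xs" "length ss = j"
  shows "(\<Sum>i<m. \<bar>li i (map fst (take j xs)) ss\<bar>) \<le> 100 * sum_list (map snd (take j xs))"
proof (cases j)
  case (Suc j')
  then obtain c t ys where xs: "xs = (c, t) # ys" using assms(4) by (cases xs) auto
  have c: "wf c" "length (leaves c) = m" using assms xs by auto
  have z: "okz (Z t D0) (100 * t)" by (simp add: D0_def)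
  have run: "acc c (Z t D0) \<noteq> Neg" "tr (chain ys) (Z t D0) c"
    using assms(1) unfolding xs by simp_all
  have pos: "(\<Sum>i<m. \<bar>leaves c ! i + li i (map fst (take j' ys)) us\<bar>)
      \<le> 100 * t + 100 * sum_list (map snd (take j' ys))" if us: "length us = j'" for us
  proof (cases j')
    case 0
    then show ?thesis using acc_bound[OF c(1) z run(1)] absum_nth[OF c(2)] by simp
  next
    case (Suc j'')
    show ?thesis unfolding Suc
      by (rule tr_sound[OF run(2) z c]) (use assms(3,4) xs us \<open>j = Suc j'\<close> Suc in auto)
  qed
  obtain s us where ss: "ss = s # us" "length us = j'" using assms(5) Suc by (cases ss) auto
  \<comment> \<open>If the sign of the fixed column is negative, all signs are flipped, which does
    not change the absolute value.\<close>
  have eq: "\<bar>li i (map fst (take j xs)) ss\<bar> =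
      \<bar>leaves c ! i + li i (map fst (take j' ys)) (if s then us else map Not us)\<bar>" for i
    unfolding Suc xs ss by (auto simp: li_Not)
  show ?thesis unfolding eq using pos[of "if s then us else map Not us"] ss(2)
    by (simp add: Suc xs algebra_simps)
qed simp

text \<open>The search consumes columns from the front while the check adds them from the end.
  Reversal identifies a suffix of the columns with an initial part of the chain.\<close>

lemma tails:
  assumes "tl0 (chain (rev ps))" "\<forall>c\<in>fst ` set ps. wf c \<and> same c r \<and> length (leaves c) = Suc n"
  shows "tailb n (map fst (drop k ps)) (100 * sum_list (map snd (drop k ps)))"
  unfolding tailb_def
proof (intro allI impI)
  fix ss :: "bool list" assume ss: "length ss = length (map fst (drop k ps))"
  let ?j = "length ps - k"
  have d: "rev (drop k ps) = take ?j (rev ps)" by (simp add: rev_drop)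
  have eq: "(\<Sum>i\<le>n. \<bar>li i (map fst (drop k ps)) ss\<bar>) = (\<Sum>i<Suc n. \<bar>li i (map fst (take ?j (rev ps))) (rev ss)\<bar>)"
    unfolding d[symmetric] rev_map[symmetric] lessThan_Suc_atMost
    by (subst li_rev) (use ss in auto)
  have eq': "sum_list (map snd (drop k ps)) = sum_list (map snd (take ?j (rev ps)))"
    unfolding d[symmetric] rev_map[symmetric] by simp
  show "(\<Sum>i\<le>n. \<bar>li i (map fst (drop k ps)) ss\<bar>) \<le> 100 * sum_list (map snd (drop k ps))"
  proof (cases "ps = []")
    case False
    then have hd: "fst (hd (rev ps)) \<in> fst ` set ps" by (simp add: hd_rev)
    show ?thesis unfolding eq eq'
    proof (rule tl0_sound[OF assms(1)])
      show "length (leaves (fst (hd (rev ps)))) = Suc n" using assms(2) hd by blast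
      show "\<forall>c\<in>fst ` set (rev ps). wf c \<and> same c (fst (hd (rev ps)))"
      proof
        fix c assume "c \<in> fst ` set (rev ps)"
        then have "wf c \<and> same c r" using assms(2) by auto
        moreover have "same (fst (hd (rev ps))) r" using assms(2) hd by blast
        ultimately show "wf c \<and> same c (fst (hd (rev ps)))"
          using same_trans[OF _ same_sym] by blast
      qed
    qed (use ss in auto)
  qed simp
qed

lemma okz_s0: "okz z x \<Longrightarrow> okz (s0 d z) (x - rad d)"
proof (induction d arbitrary: z x)
  case (Del t d)
  have "okz (sh (neg (N t D0)) z) (x - 100 * t)"
    using step_slack(1)[of t D0 z x] Del.prems by (simp add: D0_def del: neg.simps sh.simps)
  then show ?case using Del.IH[of "sh (neg (N t D0)) z" "x - 100 * t"]
    by (simp add: algebra_simps del: neg.simps sh.simps)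
qed auto

lemma length_13:
  assumes "length cs = 13"
  obtains c1 c2 c3 c4 c5 c6 c7 c8 c9 c10 c11 c12 c13
  where "cs = [c1, c2, c3, c4, c5, c6, c7, c8, c9, c10, c11, c12, c13]"
  using assms by (auto simp: numeral_eq_Suc length_Suc_conv)

lemma leaf_sound:
  assumes run: "leaf p (plan6 a b c d e f) (B (N t l) v # cs)"
    and n: "wf (N t l)" and v: "wf v" "length (leaves v) = n"
    and cols: "\<forall>c\<in>set cs. col n v c" and len: "length cs = 13" "length ss = 13"
    and al: "allowed p ss"
  shows "100 * t + l + bound n v cs ss \<le> 13036"
proof -
  obtain c1 c2 c3 c4 c5 c6 c7 c8 c9 c10 c11 c12 c13
    where cs: "cs = [c1, c2, c3, c4, c5, c6, c7, c8, c9, c10, c11, c12, c13]"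
    using length_13[OF len(1)] by blast
  let ?ps = "[(c8, a), (c9, b), (c10, c), (c11, d), (c12, e), (c13, f)]"
  let ?d = "plan6 a b c d e f" and ?z = "sh (neg (N t l)) (s0 (plan6 a b c d e f) (Z D130 D36))"
  have run: "tl0 (tq cs ?d TE)" "dfp p (mk cs ?d) ?z v" using run by simp_all
  have "tq cs ?d TE = chain (rev ?ps)" unfolding cs by (simp add: plan6_def)
  then have tl: "tl0 (chain (rev ?ps))" using run(1) by metis
  have good: "\<forall>c\<in>fst ` set ?ps. wf c \<and> same c (B (N t l) v) \<and> length (leaves c) = Suc n"
  proof
    fix c assume "c \<in> fst ` set ?ps"
    then have "c \<in> set cs" unfolding cs by auto
    then have "col n v c" using cols by blast
    then show "wf c \<and> same c (B (N t l) v) \<and> length (leaves c) = Suc n" by (auto simp: col_def)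
  qed
  note t = tails[OF tl good]
  \<comment> \<open>The seven suffixes are the six open columns at the \<open>Tst\<close> level and
    one column fewer after each \<open>Del\<close>, down to the empty tail.\<close>
  have tok: "tok n cs ?d"
    unfolding cs plan6_def using t[of 0] t[of 1] t[of 2] t[of 3] t[of 4] t[of 5] t[of 6]
    by (simp add: algebra_simps)
  have "okz (s0 ?d (Z D130 D36)) (13036 - rad ?d)"
    by (rule okz_s0) (simp add: D_defs)
  from step_slack(1)[OF n this] have z: "okz ?z (13036 - rad ?d - (100 * t + l))" .
  from dfp_sound[OF run(2) tok z v cols _ al] len show ?thesis by simp
qed

text \<open>\<open>dl\<close> and, below, \<open>fl\<close> follow a sign sequence through the
  trees: the former says whether it ends at a checked leaf, the latter also returns the prefix in
  force there.\<close>

fun dl :: "deltas \<Rightarrow> bool list \<Rightarrow> bool" where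
  "dl (DB x y) (b # bs) = dl (if b then x else y) bs"
| "dl (DL a b c d e f) bs = (bs = [])"
| "dl x bs = False"

lemma rt_sound:
  "rt p x ts m \<Longrightarrow> length bs = length ts \<Longrightarrow> dl x bs \<Longrightarrow>
    \<exists>a b c d e f. leaf p (plan6 a b c d e f) (mm bs ts m)"
proof (induction x arbitrary: ts m bs)
  case (DB x y)
  obtain s bs' where bs: "bs = s # bs'" using DB.prems(3) by (cases bs) auto
  then obtain t ts' where ts: "ts = t # ts'" using DB.prems(2) by (cases ts) auto
  show ?case using DB.prems DB.IH(1)[of ts' "lad m t" bs'] DB.IH(2)[of ts' m bs']
    unfolding bs ts by (cases s) auto
next
  case (DL a b c d e f)
  then have "bs = []" "ts = []" by (cases bs; auto)+
  then have "leaf p (plan6 a b c d e f) (mm bs ts m)" using DL.prems(1) by simp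
  then show ?case by blast
qed simp

fun fl :: "prefix \<Rightarrow> prefix \<Rightarrow> forest \<Rightarrow> bool list \<Rightarrow> prefix option" where
  "fl p q (FB x y) (b # bs) = fl p q (if b then x else y) bs"
| "fl p q (FP p' q' x) bs = fl p' q' x bs"
| "fl p q (FE x y) (b # bs) = (if dl (if b then x else y) bs then Some (if b then p else q) else None)"
| "fl p q x bs = None"

lemma rf_sound:
  "rf p q x ts m \<Longrightarrow> length bs = length ts \<Longrightarrow> fl p q x bs = Some r \<Longrightarrow>
    \<exists>a b c d e f. leaf r (plan6 a b c d e f) (mm bs ts m)"
proof (induction x arbitrary: p q ts m bs)
  case (FB x y)
  obtain s bs' where bs: "bs = s # bs'" using FB.prems(3) by (cases bs) auto
  then obtain t ts' where ts: "ts = t # ts'" using FB.prems(2) by (cases ts) auto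
  show ?case using FB.prems FB.IH(1)[of p q ts' "lad m t" bs'] FB.IH(2)[of p q ts' m bs']
    unfolding bs ts by (cases s) auto
next
  case (FE x y)
  obtain s bs' where bs: "bs = s # bs'" using FE.prems(3) by (cases bs) auto
  then obtain t ts' where ts: "ts = t # ts'" using FE.prems(2) by (cases ts) auto
  show ?case using FE.prems rt_sound[of p x ts' "lad m t" bs'] rt_sound[of q y ts' m bs']
    unfolding bs ts by (cases s) (auto split: if_splits)
qed auto

section \<open>The functional on deterministic strategies\<close>

definition tn :: "nat \<Rightarrow> nat \<Rightarrow> nat \<Rightarrow> int" where "tn i j k = vl (tens ! i ! j ! k)"
definition sg :: "bool \<Rightarrow> int" where "sg b = (if b then 1 else - 1)"
definition G :: "nat \<Rightarrow> bool list \<Rightarrow> bool list \<Rightarrow> int" where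
  "G i b c = (\<Sum>j<14. \<Sum>k<14. tn i j k * sg (b ! j) * sg (c ! k))"
definition F :: "bool list \<Rightarrow> bool list \<Rightarrow> int" where
  "F b c = G 0 b c + (\<Sum>i<31. \<bar>G (Suc i) b c\<bar>)"
definition strat :: "bool list \<Rightarrow> bool" where "strat b = (length b = 14 \<and> b ! 0)"

fun isN :: "vec \<Rightarrow> bool" where "isN (N t a) = (0 \<le> a \<and> a < 100)" | "isN x = False"

lemma isN: "isN x \<Longrightarrow> wf x \<and> same x (N 0 0) \<and> leaves x = [vl x]"
  by (cases x) auto

definition ref :: vec where "ref = mkv (replicate 32 (N 0 0))"

lemma tens_shape:
  "length tens = 32 \<and> list_all (\<lambda>m. length m = 14 \<and> list_all (\<lambda>r. length r = 14 \<and> list_all isN r) m) tens"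
  unfolding tens_lit by (simp add: D_defs)

lemma tens_even: "list_all (\<lambda>m. list_all even (foldl vdiff (ints (hd m)) (map ints (tl m)))) tens"
  unfolding tens_lit ints_def by (simp add: D_defs M_defs vdiff_simps)

lemma tens_swap: "map (\<lambda>m. map (\<lambda>k. map (\<lambda>r. r ! k) m) [0,1,2,3,4,5,6,7,8,9,10,11,12,13]) tens = tens"
  unfolding tens_lit by (simp only: list.map nth_lit)

definition refl_ix :: "nat list" where "refl_ix = [0, 1, 2, 5, 4, 3, 9, 8, 7, 6, 10, 13, 12, 11]"
lemma perm_refl_lit:
  "perm refl_ix [x0,x1,x2,x3,x4,x5,x6,x7,x8,x9,x10,x11,x12,x13] = [x0,x1,x2,x5,x4,x3,x9,x8,x7,x6,x10,x13,x12,x11]"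
  by (simp add: perm_def refl_ix_def)

text \<open>The first 31 matrices are mapped to one another literally, so this is an equality of
  terms that needs no arithmetic. The last one changes its sign and is compared by values in
  \<open>tens_rot31\<close> and \<open>tens_refl31\<close>.\<close>

lemma tens_rot:
  "map (permute rot) (take 31 tens) = map ((!) tens) [0, 1, 3, 4, 5, 2, 7, 8, 9, 6, 11, 12, 13, 10, 15, 16, 17, 14, 19, 20, 21, 18, 23, 24, 25, 22, 27, 28, 29, 26, 31]"
  unfolding tens_lit by (simp only: list.map nth_lit permute_def perm_lit take_drop_expand)
lemma tens_refl:
  "map (permute refl_ix) (take 31 tens) = map ((!) tens) [0, 1, 2, 5, 4, 3, 9, 8, 7, 6, 10, 13, 12, 11, 17, 16, 15, 14, 21, 20, 19, 18, 22, 25, 24, 23, 29, 28, 27, 26, 30]"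
  unfolding tens_lit by (simp only: list.map nth_lit permute_def perm_refl_lit take_drop_expand)
lemma tens_rot31:
  "map (map vl) (permute rot (tens ! 31)) = map (map (\<lambda>x. - vl x)) (tens ! 30)"
  unfolding tens_lit by (simp only: list.map nth_lit permute_def perm_lit) (simp add: D_defs M_defs)
lemma tens_refl31:
  "map (map vl) (permute refl_ix (tens ! 31)) = map (map (\<lambda>x. - vl x)) (tens ! 31)"
  unfolding tens_lit by (simp only: list.map nth_lit permute_def perm_refl_lit) (simp add: D_defs M_defs)

lemma tens_props:
  "length tens = 32" "i < 32 \<Longrightarrow> length (tens ! i) = 14"
  "i < 32 \<Longrightarrow> j < 14 \<Longrightarrow> length (tens ! i ! j) = 14"
  "i < 32 \<Longrightarrow> j < 14 \<Longrightarrow> k < 14 \<Longrightarrow> isN (tens ! i ! j ! k)"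
  using tens_shape by (auto simp: list_all_length)

lemma upt_32: "[0..<32] = [0, 1, 2, 3, 4, 5, 6, 7, 8, 9, 10, 11, 12, 13, 14, 15, 16, 17, 18, 19, 20, 21, 22, 23, 24, 25, 26, 27, 28, 29, 30, 31]" by code_simp

lemma mkv_props:
  assumes "\<forall>i<32. isN (x ! i)"
  shows "wf (mkv x)" "same (mkv x) ref" "leaves (mkv x) = map (\<lambda>i. vl (x ! i)) [0..<32]"
    "\<exists>t a v. mkv x = B (N t a) v"
proof -
  have "isN (x ! 0)" using assms by simp
  then obtain t a where "x ! 0 = N t a" by (cases "x ! 0") auto
  then show "\<exists>t a v. mkv x = B (N t a) v" by (simp add: mkv_def)
  have 1: "wf (x ! i)" "same (x ! i) (N 0 0)" "leaves (x ! i) = [vl (x ! i)]" if "i < 32" for i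
    using isN assms that by blast+
  show "wf (mkv x)" unfolding mkv_def by (simp add: 1)
  show "same (mkv x) ref" unfolding mkv_def ref_def by (simp add: 1)
  show "leaves (mkv x) = map (\<lambda>i. vl (x ! i)) [0..<32]"
    unfolding mkv_def by (simp add: 1 upt_32)
qed

definition good :: "vec list \<Rightarrow> bool" where
  "good m = (length m = 14 \<and> (\<forall>c\<in>set m. wf c \<and> same c ref))"

lemma order_less: "k < 14 \<Longrightarrow> order ! k < 14"
  by (auto simp: order_def less_Suc_eq numeral_eq_Suc)

lemma length_order: "length order = 14" by (simp add: order_def)

lemma row_props:
  assumes "j < 14"
  shows "good (row j)" "k < 14 \<Longrightarrow> i < 32 \<Longrightarrow> leaves (row j ! k) ! i = tn i j (order ! k)"
proof -
  have *: "\<forall>i<32. isN (map (\<lambda>r. r ! (order ! k)) (map (\<lambda>m. m ! j) tens) ! i)" if "k < 14" for k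
    using tens_props assms order_less[OF that] by simp
  have r: "row j ! k = mkv (map (\<lambda>r. r ! (order ! k)) (map (\<lambda>m. m ! j) tens))" if "k < 14" for k
    using that by (simp add: row_def columns_def length_order)
  show "good (row j)" unfolding good_def
  proof
    show l: "length (row j) = 14" by (simp add: row_def columns_def length_order)
    show "\<forall>c\<in>set (row j). wf c \<and> same c ref"
      unfolding all_set_conv_all_nth l using r mkv_props(1,2)[OF *] by simp
  qed
  show "leaves (row j ! k) ! i = tn i j (order ! k)" if "k < 14" "i < 32"
    unfolding r[OF that(1)] mkv_props(3)[OF *[OF that(1)]] using that tens_props assms
    by (simp add: tn_def)
qed

lemma vl_enc: "vl (enc x) = x" "isN (enc x)" by (simp_all add: enc_def)

lemma foldl_vdiff:
  "\<forall>y\<in>set ys. length y = length x \<Longrightarrow>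
    length (foldl vdiff x ys) = length x \<and> (k < length x \<longrightarrow> foldl vdiff x ys ! k = x ! k - (\<Sum>y\<leftarrow>ys. y ! k))"
  by (induction ys arbitrary: x) (auto simp: vdiff_def)

lemma sum_14: "(\<Sum>j<14. f j) = f 0 + f 1 + f 2 + f 3 + f 4 + f 5 + f 6 + f 7 + f 8 + f 9 + f 10 + f 11 + f 12 + f (13::nat)"
  for f :: "nat \<Rightarrow> int"
  by (simp add: numeral_eq_Suc)

lemma base_props:
  shows "good base"
    "k < 14 \<Longrightarrow> i < 32 \<Longrightarrow> 2 * leaves (base ! k) ! i = 2 * tn i 0 (order ! k) - (\<Sum>j<14. tn i j (order ! k))"
proof -
  have d: "length (foldl vdiff (ints (hd m)) (map ints (tl m))) = 14 \<and>
      foldl vdiff (ints (hd m)) (map ints (tl m)) ! k = 2 * vl (m ! 0 ! k) - (\<Sum>j<14. vl (m ! j ! k)) \<and>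
      even (foldl vdiff (ints (hd m)) (map ints (tl m)) ! k)"
    if m: "m = tens ! i" "i < 32" "k < 14" for m i k
  proof -
    have l: "length m = 14" "\<forall>j<14. length (m ! j) = 14" using tens_props m by auto
    then have hd: "hd m = m ! 0" and ne: "m \<noteq> []" by (cases m; auto)+
    have tl: "\<forall>r\<in>set (tl m). length r = 14"
      using l by (metis in_set_conv_nth list.set_sel(2) ne)
    note f = foldl_vdiff[of "map ints (tl m)" "ints (hd m)" k]
    have L: "length (ints (hd m)) = 14" using l hd by (simp add: ints_def)
    have s: "(\<Sum>y\<leftarrow>map ints (tl m). y ! k) = (\<Sum>r\<leftarrow>tl m. vl (r ! k))"
      using tl m(3) by (auto simp: ints_def o_def intro!: arg_cong[where f = sum_list])
    have s': "(\<Sum>r\<leftarrow>m. vl (r ! k)) = (\<Sum>j<14. vl (m ! j ! k))"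
      by (simp add: sum_list_sum_nth l atLeast0LessThan)
    have "(\<Sum>r\<leftarrow>m. vl (r ! k)) = vl (m ! 0 ! k) + (\<Sum>r\<leftarrow>tl m. vl (r ! k))"
      using ne hd by (cases m) auto
    moreover have "ints (hd m) ! k = vl (m ! 0 ! k)" using l hd m by (simp add: ints_def)
    moreover have "\<forall>y\<in>set (map ints (tl m)). length y = length (ints (hd m))"
      using tl L by (auto simp: ints_def)
    moreover have "even (foldl vdiff (ints (hd m)) (map ints (tl m)) ! k)"
      if "length (foldl vdiff (ints (hd m)) (map ints (tl m))) = 14"
      using tens_even m that tens_props(1) by (simp add: list_all_length)
    ultimately show ?thesis using f L s s' m by auto
  qed
  have b: "base ! k = mkv (map (\<lambda>r. r ! (order ! k)) (map brow tens))" if "k < 14" for k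
    using that by (simp add: base_def columns_def length_order)
  have e: "map (\<lambda>r. r ! (order ! k)) (map brow tens) ! i =
      enc ((2 * tn i 0 (order ! k) - (\<Sum>j<14. tn i j (order ! k))) div 2) \<and>
      even (2 * tn i 0 (order ! k) - (\<Sum>j<14. tn i j (order ! k)))" if "k < 14" "i < 32" for i k
  proof -
    let ?f = "foldl vdiff (ints (hd (tens ! i))) (map ints (tl (tens ! i)))"
    have D: "length ?f = 14" "?f ! (order ! k) = 2 * tn i 0 (order ! k) - (\<Sum>j<14. tn i j (order ! k))"
      "even (?f ! (order ! k))"
      using d[OF refl that(2) order_less[OF that(1)]] unfolding tn_def by auto
    have "map (\<lambda>r. r ! (order ! k)) (map brow tens) ! i = map (\<lambda>x. enc (x div 2)) ?f ! (order ! k)"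
      using that tens_props(1) by (simp add: brow_def halves_def)
    also have "\<dots> = enc (?f ! (order ! k) div 2)"
      using D(1) order_less[OF that(1)] by simp
    finally show ?thesis using D(2,3) by simp
  qed
  have *: "\<forall>i<32. isN (map (\<lambda>r. r ! (order ! k)) (map brow tens) ! i)" if "k < 14" for k
    using e[OF that] vl_enc(2) by simp
  show "good base" unfolding good_def
  proof
    show l: "length base = 14" by (simp add: base_def columns_def length_order)
    show "\<forall>c\<in>set base. wf c \<and> same c ref"
      unfolding all_set_conv_all_nth l using b mkv_props(1,2)[OF *] by simp
  qed
  show "2 * leaves (base ! k) ! i = 2 * tn i 0 (order ! k) - (\<Sum>j<14. tn i j (order ! k))"
    if "k < 14" "i < 32"
    unfolding b[OF that(1)] mkv_props(3)[OF *[OF that(1)]]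
    using e[OF that] that by (simp add: vl_enc)
qed

lemma length_leaves_ref: "length (leaves ref) = 32" by (simp add: ref_def mkv_def)

lemma lad_props:
  assumes "good m" "good m'"
  shows "good (lad m m')"
    "k < 14 \<Longrightarrow> i < 32 \<Longrightarrow> leaves (lad m m' ! k) ! i = leaves (m ! k) ! i + leaves (m' ! k) ! i"
proof -
  have l: "length x = length y \<Longrightarrow> lad x y = map2 ad x y" for x y
    by (induction x y rule: list_induct2) auto
  have n: "lad m m' ! k = ad (m ! k) (m' ! k)" if "k < 14" for k
    using assms that l[of m m'] by (simp add: good_def)
  have mm: "wf (m ! k)" "same (m ! k) ref" "wf (m' ! k)" "same (m' ! k) ref" if "k < 14" for k
    using assms that by (auto simp: good_def)
  have s: "same (m ! k) (m' ! k)" if "k < 14" for k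
    using same_trans[OF mm(2)[OF that] same_sym[OF mm(4)[OF that]]] .
  note a = ad_sound[OF s mm(1) mm(3)]
  have L: "length (lad m m') = 14" using assms l[of m m'] by (simp add: good_def)
  show "good (lad m m')" unfolding good_def
  proof
    show "\<forall>c\<in>set (lad m m'). wf c \<and> same c ref"
      unfolding all_set_conv_all_nth L
    proof (intro allI impI)
      fix k :: nat assume k: "k < 14"
      have "same (ad (m ! k) (m' ! k)) ref"
        by (rule same_trans[OF _ mm(2)[OF k]]) (use a[OF k k k] in blast)
      then show "wf (lad m m' ! k) \<and> same (lad m m' ! k) ref"
        unfolding n[OF k] using a[OF k k k] by blast
    qed
  qed (rule L)
  show "leaves (lad m m' ! k) ! i = leaves (m ! k) ! i + leaves (m' ! k) ! i" if "k < 14" "i < 32"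
    unfolding n[OF that(1)] using a[OF that(1) that(1) that(1)] same_length[OF mm(2)[OF that(1)]]
      same_length[OF mm(4)[OF that(1)]] length_leaves_ref that by simp
qed

lemma mm_props:
  assumes "good m" "\<forall>j\<in>set js. j < 14" "length bs = length js"
  shows "good (mm bs (map row js) m) \<and> (\<forall>k<14. \<forall>i<32. leaves (mm bs (map row js) m ! k) ! i =
      leaves (m ! k) ! i + (\<Sum>(b, j)\<leftarrow>zip bs js. if b then tn i j (order ! k) else 0))"
  using assms
proof (induction js arbitrary: bs m)
  case (Cons j js)
  obtain b bs' where bs: "bs = b # bs'" "length bs' = length js" using Cons.prems(3) by (cases bs) auto
  have j: "j < 14" using Cons.prems by simp
  show ?case
  proof (cases b)
    case True
    note l = lad_props[OF Cons.prems(1) row_props(1)[OF j]]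
    show ?thesis using Cons.IH[OF l(1) _ bs(2)] Cons.prems(2) l(2) row_props(2)[OF j] True
      by (simp add: bs)
  next
    case False
    then show ?thesis using Cons.IH[OF Cons.prems(1) _ bs(2)] Cons.prems(2) by (simp add: bs)
  qed
qed simp

definition seq :: "nat list" where "seq = [10, 11, 12, 13, 6, 7, 8, 9, 1, 2, 3, 4, 5]"
text \<open>Signs of the second party in the order in which the trees branch; \<open>cpath\<close>
  lists those of the third party in the order of the search. The trivial setting, whose sign is
  fixed, is left out of both.\<close>

definition path :: "bool list \<Rightarrow> bool list" where "path b = map ((!) b) seq"
definition cpath :: "bool list \<Rightarrow> bool list" where "cpath c = map ((!) c) (tl order)"

lemma li_13: "length cs = 13 \<Longrightarrow> li i cs (cpath c) =
    (\<Sum>k<13. sg (c ! (order ! Suc k)) * leaves (cs ! k) ! i)"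
  by (elim length_13) (simp add: cpath_def order_def sg_def numeral_eq_Suc)

lemma checked:
  assumes rf: "rf PNone PNone forest (map row seq) base" and b: "strat b" and c: "strat c"
    and fl: "fl PNone PNone forest (path b) = Some r" and al: "allowed r (cpath c)"
  shows "F b c \<le> 26072"
proof -
  let ?m = "mm (path b) (map row seq) base"
  obtain x1 x2 x3 x4 x5 x6 where leaf: "leaf r (plan6 x1 x2 x3 x4 x5 x6) ?m"
    using rf_sound[OF rf _ fl] by (auto simp: path_def)
  have m: "good ?m" and lv: "\<And>k i. k < 14 \<Longrightarrow> i < 32 \<Longrightarrow> leaves (?m ! k) ! i =
      leaves (base ! k) ! i + (\<Sum>(b, j)\<leftarrow>zip (path b) seq. if b then tn i j (order ! k) else 0)"
    using mm_props[OF base_props(1), of seq "path b"] by (auto simp: path_def seq_def)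
  \<comment> \<open>A nontrivial row has weight -1/2 in \<open>base\<close> and gains 1 if its sign
    is positive, so in either case it ends with half its sign.\<close>
  have val: "2 * leaves (?m ! k) ! i = (\<Sum>j<14. tn i j (order ! k) * sg (b ! j))" if "k < 14" "i < 32" for k i
  proof -
    have sg_b0: "sg (b ! 0) = 1" using b by (simp add: strat_def sg_def)
    have if_sg: "(if q then 2 * t else 0) = t + t * sg q" for q and t :: int by (simp add: sg_def)
    have "2 * leaves (?m ! k) ! i = 2 * leaves (base ! k) ! i
        + 2 * (\<Sum>(b, j)\<leftarrow>zip (path b) seq. if b then tn i j (order ! k) else 0)"
      using lv[OF that] by simp
    also have "\<dots> = 2 * tn i 0 (order ! k) - (\<Sum>j<14. tn i j (order ! k))
        + (\<Sum>j\<leftarrow>seq. if b ! j then 2 * tn i j (order ! k) else 0)"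
      unfolding base_props(2)[OF that] by (simp add: path_def seq_def)
    also have "\<dots> = (\<Sum>j<14. tn i j (order ! k) * sg (b ! j))"
      unfolding sum_14 if_sg using sg_b0 by (simp add: seq_def)
    finally show ?thesis .
  qed
  obtain c0 cs where mc: "?m = c0 # cs" "length cs = 13"
    using m by (cases ?m) (auto simp: good_def)
  have wf: "\<forall>x\<in>set ?m. wf x \<and> same x ref" using m by (simp add: good_def)
  have shape: "\<exists>t a v. x = B (N t a) v" if sr: "same x ref" for x
  proof -
    obtain y z where x: "x = B y z" using sr by (cases x) (auto simp: ref_def mkv_def)
    then have "same y (N 0 0)" using sr x by (simp add: ref_def mkv_def)
    then show ?thesis unfolding x by (cases y) auto
  qed
  obtain t l v where c0: "c0 = B (N t l) v" using shape wf mc(1) by force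
  have w0: "wf (N t l)" "wf v" "same (B (N t l) v) ref" using wf mc(1) c0 by auto
  have lenv: "length (leaves v) = 31" using same_length[OF w0(3)] length_leaves_ref by simp
  have cols: "\<forall>x\<in>set cs. col 31 v x"
  proof
    fix x assume "x \<in> set cs"
    then have x: "wf x" "same x ref" using wf mc(1) by auto
    obtain t' l' v' where x': "x = B (N t' l') v'" using shape[OF x(2)] by blast
    have "same x (B (N t l) v)" using same_trans[OF x(2) same_sym[OF w0(3)]] .
    then have "same v' v" unfolding x' by simp
    then show "col 31 v x" unfolding col_def using x x' same_length lenv by fastforce
  qed
  have S: "(\<Sum>k<14. sg (c ! (order ! k)) * (2 * leaves (?m ! k) ! i)) = G i b c" if "i < 32" for i
  proof -
    have "(\<Sum>k<14. sg (c ! (order ! k)) * (2 * leaves (?m ! k) ! i)) =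
        (\<Sum>k<14. sg (c ! (order ! k)) * (\<Sum>j<14. tn i j (order ! k) * sg (b ! j)))"
      using val that by simp
    also have "\<dots> = (\<Sum>k<14. sg (c ! k) * (\<Sum>j<14. tn i j k * sg (b ! j)))"
      unfolding sum_14[of "\<lambda>k. sg (c ! (order ! k)) * _ k"] sum_14[of "\<lambda>k. sg (c ! k) * _ k"]
      by (simp add: order_def)
    also have "\<dots> = G i b c" unfolding G_def
      by (subst sum.swap) (simp add: sum_distrib_left mult.commute mult.left_commute)
    finally show ?thesis .
  qed
  have H: "2 * (leaves c0 ! i + li i cs (cpath c)) = G i b c" if "i < 32" for i
  proof -
    have "(\<Sum>k<14. sg (c ! (order ! k)) * leaves (?m ! k) ! i) =
        sg (c ! (order ! 0)) * leaves (?m ! 0) ! i + (\<Sum>k<13. sg (c ! (order ! Suc k)) * leaves (?m ! Suc k) ! i)"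
      using sum.lessThan_Suc_shift[of "\<lambda>k. sg (c ! (order ! k)) * leaves (?m ! k) ! i" 13] by simp
    moreover have "sg (c ! (order ! 0)) = 1" using c by (simp add: order_def strat_def sg_def)
    ultimately have "leaves c0 ! i + li i cs (cpath c) = (\<Sum>k<14. sg (c ! (order ! k)) * leaves (?m ! k) ! i)"
      unfolding li_13[OF mc(2)] mc(1) by simp
    then have "2 * (leaves c0 ! i + li i cs (cpath c)) = (\<Sum>k<14. sg (c ! (order ! k)) * (2 * leaves (?m ! k) ! i))"
      by (simp add: sum_distrib_left mult.left_commute)
    then show ?thesis using S[OF that] by simp
  qed
  have "100 * t + l + bound 31 v cs (cpath c) \<le> 13036"
    by (rule leaf_sound[OF leaf[unfolded mc(1) c0] w0(1,2) lenv cols mc(2) _ al])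
      (simp add: cpath_def order_def)
  moreover have dbl: "(\<Sum>i<31. \<bar>2 * f i\<bar>) = 2 * (\<Sum>i<31. \<bar>f i\<bar>)" for f :: "nat \<Rightarrow> int"
    by (simp add: sum_distrib_left abs_mult)
  ultimately have "2 * (100 * t + l + li 0 cs (cpath c)) + (\<Sum>i<31. \<bar>2 * (leaves v ! i + li (Suc i) cs (cpath c))\<bar>) \<le> 26072"
    unfolding bound_def by (simp only: dbl) simp
  moreover have "2 * (100 * t + l + li 0 cs (cpath c)) = G 0 b c"
    using H[of 0] by (simp add: c0)
  moreover have "2 * (leaves v ! i + li (Suc i) cs (cpath c)) = G (Suc i) b c" if "i < 31" for i
    using H[of "Suc i"] that by (simp add: c0)
  ultimately show ?thesis unfolding F_def by simp
qed

section \<open>Orbits of strategies and completeness of the cases\<close>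

text \<open>Distinguishes the six orbits of sign patterns on a 4-cycle under its dihedral group: no
  positive sign, one, two adjacent, two opposite, three, four.\<close>

definition pick :: "bool \<Rightarrow> bool \<Rightarrow> bool \<Rightarrow> bool \<Rightarrow> 'a \<Rightarrow> 'a \<Rightarrow> 'a \<Rightarrow> 'a \<Rightarrow> 'a \<Rightarrow> 'a \<Rightarrow> 'a" where
  "pick x y z w a0 a1 a2 a3 a4 a5 =
    (if x then if y then if z then if w then a5 else a4 else if w then a4 else a2
               else if z then if w then a4 else a3 else if w then a2 else a1
     else if y then if z then if w then a4 else a2 else if w then a3 else a1
          else if z then if w then a2 else a1 else if w then a1 else a0)"

fun pre :: "bool list \<Rightarrow> prefix" where
  "pre (p # x # y # z # w # xs) = (if p then pick x y z w pre6 pre7 pre8 pre9 pre10 pre11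
     else pick x y z w pre0 pre1 pre2 pre3 pre4 pre5)"
| "pre xs = PNone"

text \<open>Numbers the orbits of the first five signs in search order: the sign of setting 1, which
  the group fixes, and the pattern on the ring 10--13. Comparing keys instead of strategies keeps
  the comparison invariant.\<close>

fun key :: "bool list \<Rightarrow> nat" where
  "key (p # x # y # z # w # xs) = (if p then pick x y z w 6 7 8 9 10 11 else pick x y z w 0 1 2 3 4 5)"
| "key xs = 0"

lemma allowed_pre:
  "key (p # x # y # z # w # xs) \<le> key (p' # x' # y' # z' # w' # xs') \<Longrightarrow>
    allowed (pre (p # x # y # z # w # xs)) (p' # x' # y' # z' # w' # xs')"
  by (cases p'; cases x'; cases y'; cases z'; cases w')
    (auto simp: pick_def pre_defs split: if_splits)

lemma path_lit: "path [x0,x1,x2,x3,x4,x5,x6,x7,x8,x9,x10,x11,x12,x13] = [x10,x11,x12,x13,x6,x7,x8,x9,x1,x2,x3,x4,x5]"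
  by (simp add: path_def seq_def)
lemma cpath_lit: "cpath [x0,x1,x2,x3,x4,x5,x6,x7,x8,x9,x10,x11,x12,x13] = [x1,x10,x11,x12,x13,x8,x9,x6,x7,x5,x2,x3,x4]"
  by (simp add: cpath_def order_def)

definition look :: "bool list \<Rightarrow> prefix option" where "look = fl PNone PNone forest"

text \<open>\<open>search\<close> looks for a symmetry that maps \<open>b\<close> to a case of \<open>forest\<close>; the successive
  permutations of \<open>words\<close> run through all eight elements of the dihedral group.\<close>

definition words :: "nat list list" where "words = [rot, rot, rot, refl_ix, rot, rot, rot]"

fun search :: "nat list list \<Rightarrow> bool list \<Rightarrow> bool" where
  "search [] b = (look (path b) = Some (pre (cpath b)))"
| "search (p # ps) b = (look (path b) = Some (pre (cpath b)) \<or> search ps (perm p b))"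

text \<open>Matching on the result of the lookup ends the search at the first hit, without trying
  the remaining symmetries.\<close>

fun cases_of :: "prefix option \<Rightarrow> nat list list \<Rightarrow> bool list \<Rightarrow> bool" where
  "cases_of (Some r) ps b = (r = pre (cpath b) \<or> (case ps of [] \<Rightarrow> False | p # ps \<Rightarrow> search ps (perm p b)))"
| "cases_of None [] b = False"
| "cases_of None (p # ps) b = search ps (perm p b)"

lemma search_cases: "search ps b = cases_of (look (path b)) ps b"
  by (cases ps; cases "look (path b)") auto

lemma cases_of_Some: "r = pre (cpath b) \<Longrightarrow> cases_of (Some r) ps b = True"
  by simp

fun allb :: "nat \<Rightarrow> bool list \<Rightarrow> bool" where
  "allb 0 bs = search words (True # bs)"
| "allb (Suc n) bs = (allb n (True # bs) \<and> allb n (False # bs))"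

lemma allb_con: "allb (Suc n) bs = con (allb n (True # bs)) (allb n (False # bs))"
  by (simp add: con_def)

text \<open>Turns the trees into rewrite rules for a lookup: one equation for each leaf and one
  quantified equation for each empty subtree, so that every lookup is a single step.\<close>

fun tabd :: "deltas \<Rightarrow> prefix \<Rightarrow> (bool list \<Rightarrow> prefix option) \<Rightarrow> bool" where
  "tabd (DB x y) p h = (tabd x p (\<lambda>bs. h (True # bs)) \<and> tabd y p (\<lambda>bs. h (False # bs)))"
| "tabd (DL a b c d e f) p h = (h [] = Some p)"
| "tabd DN p h = (\<forall>bs. h bs = None)"

fun tabl :: "forest \<Rightarrow> prefix \<Rightarrow> prefix \<Rightarrow> (bool list \<Rightarrow> prefix option) \<Rightarrow> bool" where
  "tabl (FB x y) p q h = (tabl x p q (\<lambda>bs. h (True # bs)) \<and> tabl y p q (\<lambda>bs. h (False # bs)))"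
| "tabl FN p q h = (\<forall>bs. h bs = None)"
| "tabl (FP p' q' x) p q h = tabl x p' q' h"
| "tabl (FE x y) p q h = (tabd x p (\<lambda>bs. h (True # bs)) \<and> tabd y q (\<lambda>bs. h (False # bs)))"

lemma tabd_dl: "(\<And>bs. h bs = (if dl x bs then Some p else None)) \<Longrightarrow> tabd x p h"
  by (induction x arbitrary: h) auto
lemma tabl_fl: "(\<And>bs. h bs = fl p q f bs) \<Longrightarrow> tabl f p q h"
proof (induction f arbitrary: p q h)
  case (FE x y)
  then show ?case by (auto intro!: tabd_dl)
qed auto

lemma look_table: "tabl forest PNone PNone look"
  by (rule tabl_fl) (simp add: look_def)
lemmas look_rules = look_table[unfolded forest_def for_defs tabl.simps tabd.simps]
lemma if_lit: "(if True then x else y) = x" "(if False then x else y) = y" by simp_all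

text \<open>Runs through all 2^13 strategies of the second party by table lookups, without
  arithmetic.\<close>

lemma covered: "allb 13 []"
  by (simp only: numeral_eq_Suc pred_numeral_simps pred_num One_nat_def allb_con allb.simps(1) words_def search_cases
      path_lit cpath_lit look_rules cases_of.simps(2,3)
      cases_of_Some perm_lit perm_refl_lit pre.simps(1) pick_def if_lit con_simps)

section \<open>Invariance of the functional\<close>

text \<open>Reindexing both sums by \<open>p\<close> moves the permutation from the strategies to
  the coefficients.\<close>

lemma G_perm:
  assumes p: "distinct p" "set p = {..<14}" "length p = 14"
    and t: "\<And>j k. j < 14 \<Longrightarrow> k < 14 \<Longrightarrow> tn i' j k = e * tn i (p ! j) (p ! k)"
    and b: "strat b" "strat c"
  shows "G i' (perm p b) (perm p c) = e * G i b c"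
proof -
  have n: "perm p b ! j = b ! (p ! j)" "perm p c ! j = c ! (p ! j)" if "j < 14" for j
    using that p(3) by (simp_all add: perm_def)
  have bij: "bij_betw ((!) p) {..<14} {..<14}"
    using bij_betw_nth[OF p(1)] p by simp
  have "G i' (perm p b) (perm p c) =
      (\<Sum>j<14. \<Sum>k<14. e * (tn i (p ! j) (p ! k) * sg (b ! (p ! j)) * sg (c ! (p ! k))))"
    unfolding G_def by (intro sum.cong refl) (simp add: t n)
  also have "\<dots> = e * (\<Sum>j<14. \<Sum>k<14. tn i (p ! j) (p ! k) * sg (b ! (p ! j)) * sg (c ! (p ! k)))"
    by (simp add: sum_distrib_left)
  also have "(\<Sum>j<14. \<Sum>k<14. tn i (p ! j) (p ! k) * sg (b ! (p ! j)) * sg (c ! (p ! k))) =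
      (\<Sum>j<14. \<Sum>k<14. tn i (p ! j) k * sg (b ! (p ! j)) * sg (c ! k))"
    by (intro sum.cong refl sum.reindex_bij_betw[OF bij])
  also have "\<dots> = (\<Sum>j<14. \<Sum>k<14. tn i j k * sg (b ! j) * sg (c ! k))"
    by (rule sum.reindex_bij_betw[OF bij, of "\<lambda>j. \<Sum>k<14. tn i j k * sg (b ! j) * sg (c ! k)"])
  finally show ?thesis unfolding G_def .
qed

lemma permute_nth:
  assumes "length p = 14" "\<forall>j<14. p ! j < 14" "i < 32" "j < 14" "k < 14"
  shows "vl (permute p (tens ! i) ! j ! k) = tn i (p ! j) (p ! k)"
  using assms by (simp add: permute_def perm_def tn_def)

text \<open>The permutation \<open>s\<close> of the first party's settings has to fix 0, whose term
  carries no absolute value. Among the others a change of sign is absorbed by the absolute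
  value.\<close>

lemma F_perm_gen:
  assumes p: "distinct p" "set p = {..<14}" "length p = 14"
    and s: "distinct s" "set s = {..<32}" "length s = 32" "s ! 0 = 0"
    and r: "map (permute p) (take 31 tens) = map ((!) tens) (take 31 s)"
    and r': "map (map vl) (permute p (tens ! 31)) = map (map (\<lambda>x. - vl x)) (tens ! (s ! 31))"
    and b: "strat b" "strat c"
  shows "F (perm p b) (perm p c) = F b c"
proof -
  have pj: "\<forall>j<14. p ! j < 14" using p by (metis lessThan_iff nth_mem)
  have si: "s ! i < 32" if "i < 32" for i using s that by (metis lessThan_iff nth_mem)
  have t1: "tn (s ! i) j k = 1 * tn i (p ! j) (p ! k)" if "i < 31" "j < 14" "k < 14" for i j k
  proof -
    have "permute p (tens ! i) = tens ! (s ! i)"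
      using arg_cong[OF r, of "\<lambda>x. x ! i"] that s tens_props(1) by simp
    then show ?thesis using permute_nth[OF p(3) pj, of i j k] that by (simp add: tn_def)
  qed
  have t2: "tn (s ! 31) j k = - 1 * tn 31 (p ! j) (p ! k)" if "j < 14" "k < 14" for j k
  proof -
    have l: "length (permute p (tens ! 31)) = 14" "length (permute p (tens ! 31) ! j) = 14"
      using p(3) that by (simp_all add: permute_def perm_def)
    have "vl (permute p (tens ! 31) ! j ! k) = - vl (tens ! (s ! 31) ! j ! k)"
      using arg_cong[OF r', of "\<lambda>x. x ! j ! k"] that l tens_props(2,3) si[of 31] by simp
    then show ?thesis using permute_nth[OF p(3) pj, of 31 j k] that by (simp add: tn_def)
  qed
  have g1: "G (s ! i) (perm p b) (perm p c) = 1 * G i b c" if "i < 31" for i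
    by (rule G_perm[OF p t1 b]) (use that in auto)
  have g2: "G (s ! 31) (perm p b) (perm p c) = - 1 * G 31 b c"
    by (rule G_perm[OF p t2 b])
  have g: "\<bar>G (s ! i) (perm p b) (perm p c)\<bar> = \<bar>G i b c\<bar>" if "i < 32" for i
  proof (cases "i < 31")
    case False
    then have "i = 31" using that by simp
    then show ?thesis using g2 by simp
  qed (use g1 in simp)
  have "bij_betw ((!) s) {..<32} {..<32}"
    using bij_betw_nth[OF s(1)] s by simp
  then have "bij_betw ((!) s) ({..<32} - {0}) ({..<32} - {0})"
    by (rule bij_betw_DiffI) (use s(4) in \<open>auto simp: bij_betw_def\<close>)
  moreover have d: "{..<32} - {0} = {Suc 0..<Suc 31}" by auto
  ultimately have bij: "bij_betw ((!) s) {Suc 0..<Suc 31} {Suc 0..<Suc 31}" by simp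
  have sh: "(\<Sum>i<31. f (Suc i)) = (\<Sum>i\<in>{Suc 0..<Suc 31}. f i)" for f :: "nat \<Rightarrow> int"
    by (simp only: sum.shift_bounds_Suc_ivl atLeast0LessThan)
  have "(\<Sum>i<31. \<bar>G (Suc i) (perm p b) (perm p c)\<bar>) = (\<Sum>i\<in>{Suc 0..<Suc 31}. \<bar>G i (perm p b) (perm p c)\<bar>)"
    by (rule sh)
  also have "\<dots> = (\<Sum>i\<in>{Suc 0..<Suc 31}. \<bar>G (s ! i) (perm p b) (perm p c)\<bar>)"
    by (rule sum.reindex_bij_betw[OF bij, symmetric])
  also have "\<dots> = (\<Sum>i\<in>{Suc 0..<Suc 31}. \<bar>G i b c\<bar>)"
    by (intro sum.cong refl) (use g in auto)
  also have "\<dots> = (\<Sum>i<31. \<bar>G (Suc i) b c\<bar>)" by (rule sh[symmetric])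
  finally show ?thesis using g1[of 0] s(4) by (simp add: F_def)
qed

definition sigma_rot :: "nat list" where "sigma_rot = [0, 1, 3, 4, 5, 2, 7, 8, 9, 6, 11, 12, 13, 10, 15, 16, 17, 14, 19, 20, 21, 18, 23, 24, 25, 22, 27, 28, 29, 26, 31, 30]"
definition sigma_refl :: "nat list" where "sigma_refl = [0, 1, 2, 5, 4, 3, 9, 8, 7, 6, 10, 13, 12, 11, 17, 16, 15, 14, 21, 20, 19, 18, 22, 25, 24, 23, 29, 28, 27, 26, 30, 31]"

lemma perm_list_14: "distinct p \<Longrightarrow> length p = n \<Longrightarrow> \<forall>x\<in>set p. x < n \<Longrightarrow> set p = {..<n}"
  using card_subset_eq[of "{..<n}" "set p"] distinct_card[of p] by auto

lemma F_perm:
  assumes "p = rot \<or> p = refl_ix" "strat b" "strat c"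
  shows "F (perm p b) (perm p c) = F b c"
  using assms(1)
proof
  assume p: "p = rot"
  show ?thesis unfolding p
  proof (rule F_perm_gen[of _ sigma_rot, OF _ _ _ _ _ _ _ _ _ assms(2,3)])
    show "distinct rot" "length rot = 14" "distinct sigma_rot" "length sigma_rot = 32" "sigma_rot ! 0 = 0"
      by (simp_all add: rot_def sigma_rot_def)
    show "set rot = {..<14}" by (rule perm_list_14) (simp_all add: rot_def)
    show "set sigma_rot = {..<32}" by (rule perm_list_14) (simp_all add: sigma_rot_def)
    show "map (permute rot) (take 31 tens) = map ((!) tens) (take 31 sigma_rot)"
      unfolding tens_rot by (simp add: sigma_rot_def)
    show "map (map vl) (permute rot (tens ! 31)) = map (map (\<lambda>x. - vl x)) (tens ! (sigma_rot ! 31))"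
      unfolding tens_rot31 by (simp add: sigma_rot_def)
  qed
next
  assume p: "p = refl_ix"
  show ?thesis unfolding p
  proof (rule F_perm_gen[of _ sigma_refl, OF _ _ _ _ _ _ _ _ _ assms(2,3)])
    show "distinct refl_ix" "length refl_ix = 14" "distinct sigma_refl" "length sigma_refl = 32" "sigma_refl ! 0 = 0"
      by (simp_all add: refl_ix_def sigma_refl_def)
    show "set refl_ix = {..<14}" by (rule perm_list_14) (simp_all add: refl_ix_def)
    show "set sigma_refl = {..<32}" by (rule perm_list_14) (simp_all add: sigma_refl_def)
    show "map (permute refl_ix) (take 31 tens) = map ((!) tens) (take 31 sigma_refl)"
      unfolding tens_refl by (simp add: sigma_refl_def)
    show "map (map vl) (permute refl_ix (tens ! 31)) = map (map (\<lambda>x. - vl x)) (tens ! (sigma_refl ! 31))"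
      unfolding tens_refl31 by (simp add: sigma_refl_def)
  qed
qed

lemma upt_14: "[0,1,2,3,4,5,6,7,8,9,10,11,12,13] = [0..<14]" by code_simp

lemma tn_swap: "i < 32 \<Longrightarrow> j < 14 \<Longrightarrow> k < 14 \<Longrightarrow> tn i j k = tn i k j"
  using arg_cong[OF tens_swap, of "\<lambda>x. x ! i ! j ! k"] tens_props
  unfolding upt_14 by (simp add: tn_def)

lemma F_swap: "F b c = F c b"
proof -
  have "G i b c = G i c b" if "i < 32" for i
  proof -
    have "G i b c = (\<Sum>j<14. \<Sum>k<14. tn i k j * sg (c ! k) * sg (b ! j))"
      unfolding G_def by (intro sum.cong refl) (simp add: tn_swap[OF that])
    also have "\<dots> = G i c b" unfolding G_def by (rule sum.swap)
    finally show ?thesis .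
  qed
  then show ?thesis by (simp add: F_def)
qed

lemma length_14:
  assumes "length b = 14"
  obtains x0 x1 x2 x3 x4 x5 x6 x7 x8 x9 x10 x11 x12 x13
  where "b = [x0, x1, x2, x3, x4, x5, x6, x7, x8, x9, x10, x11, x12, x13]"
  using assms by (auto simp: numeral_eq_Suc length_Suc_conv)

lemma pick_rot: "pick w x y z a0 a1 a2 a3 a4 a5 = pick x y z w a0 a1 a2 a3 a4 a5"
  by (cases w; cases x; cases y; cases z) (simp_all add: pick_def)
lemma pick_refl: "pick x w z y a0 a1 a2 a3 a4 a5 = pick x y z w a0 a1 a2 a3 a4 a5"
  by (cases w; cases x; cases y; cases z) (simp_all add: pick_def)

lemma perm_strat:
  assumes "p = rot \<or> p = refl_ix" "strat b"
  shows "strat (perm p b)" "key (cpath (perm p b)) = key (cpath b)"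
proof -
  obtain x0 x1 x2 x3 x4 x5 x6 x7 x8 x9 x10 x11 x12 x13
    where b: "b = [x0, x1, x2, x3, x4, x5, x6, x7, x8, x9, x10, x11, x12, x13]"
    using assms(2) length_14 unfolding strat_def by blast
  show "strat (perm p b)" using assms(1) assms(2) unfolding b strat_def
    by (elim disjE) (simp_all add: perm_lit perm_refl_lit)
  show "key (cpath (perm p b)) = key (cpath b)"
    using assms(1) unfolding b
  proof
    assume p: "p = rot"
    show "key (cpath (perm p [x0, x1, x2, x3, x4, x5, x6, x7, x8, x9, x10, x11, x12, x13])) =
      key (cpath [x0, x1, x2, x3, x4, x5, x6, x7, x8, x9, x10, x11, x12, x13])"
      unfolding p perm_lit cpath_lit key.simps pick_rot[of x13 x10 x11 x12] ..
  next
    assume p: "p = refl_ix"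
    show "key (cpath (perm p [x0, x1, x2, x3, x4, x5, x6, x7, x8, x9, x10, x11, x12, x13])) =
      key (cpath [x0, x1, x2, x3, x4, x5, x6, x7, x8, x9, x10, x11, x12, x13])"
      unfolding p perm_refl_lit cpath_lit key.simps pick_refl[of x10 x13 x12 x11] ..
  qed
qed

lemma hit:
  assumes rf: "rf PNone PNone forest (map row seq) base"
    and l: "look (path b) = Some (pre (cpath b))" and b: "strat b" and c: "strat c"
    and k: "key (cpath b) \<le> key (cpath c)"
  shows "F b c \<le> 26072"
proof (rule checked[OF rf b c l[unfolded look_def]])
  obtain x0 x1 x2 x3 x4 x5 x6 x7 x8 x9 x10 x11 x12 x13
    where b': "b = [x0, x1, x2, x3, x4, x5, x6, x7, x8, x9, x10, x11, x12, x13]"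
    using b length_14 unfolding strat_def by blast
  obtain y0 y1 y2 y3 y4 y5 y6 y7 y8 y9 y10 y11 y12 y13
    where c': "c = [y0, y1, y2, y3, y4, y5, y6, y7, y8, y9, y10, y11, y12, y13]"
    using c length_14 unfolding strat_def by blast
  show "allowed (pre (cpath b)) (cpath c)"
    using k unfolding b' c' cpath_lit by (rule allowed_pre)
qed

text \<open>Every symmetry is applied to \<open>c\<close> together with \<open>b\<close>. It
  preserves \<open>F\<close> and both keys, so the comparison of the keys survives until a listed
  case is reached.\<close>

lemma search_sound:
  assumes rf: "rf PNone PNone forest (map row seq) base"
  shows "search ps b \<Longrightarrow> set ps \<subseteq> {rot, refl_ix} \<Longrightarrow> strat b \<Longrightarrow> strat c \<Longrightarrow>
    key (cpath b) \<le> key (cpath c) \<Longrightarrow> F b c \<le> 26072"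
proof (induction ps arbitrary: b c)
  case Nil
  then show ?case using hit[OF rf] by simp
next
  case (Cons p ps)
  have p: "p = rot \<or> p = refl_ix" using Cons.prems(2) by auto
  from Cons.prems(1) consider "look (path b) = Some (pre (cpath b))" | "search ps (perm p b)" by auto
  then show ?case
  proof cases
    case 1
    then show ?thesis using hit[OF rf] Cons.prems by blast
  next
    case 2
    have "F (perm p b) (perm p c) \<le> 26072"
      by (rule Cons.IH[OF 2]) (use Cons.prems perm_strat[OF p] in auto)
    then show ?thesis using F_perm[OF p Cons.prems(3,4)] by simp
  qed
qed

lemma allb_sound: "allb n bs \<Longrightarrow> length xs = n \<Longrightarrow> search words (True # xs @ bs)"
proof (induction n arbitrary: bs xs)
  case (Suc n)
  obtain ys s where xs: "xs = ys @ [s]" "length ys = n"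
    using Suc.prems(2) by (cases xs rule: rev_cases) auto
  show ?case using Suc.IH[of "s # bs" ys] Suc.prems(1) xs by (cases s) auto
qed simp

theorem local_bound:
  assumes rf: "rf PNone PNone forest (map row seq) base" and b: "strat b" "strat c"
  shows "F b c \<le> 26072"
proof -
  have *: "F b c \<le> 26072" if k: "key (cpath b) \<le> key (cpath c)" and b: "strat b" and c: "strat c" for b c
  proof -
    obtain xs where xs: "b = True # xs" "length xs = 13"
      using b by (cases b) (auto simp: strat_def)
    have "search words b" using allb_sound[OF covered xs(2)] xs(1) by simp
    then show ?thesis by (rule search_sound[OF rf]) (use k b c in \<open>auto simp: words_def\<close>)
  qed
  show ?thesis
  proof (cases "key (cpath b) \<le> key (cpath c)")
    \<comment> \<open>The third party has the smaller key, so the two exchange roles.\<close>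
    case False
    then show ?thesis using *[of c b] b F_swap[of b c] by simp
  qed (use *[of b c] b in blast)
qed

section \<open>From deterministic to general responses\<close>

text \<open>A linear form on a cube attains its maximum at a vertex, given by the signs of its
  coefficients; coordinate 0 stays pinned to 1.\<close>

lemma choose_signs:
  fixes w :: "nat \<Rightarrow> real"
  assumes "\<And>b. strat b \<Longrightarrow> (\<Sum>j<14. of_int (sg (b ! j)) * w j) \<le> K"
    and "\<beta> 0 = 1" "\<And>j. \<bar>\<beta> j\<bar> \<le> 1"
  shows "(\<Sum>j<14. \<beta> j * w j) \<le> K"
proof -
  let ?b = "map (\<lambda>j. j = 0 \<or> 0 \<le> w j) [0..<14]"
  have b: "strat ?b" by (simp add: strat_def)
  have "\<beta> j * w j \<le> of_int (sg (?b ! j)) * w j" if "j < 14" for j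
  proof (cases "j = 0")
    case False
    have "\<beta> j * w j \<le> \<bar>\<beta> j\<bar> * \<bar>w j\<bar>" by (metis abs_ge_self abs_mult)
    also have "\<dots> \<le> \<bar>w j\<bar>" using assms(3)[of j] by (simp add: mult_left_le_one_le)
    also have "\<dots> = of_int (sg (?b ! j)) * w j" using False that by (simp add: sg_def)
    finally show ?thesis .
  qed (use assms(2) in \<open>simp add: sg_def\<close>)
  then have "(\<Sum>j<14. \<beta> j * w j) \<le> (\<Sum>j<14. of_int (sg (?b ! j)) * w j)"
    by (intro sum_mono) simp
  also have "\<dots> \<le> K" by (rule assms(1)[OF b])
  finally show ?thesis .
qed

definition S :: "(nat \<Rightarrow> real) \<Rightarrow> (nat \<Rightarrow> real) \<Rightarrow> (nat \<Rightarrow> real) \<Rightarrow> real" where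
  "S \<alpha> \<beta> \<gamma> = (\<Sum>i<32. \<Sum>j<14. \<Sum>k<14. of_int (tn i j k) * \<alpha> i * \<beta> j * \<gamma> k)"

text \<open>The form is linear in each party separately, so the last two parties are made
  deterministic one after the other, while the first is replaced by absolute values all at
  once.\<close>

lemma S_bound:
  assumes F: "\<And>b c. strat b \<Longrightarrow> strat c \<Longrightarrow> F b c \<le> 26072"
    and a: "\<alpha> 0 = 1" "\<And>i. \<bar>\<alpha> i\<bar> \<le> 1" and b: "\<beta> 0 = 1" "\<And>i. \<bar>\<beta> i\<bar> \<le> 1"
    and c: "\<gamma> 0 = 1" "\<And>i. \<bar>\<gamma> i\<bar> \<le> 1"
  shows "S \<alpha> \<beta> \<gamma> \<le> 26072"
proof -
  have 1: "S \<alpha> (\<lambda>j. of_int (sg (b ! j))) (\<lambda>k. of_int (sg (c ! k))) \<le> 26072" if bc: "strat b" "strat c" for b c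
  proof -
    have eq: "S \<alpha> (\<lambda>j. of_int (sg (b ! j))) (\<lambda>k. of_int (sg (c ! k))) = (\<Sum>i<32. \<alpha> i * of_int (G i b c))"
      unfolding S_def G_def of_int_sum sum_distrib_left
      by (intro sum.cong refl) (simp add: mult_ac)
    have le: "\<alpha> i * of_int (G i b c) \<le> of_int \<bar>G i b c\<bar>" for i
    proof -
      have "\<alpha> i * of_int (G i b c) \<le> \<bar>\<alpha> i\<bar> * \<bar>of_int (G i b c)\<bar>" by (metis abs_ge_self abs_mult)
      also have "\<dots> \<le> \<bar>of_int (G i b c)\<bar>" using a(2)[of i] by (simp add: mult_left_le_one_le)
      finally show ?thesis by simp
    qed
    have "(\<Sum>i<32. \<alpha> i * of_int (G i b c)) = of_int (G 0 b c) + (\<Sum>i<31. \<alpha> (Suc i) * of_int (G (Suc i) b c))"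
      using sum.lessThan_Suc_shift[of "\<lambda>i. \<alpha> i * of_int (G i b c)" 31] a(1) by simp
    also have "\<dots> \<le> of_int (G 0 b c) + (\<Sum>i<31. of_int \<bar>G (Suc i) b c\<bar>)"
      by (intro add_left_mono sum_mono le)
    also have "\<dots> = of_int (F b c)" by (simp add: F_def)
    also have "\<dots> \<le> 26072" using F[OF bc] by (simp only: of_int_le_numeral_iff)
    finally show ?thesis unfolding eq .
  qed
  have 2: "S \<alpha> \<beta> (\<lambda>k. of_int (sg (c ! k))) \<le> 26072" if "strat c" for c
  proof -
    have eq: "S \<alpha> y (\<lambda>k. of_int (sg (c ! k))) =
        (\<Sum>j<14. y j * (\<Sum>i<32. \<Sum>k<14. of_int (tn i j k) * \<alpha> i * of_int (sg (c ! k))))" for y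
      unfolding S_def sum_distrib_left by (subst sum.swap) (intro sum.cong refl, simp add: mult_ac)
    show ?thesis unfolding eq
    proof (rule choose_signs)
      fix b assume "strat b"
      from 1[OF this that] show "(\<Sum>j<14. real_of_int (sg (b ! j)) *
        (\<Sum>i<32. \<Sum>k<14. of_int (tn i j k) * \<alpha> i * of_int (sg (c ! k)))) \<le> 26072" unfolding eq .
    qed (use b in auto)
  qed
  have eq: "S \<alpha> \<beta> z = (\<Sum>k<14. z k * (\<Sum>i<32. \<Sum>j<14. of_int (tn i j k) * \<alpha> i * \<beta> j))" for z
  proof -
    have "S \<alpha> \<beta> z = (\<Sum>i<32. \<Sum>k<14. \<Sum>j<14. of_int (tn i j k) * \<alpha> i * \<beta> j * z k)"
      unfolding S_def by (intro sum.cong refl sum.swap)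
    also have "\<dots> = (\<Sum>k<14. \<Sum>i<32. \<Sum>j<14. of_int (tn i j k) * \<alpha> i * \<beta> j * z k)"
      by (rule sum.swap)
    finally show ?thesis unfolding sum_distrib_left by (simp add: mult_ac)
  qed
  show ?thesis unfolding eq
  proof (rule choose_signs)
    fix c assume "strat c"
    from 2[OF this] show "(\<Sum>k<14. real_of_int (sg (c ! k)) *
      (\<Sum>i<32. \<Sum>j<14. of_int (tn i j k) * \<alpha> i * \<beta> j)) \<le> 26072" unfolding eq .
  qed (use c in auto)
qed

section \<open>Correlators of the noisy W state\<close>

lemma sum_222: "(\<Sum>p\<in>(UNIV :: (2 \<times> 2 \<times> 2) set). f p) =
    f (1,1,1) + f (1,1,2) + f (1,2,1) + f (1,2,2) + f (2,1,1) + f (2,1,2) + f (2,2,1) + f (2,2,2)"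
proof -
  have "(\<Sum>p\<in>(UNIV :: (2 \<times> 2 \<times> 2) set). f p) = (\<Sum>i\<in>UNIV. \<Sum>j\<in>UNIV. \<Sum>k\<in>UNIV. f (i, j, k))"
    by (simp add: UNIV_Times_UNIV[symmetric] sum.cartesian_product del: UNIV_Times_UNIV)
  then show ?thesis by (simp add: sum_2 add.assoc)
qed

lemma effect_entries:
  "effect a x $ 1 $ 1 = complex_of_real ((1 + a * x $ 3) / 2)"
  "effect a x $ 1 $ 2 = Complex (a * x $ 1 / 2) (- a * x $ 2 / 2)"
  "effect a x $ 2 $ 1 = Complex (a * x $ 1 / 2) (a * x $ 2 / 2)"
  "effect a x $ 2 $ 2 = complex_of_real ((1 - a * x $ 3) / 2)"
  by (auto simp: effect_def observable_def pauli_x_def pauli_y_def pauli_z_def mat_def complex_eq_iff)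

lemma W3_entries: "W3 $ (i, j, k) =
    (if (i, j, k) \<in> {(1,1,2), (1,2,1), (2,1,1)} then complex_of_real (1 / sqrt 3) else 0)"
proof -
  have two: "i = 1 \<or> i = 2" for i :: 2 by (rule exhaust_2)
  show ?thesis using two[of i] two[of j] two[of k]
    by (auto simp: W3_def tensor_vec3_def ket0_def ket1_def complex_eq_iff)
qed

text \<open>\<open>E1\<close>, \<open>E2\<close> and \<open>E3\<close> are the correlators of the W
  state for one, two and three parties; by its permutation symmetry they do not depend on which
  parties measure.\<close>

definition E1 :: "real ^ 3 \<Rightarrow> real" where "E1 x = x $ 3 / 3"
definition E2 :: "real ^ 3 \<Rightarrow> real ^ 3 \<Rightarrow> real" where
  "E2 x y = 2 / 3 * (x $ 1 * y $ 1 + x $ 2 * y $ 2) - x $ 3 * y $ 3 / 3"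
definition E3 :: "real ^ 3 \<Rightarrow> real ^ 3 \<Rightarrow> real ^ 3 \<Rightarrow> real" where
  "E3 x y z = 2 / 3 * ((x $ 1 * y $ 1 + x $ 2 * y $ 2) * z $ 3 + (x $ 1 * z $ 1 + x $ 2 * z $ 2) * y $ 3
     + (y $ 1 * z $ 1 + y $ 2 * z $ 2) * x $ 3) - x $ 3 * y $ 3 * z $ 3"

lemma sqrt3: "complex_of_real (1 / sqrt 3) * cnj (complex_of_real (1 / sqrt 3)) = 1 / 3"
proof -
  have "(1 / sqrt 3) * (1 / sqrt 3) = (1 / 3 :: real)" by (simp add: real_divide_square_eq)
  then show ?thesis
    unfolding complex_cnj_complex_of_real of_real_mult[symmetric] by simp
qed

text \<open>The state is supported on three basis vectors with equal amplitudes, so its projector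
  has nine nonzero entries, all equal to 1/3.\<close>

lemma trace_rho_W3:
  "trace (rho_W3 v ** T) = of_real (v / 3) *
     (\<Sum>p\<in>{(1,1,2), (1,2,1), (2,1,1)}. \<Sum>q\<in>{(1,1,2), (1,2,1), (2,1,1)}. T $ p $ q)
   + of_real ((1 - v) / 8) * (\<Sum>p\<in>UNIV. T $ p $ p)"
proof -
  let ?S = "{(1,1,2), (1,2,1), (2,1,1)} :: (2 \<times> 2 \<times> 2) set"
  have W: "W3 $ p = (if p \<in> ?S then complex_of_real (1 / sqrt 3) else 0)" for p
    by (cases p) (simp only: W3_entries)
  have kb: "ket_bra W3 $ p $ q = (if p \<in> ?S \<and> q \<in> ?S then 1 / 3 else 0)" for p q
    unfolding ket_bra_def by (simp only: vec_lambda_beta W) (use sqrt3 in auto)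
  have rho: "rho_W3 v $ p $ q = of_real v * (if p \<in> ?S \<and> q \<in> ?S then 1 / 3 else 0)
      + of_real ((1 - v) / 8) * (if p = q then 1 else 0)" for p q
    unfolding rho_W3_def by (simp add: kb mat_def complex_eq_iff)
  have "trace (rho_W3 v ** T) = (\<Sum>p\<in>UNIV. \<Sum>q\<in>UNIV. rho_W3 v $ p $ q * T $ q $ p)"
    by (simp add: trace_def matrix_matrix_mult_def)
  also have "\<dots> = (\<Sum>p\<in>UNIV. \<Sum>q\<in>UNIV. of_real v / 3 * (if p \<in> ?S then if q \<in> ?S then T $ q $ p else 0 else 0))
      + (\<Sum>p\<in>UNIV. \<Sum>q\<in>UNIV. of_real ((1 - v) / 8) * (if p = q then T $ q $ p else 0))"
    unfolding sum.distrib[symmetric]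
    by (intro sum.cong refl) (auto simp: rho field_simps)
  also have "(\<Sum>p\<in>UNIV. \<Sum>q\<in>UNIV. of_real ((1 - v) / 8) * (if p = q then T $ q $ p else 0)) =
      of_real ((1 - v) / 8) * (\<Sum>p\<in>UNIV. T $ p $ p)"
    by (simp only: sum_distrib_left[symmetric] sum.delta' finite UNIV_I if_True)
  also have "(\<Sum>p\<in>UNIV. \<Sum>q\<in>UNIV. of_real v / 3 * (if p \<in> ?S then if q \<in> ?S then T $ q $ p else 0 else 0))
      = of_real (v / 3) * (\<Sum>p\<in>?S. \<Sum>q\<in>?S. T $ q $ p)"
  proof -
    have *: "(\<Sum>q\<in>UNIV. if q \<in> ?S then f q else 0) = (\<Sum>q\<in>?S. f q)" for f :: "2 \<times> 2 \<times> 2 \<Rightarrow> complex"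
      using sum.inter_restrict[of UNIV f ?S] by simp
    have **: "(\<Sum>q\<in>UNIV. of_real v / 3 * (if p \<in> ?S then if q \<in> ?S then T $ q $ p else 0 else 0))
      = of_real v / 3 * (if p \<in> ?S then \<Sum>q\<in>?S. T $ q $ p else 0)" for p
      by (cases "p \<in> ?S") (simp_all only: sum_distrib_left[symmetric] if_True if_False * sum.neutral_const)
    show ?thesis
      unfolding ** unfolding sum_distrib_left[symmetric] * by simp
  qed
  also have "(\<Sum>p\<in>?S. \<Sum>q\<in>?S. T $ q $ p) = (\<Sum>p\<in>?S. \<Sum>q\<in>?S. T $ p $ q)"
    by (rule sum.swap)
  finally show ?thesis .
qed

text \<open>Eight times an outcome probability, expanded in products of outcomes. White noise
  contributes to the constant term only.\<close>

definition corr :: "real \<Rightarrow> real \<Rightarrow> real \<Rightarrow> real \<Rightarrow> real ^ 3 \<Rightarrow> real ^ 3 \<Rightarrow> real ^ 3 \<Rightarrow> real" where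
  "corr v a b c x y z = 1 + v * (a * E1 x + b * E1 y + c * E1 z
     + a * b * E2 x y + a * c * E2 x z + b * c * E2 y z + a * b * c * E3 x y z)"

lemma outcome_prob_rho_W3:
  "outcome_prob (rho_W3 v) a b c x y z = complex_of_real (corr v a b c x y z / 8)"
  unfolding outcome_prob_def trace_rho_W3 sum_222
  by (simp add: tensor_op3_def effect_entries complex_eq_iff corr_def E1_def E2_def E3_def
      field_simps)

section \<open>Directions and the quantum value\<close>

text \<open>Rational points of the unit sphere, times 33495, near numerically optimal directions. The
  extra leading coordinate turns the trivial observable into the entry \<open>[33495, 0, 0, 0]\<close>, so that
  \<open>EI\<close> gives all correlators, including the marginals.\<close>

definition dirs_A :: "int list list" where "dirs_A =
  [[33495, 0, 0, 0],
   [0, 0, 0, 33495],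
   [0, 31165, 82, 12274],
   [0, -82, 31165, 12274],
   [0, -31165, 82, 12274],
   [0, -82, -31165, 12274],
   [0, 20448, 20745, 16536],
   [0, -20745, 20448, 16536],
   [0, -20448, -20745, 16536],
   [0, 20745, -20448, 16536],
   [0, 15875, 58, 29494],
   [0, -58, 15875, 29494],
   [0, -15875, 58, 29494],
   [0, -58, -15875, 29494],
   [0, 14755, 14810, 26170],
   [0, -14755, 14810, 26170],
   [0, -14810, -14755, 26170],
   [0, 14755, -14810, 26170],
   [0, 23290, 23438, 5491],
   [0, -23438, 23290, 5491],
   [0, -23290, -23438, 5491],
   [0, 23290, -23438, 5491],
   [0, 27748, 161, 18760],
   [0, -161, 27748, 18760],
   [0, -27748, 161, 18760],
   [0, -161, -27748, 18760],
   [0, 6465, 6480, 32220],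
   [0, -6480, 6465, 32220],
   [0, -6480, -6465, 32220],
   [0, 6465, -6480, 32220],
   [0, 33495, 0, 0],
   [0, 0, 33495, 0]]"
definition dirs_B :: "int list list" where "dirs_B =
  [[33495, 0, 0, 0],
   [0, 0, 0, 33495],
   [0, 32365, 118, 8626],
   [0, -118, 32365, 8626],
   [0, -32365, 118, 8626],
   [0, 118, -32365, 8626],
   [0, 21170, 21146, 15053],
   [0, -21170, 21146, 15053],
   [0, -21170, -21146, 15053],
   [0, 21146, -21170, 15053],
   [0, 17830, 10, 28355],
   [0, -10, 17830, 28355],
   [0, -17830, 10, 28355],
   [0, 10, -17830, 28355]]"

text \<open>The correlator times 3 * 33495^3: one factor 3 clears the denominator of the state and
  each direction brings 33495. The coordinate 0 makes the marginals trilinear as well.\<close>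

definition EI :: "int list \<Rightarrow> int list \<Rightarrow> int list \<Rightarrow> int" where
  "EI x y z = x!3 * y!0 * z!0 + x!0 * y!3 * z!0 + x!0 * y!0 * z!3
     - x!3 * y!3 * z!0 - x!3 * y!0 * z!3 - x!0 * y!3 * z!3
     + 2 * (x!1 * y!1 * z!0 + x!2 * y!2 * z!0 + x!1 * y!0 * z!1 + x!2 * y!0 * z!2 + x!0 * y!1 * z!1 + x!0 * y!2 * z!2)
     + 2 * (x!1 * y!1 * z!3 + x!2 * y!2 * z!3 + x!1 * y!3 * z!1 + x!2 * y!3 * z!2 + x!3 * y!1 * z!1 + x!3 * y!2 * z!2)
     - 3 * x!3 * y!3 * z!3"

fun dot :: "int list \<Rightarrow> int list \<Rightarrow> int" where
  "dot (x # xs) (y # ys) = x * y + dot xs ys"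
| "dot xs ys = 0"

lemma dot_sum: "length xs = length ys \<Longrightarrow> dot xs ys = (\<Sum>k<length xs. xs ! k * ys ! k)"
  by (induction xs ys rule: list_induct2) (simp_all add: sum.lessThan_Suc_shift del: sum.lessThan_Suc)

definition comp :: "nat \<Rightarrow> int list" where "comp c = map (\<lambda>l. l ! c) dirs_B"
definition contract :: "vec list list \<Rightarrow> int list \<Rightarrow> int list" where
  "contract m ys = map (\<lambda>r. dot (map vl r) ys) m"
definition qform :: "int list \<Rightarrow> (nat \<Rightarrow> nat \<Rightarrow> int) \<Rightarrow> int" where
  "qform x D = x!3 * D 0 0 + x!0 * D 3 0 + x!0 * D 0 3 - x!3 * D 3 0 - x!3 * D 0 3 - x!0 * D 3 3
     + 2 * (x!1 * D 1 0 + x!2 * D 2 0 + x!1 * D 0 1 + x!2 * D 0 2 + x!0 * D 1 1 + x!0 * D 2 2)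
     + 2 * (x!1 * D 1 3 + x!2 * D 2 3 + x!1 * D 3 1 + x!2 * D 3 2 + x!3 * D 1 1 + x!3 * D 2 2)
     - 3 * x!3 * D 3 3"
text \<open>Contracting a coefficient matrix with the coordinates of the directions leaves at most
  sixteen numbers per setting, instead of an evaluation of \<open>EI\<close> at each of the 196
  pairs.\<close>

definition qrow :: "vec list list \<Rightarrow> int list \<Rightarrow> int" where
  "qrow m x = qform x (\<lambda>b c. dot (comp b) (contract m (comp c)))"

lemma qtotal: "sum_list (map2 qrow tens dirs_A) = 5361295981885345452"
  unfolding tens_lit by code_simp

lemma dirs_shape: "length dirs_A = 32" "length dirs_B = 14"
  by (simp_all add: dirs_A_def dirs_B_def)

lemma dirs_unit:
  "dirs_A ! 0 = [33495, 0, 0, 0]" "dirs_B ! 0 = [33495, 0, 0, 0]"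
  "list_all (\<lambda>x. x ! 0 = 0 \<and> (x ! 1)^2 + (x ! 2)^2 + (x ! 3)^2 = 33495^2) (tl dirs_A)"
  "list_all (\<lambda>x. x ! 0 = 0 \<and> (x ! 1)^2 + (x ! 2)^2 + (x ! 3)^2 = 33495^2) (tl dirs_B)"
  by (simp_all add: dirs_A_def dirs_B_def)

lemma qrow_sum:
  assumes "i < 32"
  shows "qrow (tens ! i) x = (\<Sum>j<14. \<Sum>k<14. tn i j k * EI x (dirs_B ! j) (dirs_B ! k))"
proof -
  let ?D = "\<lambda>b c. \<Sum>j<14. \<Sum>k<14. tn i j k * (dirs_B ! j ! b * dirs_B ! k ! c)"
  have D: "dot (comp b) (contract (tens ! i) (comp c)) = ?D b c" for b c
  proof -
    have u: "contract (tens ! i) (comp c) ! j = (\<Sum>k<14. tn i j k * dirs_B ! k ! c)" if "j < 14" for j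
      using tens_props(2,3)[OF assms] that dirs_shape
      by (simp add: contract_def comp_def dot_sum tn_def)
    show ?thesis
      using tens_props(2)[OF assms] dirs_shape u
      by (simp add: dot_sum comp_def contract_def[of _ "map _ _"] sum_distrib_left mult.left_commute)
  qed
  show ?thesis unfolding qrow_def D qform_def EI_def
    by (simp add: algebra_simps sum.distrib sum_subtractf sum_distrib_left)
qed

text \<open>Index 0 is the trivial observable, whose outcome is replaced by 1 in \<open>wt\<close>;
  any unit vector can stand there. The same default beyond the list makes \<open>norm_dir\<close>
  unconditional in \<open>i\<close>.\<close>

definition dir :: "int list list \<Rightarrow> nat \<Rightarrow> real ^ 3" where
  "dir L i = (if i = 0 \<or> length L \<le> i then vector [0, 0, 1]
     else vector [of_int (L ! i ! 1) / 33495, of_int (L ! i ! 2) / 33495, of_int (L ! i ! 3) / 33495])"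

lemma norm_dir:
  assumes "list_all (\<lambda>x. x ! 0 = 0 \<and> (x ! 1)^2 + (x ! 2)^2 + (x ! 3)^2 = 33495^2) (tl L)"
  shows "norm (dir L i) = 1"
proof (cases "i = 0 \<or> length L \<le> i")
  case False
  then have "(L ! i ! 1)^2 + (L ! i ! 2)^2 + (L ! i ! 3)^2 = 33495^2"
    using assms unfolding list_all_length by (cases i) (auto simp: nth_tl)
  then have "(of_int (L ! i ! 1))^2 + (of_int (L ! i ! 2))^2 + (of_int (L ! i ! 3))^2 = (33495^2 :: real)"
    by (metis (mono_tags, lifting) of_int_add of_int_numeral of_int_power)
  then show ?thesis using False
    by (simp add: dir_def norm_eq_1 inner_vec_def sum_3 power2_eq_square[symmetric] power_divide add_divide_distrib[symmetric])
qed (auto simp: dir_def norm_eq_1 inner_vec_def sum_3)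

definition wt :: "bool \<Rightarrow> real \<Rightarrow> real" where "wt c a = (if c then 1 else a)"

text \<open>The value 0 in the completely trivial case leaves the constant 1, which is not scaled by
  the visibility, as a separate term in \<open>corr_sum\<close>.\<close>

definition ee :: "bool \<Rightarrow> bool \<Rightarrow> bool \<Rightarrow> real ^ 3 \<Rightarrow> real ^ 3 \<Rightarrow> real ^ 3 \<Rightarrow> real" where
  "ee ca cb cc x y z =
    (if ca then if cb then if cc then 0 else E1 z else if cc then E1 y else E2 y z
     else if cb then if cc then E1 x else E2 x z else if cc then E2 x y else E3 x y z)"

text \<open>Fourier inversion over the outcomes: summation over signs kills every monomial except
  the product of the outcomes of the nontrivial parties.\<close>

lemma corr_sum:
  "(\<Sum>a\<in>{1, - 1}. \<Sum>b\<in>{1, - 1}. \<Sum>c\<in>{1, - 1}. wt ca a * wt cb b * wt cc c * (corr v a b c x y z / 8))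
    = (if ca \<and> cb \<and> cc then 1 else 0) + v * ee ca cb cc x y z"
  by (cases ca; cases cb; cases cc) (simp_all add: wt_def ee_def corr_def field_simps)

lemma ee_EI:
  assumes "i < 32" "j < 14" "k < 14"
  shows "3 * 33495^3 * ee (i = 0) (j = 0) (k = 0) (dir dirs_A i) (dir dirs_B j) (dir dirs_B k)
    = of_int (EI (dirs_A ! i) (dirs_B ! j) (dirs_B ! k)) - (if i = 0 \<and> j = 0 \<and> k = 0 then of_int (EI (dirs_A ! 0) (dirs_B ! 0) (dirs_B ! 0)) else 0)"
proof -
  have z: "dirs_A ! i ! 0 = 0" if "i \<noteq> 0" "i < 32" for i
    using dirs_unit(3) that dirs_shape unfolding list_all_length by (cases i) (auto simp: nth_tl)
  have z': "dirs_B ! i ! 0 = 0" if "i \<noteq> 0" "i < 14" for i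
    using dirs_unit(4) that dirs_shape unfolding list_all_length by (cases i) (auto simp: nth_tl)
  show ?thesis using assms z[of i] z'[of j] z'[of k] dirs_shape
    by (cases "i = 0"; cases "j = 0"; cases "k = 0")
      (simp_all add: ee_def EI_def E1_def E2_def E3_def dir_def dirs_unit(1,2) field_simps power3_eq_cube)
qed

definition quantum_value :: real where
  "quantum_value = (\<Sum>i<32. \<Sum>j<14. \<Sum>k<14. of_int (tn i j k) *
     ee (i = 0) (j = 0) (k = 0) (dir dirs_A i) (dir dirs_B j) (dir dirs_B k))"

text \<open>Without a constant term the Bell value of the noisy state is exactly proportional to
  \<open>v\<close>.\<close>

lemma tn_000: "tn 0 0 0 = 0"
  unfolding tn_def tens_lit by (simp add: D_defs)

lemma quantum_value: "3 * 33495^3 * quantum_value = 5361295981885345452"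
proof -
  have "3 * 33495^3 * quantum_value = (\<Sum>i<32. \<Sum>j<14. \<Sum>k<14. of_int (tn i j k) *
     (3 * 33495^3 * ee (i = 0) (j = 0) (k = 0) (dir dirs_A i) (dir dirs_B j) (dir dirs_B k)))"
    unfolding quantum_value_def sum_distrib_left by (intro sum.cong refl) (simp only: mult.left_commute)
  also have "\<dots> = (\<Sum>i<32. \<Sum>j<14. \<Sum>k<14. of_int (tn i j k * EI (dirs_A ! i) (dirs_B ! j) (dirs_B ! k)))"
    by (intro sum.cong refl) (simp only: lessThan_iff ee_EI of_int_mult, auto simp: tn_000)
  also have "\<dots> = of_int (\<Sum>i<32. qrow (tens ! i) (dirs_A ! i))"
    by (simp only: of_int_sum[symmetric]) (simp add: qrow_sum)
  also have "(\<Sum>i<32. qrow (tens ! i) (dirs_A ! i)) = sum_list (map2 qrow tens dirs_A)"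
    by (simp add: sum_list_sum_nth dirs_shape tens_props(1) atLeast0LessThan)
  finally show ?thesis unfolding qtotal by simp
qed

section \<open>Local models\<close>

lemma two_point:
  assumes "response_function M p" "norm x = 1" "l \<in> space M"
  shows "\<bar>\<Sum>a\<in>{1, - 1}. wt c a * p l a x\<bar> \<le> 1" "(\<Sum>a\<in>{1, - 1}. wt True a * p l a x) = 1"
    "a \<in> {1, - 1} \<Longrightarrow> 0 \<le> p l a x \<and> p l a x \<le> 1"
proof -
  have *: "0 \<le> p l 1 x" "0 \<le> p l (- 1) x" "p l 1 x + p l (- 1) x = 1"
    using assms unfolding response_function_def by auto
  then show "\<bar>\<Sum>a\<in>{1, - 1}. wt c a * p l a x\<bar> \<le> 1" "(\<Sum>a\<in>{1, - 1}. wt True a * p l a x) = 1"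
    "a \<in> {1, - 1} \<Longrightarrow> 0 \<le> p l a x \<and> p l a x \<le> 1"
    by (auto simp: wt_def)
qed

text \<open>For each hidden variable the mean outcomes lie in [-1, 1], so \<open>S_bound\<close>
  applies pointwise. Integration preserves the bound, and by linearity the integral is the Bell
  value of the state.\<close>

lemma local_visibility:
  assumes F: "\<And>b c. strat b \<Longrightarrow> strat c \<Longrightarrow> F b c \<le> 26072"
    and loc: "local_projective TYPE('l) (rho_W3 v)"
  shows "v * quantum_value \<le> 26072"
proof -
  obtain M :: "'l measure" and p1 p2 p3 where M: "prob_space M"
    and p: "response_function M p1" "response_function M p2" "response_function M p3"
    and eq: "\<And>a b c x y z. a \<in> {1, - 1} \<Longrightarrow> b \<in> {1, - 1} \<Longrightarrow> c \<in> {1, - 1} \<Longrightarrow> norm x = 1 \<Longrightarrow>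
       norm y = 1 \<Longrightarrow> norm z = 1 \<Longrightarrow> outcome_prob (rho_W3 v) a b c x y z =
         complex_of_real (\<integral>l. p1 l a x * p2 l b y * p3 l c z \<partial>M)"
    using loc unfolding local_projective_def by blast
  interpret prob_space M by (rule M)
  note nA = norm_dir[OF dirs_unit(3)] and nB = norm_dir[OF dirs_unit(4)]
  define P where "P i j k a b c l = p1 l a (dir dirs_A i) * p2 l b (dir dirs_B j) * p3 l c (dir dirs_B k)"
    for i j k a b c l
  have int: "integrable M (P i j k a b c)" if abc: "a \<in> {1, - 1}" "b \<in> {1, - 1}" "c \<in> {1, - 1}" for i j k a b c
  proof (rule integrable_const_bound[where B = 1])
    have m: "(\<lambda>l. q l e x) \<in> borel_measurable M"
      if "response_function M q" "norm x = 1" "e \<in> {1, - 1}" for q and e :: real and x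
      using that unfolding response_function_def by blast
    show "P i j k a b c \<in> borel_measurable M"
      unfolding P_def using m[OF p(1) nA abc(1)] m[OF p(2) nB abc(2)] m[OF p(3) nB abc(3)]
      by (intro borel_measurable_times)
    show "AE l in M. norm (P i j k a b c l) \<le> 1"
    proof (rule AE_I2)
      fix l assume l: "l \<in> space M"
      show "norm (P i j k a b c l) \<le> 1"
        unfolding P_def using two_point(3)[OF p(1) nA l abc(1), of i] two_point(3)[OF p(2) nB l abc(2), of j]
          two_point(3)[OF p(3) nB l abc(3), of k]
        by (simp add: abs_mult mult_le_one)
    qed
  qed
  have val: "(\<integral>l. P i j k a b c l \<partial>M) = corr v a b c (dir dirs_A i) (dir dirs_B j) (dir dirs_B k) / 8"
    if abc: "a \<in> {1, - 1}" "b \<in> {1, - 1}" "c \<in> {1, - 1}" for i j k a b c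
    using eq[OF abc nA nB nB, of i j k] unfolding outcome_prob_rho_W3 P_def of_real_eq_iff by simp
  \<comment> \<open>Mean outcome given the hidden variable; at index 0 the weight is 1 and the mean
    is the total probability 1, as \<open>S_bound\<close> demands.\<close>
  define A where "A l i = (\<Sum>a\<in>{1, - 1}. wt (i = 0) a * p1 l a (dir dirs_A i))" for l i
  define B where "B l i = (\<Sum>a\<in>{1, - 1}. wt (i = 0) a * p2 l a (dir dirs_B i))" for l i
  define C where "C l i = (\<Sum>a\<in>{1, - 1}. wt (i = 0) a * p3 l a (dir dirs_B i))" for l i
  let ?R = "\<lambda>i j k l. \<Sum>a\<in>{1, - 1}. \<Sum>b\<in>{1, - 1}. \<Sum>c\<in>{1, - 1}.
    wt (i = 0) a * wt (j = 0) b * wt (k = 0) c * P i j k a b c l"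
  have prod: "A l i * B l j * C l k = ?R i j k l" for l i j k
    unfolding A_def B_def C_def P_def by (simp add: algebra_simps)
  have intR: "integrable M (?R i j k)" for i j k
    by (intro Bochner_Integration.integrable_sum integrable_mult_right int) auto
  have ABC: "(\<integral>l. ?R i j k l \<partial>M) = (if i = 0 \<and> j = 0 \<and> k = 0 then 1 else 0)
      + v * ee (i = 0) (j = 0) (k = 0) (dir dirs_A i) (dir dirs_B j) (dir dirs_B k)" for i j k
  proof -
    have "(\<integral>l. ?R i j k l \<partial>M) = (\<Sum>a\<in>{1, - 1}. \<Sum>b\<in>{1, - 1}. \<Sum>c\<in>{1, - 1}.
        wt (i = 0) a * wt (j = 0) b * wt (k = 0) c * (\<integral>l. P i j k a b c l \<partial>M))"
      by (subst Bochner_Integration.integral_sum,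
          (intro Bochner_Integration.integrable_sum integrable_mult_right int; simp),
          intro sum.cong refl)+ simp
    also have "\<dots> = (\<Sum>a\<in>{1, - 1}. \<Sum>b\<in>{1, - 1}. \<Sum>c\<in>{1, - 1}. wt (i = 0) a * wt (j = 0) b * wt (k = 0) c *
        (corr v a b c (dir dirs_A i) (dir dirs_B j) (dir dirs_B k) / 8))"
      by (intro sum.cong refl) (simp only: val)
    also note corr_sum
    finally show ?thesis .
  qed
  have S: "S (A l) (B l) (C l) = (\<Sum>i<32. \<Sum>j<14. \<Sum>k<14. of_int (tn i j k) * ?R i j k l)" for l
    unfolding S_def prod[symmetric] by (simp add: mult.assoc)
  have "integrable M (\<lambda>l. S (A l) (B l) (C l))"
    unfolding S by (intro Bochner_Integration.integrable_sum integrable_mult_right intR)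
  moreover have "AE l in M. S (A l) (B l) (C l) \<le> 26072"
  proof (rule AE_I2)
    fix l assume l: "l \<in> space M"
    show "S (A l) (B l) (C l) \<le> 26072"
      by (rule S_bound[OF F])
        (use two_point(1)[OF p(1) nA l] two_point(1)[OF p(2) nB l] two_point(1)[OF p(3) nB l]
          two_point(2)[OF p(1) nA l, of 0] two_point(2)[OF p(2) nB l, of 0] two_point(2)[OF p(3) nB l, of 0]
         in \<open>simp_all only: A_def B_def C_def simp_thms\<close>)
  qed
  ultimately have "(\<integral>l. S (A l) (B l) (C l) \<partial>M) \<le> 26072" by (rule integral_le_const)
  also have "(\<integral>l. S (A l) (B l) (C l) \<partial>M) =
      (\<Sum>i<32. \<Sum>j<14. \<Sum>k<14. of_int (tn i j k) * (\<integral>l. ?R i j k l \<partial>M))"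
    unfolding S
    by (simp only: Bochner_Integration.integral_sum Bochner_Integration.integrable_sum
        integrable_mult_right intR integral_mult_right_zero)
  also have "\<dots> = v * quantum_value"
    unfolding ABC quantum_value_def sum_distrib_left
    by (intro sum.cong refl) (auto simp: tn_000 algebra_simps)
  finally show ?thesis by simp
qed

section \<open>The threshold\<close>

text \<open>Ensures that the supremum is taken over a nonempty set. White noise is reproduced by
  fair coins, and a point mass at an arbitrary element gives a probability space over every
  type.\<close>

lemma local_zero: "local_projective TYPE('l) (rho_W3 0)"
proof -
  let ?M = "return (count_space UNIV) (undefined :: 'l)"
  let ?p = "\<lambda>l a x. 1 / 2 :: real"
  interpret prob_space ?M by (rule prob_space_return) simp
  have "response_function ?M ?p" unfolding response_function_def by simp
  moreover have "outcome_prob (rho_W3 0) a b c x y z =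
      complex_of_real (\<integral>l. ?p l a x * ?p l b y * ?p l c z \<partial>?M)" for a b c x y z
    unfolding outcome_prob_rho_W3 using prob_space by (simp add: corr_def)
  ultimately show ?thesis unfolding local_projective_def using prob_space_axioms by blast
qed

lemma sqrt_bounds:
  "2.2360679774 \<le> sqrt 5" "sqrt 5 \<le> 2.2360679775"
  by (rule real_le_rsqrt real_le_lsqrt; simp add: power2_eq_square)+

text \<open>The Bell inequality yields about 0.5482337, which is 2e-6 below the lower end here, so
  ten decimals of \<open>sqrt 5\<close> are ample. The nested root is enclosed by squaring
  integers.\<close>

lemma W3_bound_bounds: "0.5482357203 \<le> W3_bound" "W3_bound \<le> 0.5482357206"
proof -
  let ?C = "565536694605181420689075 + 230287482340357705773330 * sqrt 5"
  let ?r = "sqrt ?C"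
  have 1: "1039459070604 \<le> ?r"
    by (rule real_le_rsqrt) (use sqrt_bounds(1) in simp)
  have 2: "?r \<le> 1039459070616"
    by (rule real_le_lsqrt) (use sqrt_bounds in simp_all)
  have pos: "0 < 314450816715 + 210987849189 * sqrt 5 + ?r"
    using 1 sqrt_bounds by linarith
  show "0.5482357203 \<le> W3_bound" unfolding W3_bound_def
    using 2 sqrt_bounds pos by (simp add: le_divide_eq)
  show "W3_bound \<le> 0.5482357206" unfolding W3_bound_def
    using 1 sqrt_bounds pos by (simp add: divide_le_eq)
qed

lemma forest_checked: "rf PNone PNone forest (map row seq) base"
  using run_0 run_1 unfolding run_def by (simp add: forest_def seq_def)

theorem mainTheorem6:
  shows "W3_threshold TYPE('l) \<le> W3_bound \<and> \<bar>W3_bound - 0.548236\<bar> < 0.0000005"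
proof
  have "v \<le> W3_bound" if "local_projective TYPE('l) (rho_W3 v)" for v
  proof -
    have "v * quantum_value \<le> 26072"
      by (rule local_visibility[OF local_bound[OF forest_checked] that])
    then have "v * (3 * 33495^3 * quantum_value) \<le> 26072 * (3 * 33495^3)"
      by (simp add: mult_ac)
    \<comment> \<open>After multiplication by \<open>3 * 33495^3\<close> this compares integers with
      a decimal fraction; the true quotient is about 0.5482337.\<close>
    then have "v \<le> 0.5482357203"
      unfolding quantum_value by simp
    then show ?thesis using W3_bound_bounds(1) by linarith
  qed
  moreover have "0 \<in> {v \<in> {0..1}. local_projective TYPE('l) (rho_W3 v)}"
    using local_zero by simp
  ultimately show "W3_threshold TYPE('l) \<le> W3_bound"
    unfolding W3_threshold_def by (intro cSup_least) blast+
  show "\<bar>W3_bound - 0.548236\<bar> < 0.0000005"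
    using W3_bound_bounds by (simp add: abs_less_iff)
qed

end
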